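(* Let $\mathbb{G}$ be a stratified Lie group of homogeneous dimension $Q$, let $0<\beta<1$, $b\in L^1_{\rm loc}(\mathbb{G})$, let $\Phi,\Psi$ be Young functions, and assume $\Phi\in\mathcal{Y}$. 1. If there is a constant $C>0$ such that $t^{-\beta/Q}\,\Phi^{-1}(t)\le C\,\Psi^{-1}(t)$ for all $t>0$, then the condition $b\in\dot{\Lambda}_{\beta}(\mathbb{G})$ is sufficient for the boundedness of the maximal commutator $M_b$ from $L^{\Phi}(\mathbb{G})$ to $WL^{\Psi}(\mathbb{G})$. 2. If there is a constant $C>0$ such that $\Psi^{-1}(t)\le C\,\Phi^{-1}(t)\,t^{-\beta/Q}$ for all $t>0$, and $\frac{t^{1+\varepsilon}}{\Psi(t)}$ is almost decreasing for some $\varepsilon>0$, then the condition $b\in\dot{\Lambda}_{\beta}(\mathbb{G})$ is necessary for the boundedness of $M_b$ from $L^{\Phi}(\mathbb{G})$ to $WL^{\Psi}(\mathbb{G})$. 3. If $\Psi^{-1}(t)\approx\Phi^{-1}(t)\,t^{-\beta/Q}$ (i.e. each side is bounded by a constant times the other, with constants independent of $t>0$), and $\frac{t^{1+\varepsilon}}{\Psi(t)}$ is almost decreasing for some $\varepsilon>0$, then the condition $b\in\dot{\Lambda}_{\beta}(\mathbb{G})$ is necessary and sufficient for the boundedness of $M_b$ from $L^{\Phi}(\mathbb{G})$ to $WL^{\Psi}(\mathbb{G})$.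
   Context: **Stratified group.** $\mathbb{G}$ is the simply connected Lie group of a finite-dimensional real nilpotent Lie algebra $\mathcal{G}=V_1\oplus\cdots\oplus V_m$ with $[V_1,V_j]=V_{j+1}$ for $1\le j<m$ and $[V_1,V_m]=0$. The exponential map is a global diffeomorphism; dilations are $\delta_r(\exp\sum_j v_j)=\exp(\sum_j r^j v_j)$, $v_j\in V_j$, $r>0$. The homogeneous dimension is $Q=\sum_{j=1}^m j\dim V_j$. Haar measure $dx$ is the push-forward of Lebesgue measure by $\exp$; $|E|$ is the Haar measure of $E$. Fix a homogeneous norm $\rho:\mathbb{G}\to[0,\infty)$: continuous, $C^\infty$ away from the identity $e$, $\rho(x^{-1})=\rho(x)$, $\rho(\delta_t x)=t\rho(x)$ for $t>0$, $\rho(x)=0$ iff $x=e$, and $\rho(xy)\le c_0(\rho(x)+\rho(y))$ for some $c_0\ge1$. Balls are $B(x,r)=\{y\in\mathbb{G}:\rho(y^{-1}x)<r\}$, and $|B(x,r)|=c_1 r^Q$. **Young functions.** A Young function is a convex, left-continuous $\Phi:[0,\infty)\to[0,\infty]$ with $\lim_{r\to0+}\Phi(r)=\Phi(0)=0$ and $\lim_{r\to\infty}\Phi(r)=\infty$. $\mathcal{Y}$ is the set of Young functions with $0<\Phi(r)<\infty$ for $0<r<\infty$. $\Phi^{-1}(s)=\inf\{r\ge0:\Phi(r)>s\}$. A function $g:(0,\infty)\to[0,\infty]$ is almost decreasing if there is $C>0$ with $g(t)\le C g(s)$ whenever $0<s\le t$ (with $t^{1+\varepsilon}/0=\infty$,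 $t^{1+\varepsilon}/\infty=0$). **Orlicz and weak Orlicz spaces.** $L^{\Phi}(\mathbb{G})$ is the set of $f\in L^1_{\rm loc}(\mathbb{G})$ with $\int_{\mathbb{G}}\Phi(k|f(x)|)dx<\infty$ for some $k>0$, with norm $\|f\|_{L^\Phi}=\inf\{\lambda>0:\int_{\mathbb{G}}\Phi(|f(x)|/\lambda)dx\le1\}$. With $m(f,t)=|\{x\in\mathbb{G}:|f(x)|>t\}|$, $WL^\Psi(\mathbb{G})$ is the set of $f\in L^1_{\rm loc}(\mathbb{G})$ with $\|f\|_{WL^\Psi}=\inf\{\lambda>0:\sup_{t>0}\Psi(t)\,m(f/\lambda,t)\le1\}<\infty$ (with $\infty\cdot0=0$). **Lipschitz space.** $b\in\dot{\Lambda}_\beta(\mathbb{G})$ means there is $C$ with $|b(x)-b(y)|\le C\rho(y^{-1}x)^\beta$ for all $x,y\in\mathbb{G}$. Locally integrable functions are identified when equal almost everywhere, so $b\in\dot\Lambda_\beta$ means $b$ agrees a.e. with such a function. **Maximal commutator.** $M_b f(x)=\sup_{B\ni x}|B|^{-1}\int_B|b(x)-b(y)||f(y)|dy$, the supremum over all balls $B$ containing $x$. **Boundedness.** $M_b$ is bounded from $L^\Phi(\mathbb{G})$ to $WL^\Psi(\mathbb{G})$ if there is $C$ with $\|M_bf\|_{WL^\Psi}\le C\|f\|_{L^\Phi}$ for all $f\in L^\Phi(\mathbb{G})$. *)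

theory Defs
  imports "HOL-Analysis.Analysis"
begin

section \<open>Smooth maps between Euclidean spaces\<close>

text \<open>Only used on open sets.\<close>

primrec Ck_on :: "nat \<Rightarrow> ('a::euclidean_space \<Rightarrow> 'b::real_normed_vector) \<Rightarrow> 'a set \<Rightarrow> bool" where
  "Ck_on 0 f S \<longleftrightarrow> continuous_on S f"
| "Ck_on (Suc k) f S \<longleftrightarrow>
     (\<forall>x\<in>S. f differentiable (at x)) \<and>
     (\<forall>v. Ck_on k (\<lambda>x. frechet_derivative f (at x) v) S)"

definition smooth_on :: "('a::euclidean_space \<Rightarrow> 'b::real_normed_vector) \<Rightarrow> 'a set \<Rightarrow> bool" where
  "smooth_on f S \<longleftrightarrow> (\<forall>k. Ck_on k f S)"

section \<open>Stratified Lie algebras and their simply connected Lie groups\<close>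

definition lie_algebra :: "('a::euclidean_space \<Rightarrow> 'a \<Rightarrow> 'a) \<Rightarrow> bool" where
  "lie_algebra br \<longleftrightarrow>
     bilinear br \<and> (\<forall>x. br x x = 0) \<and>
     (\<forall>x y z. br x (br y z) + br y (br z x) + br z (br x y) = 0)"

definition stratification ::
    "('a::euclidean_space \<Rightarrow> 'a \<Rightarrow> 'a) \<Rightarrow> (nat \<Rightarrow> 'a set) \<Rightarrow> nat \<Rightarrow> bool" where
  "stratification br V m \<longleftrightarrow>
     1 \<le> m \<and>
     (\<forall>j\<in>{1..m}. subspace (V j)) \<and>
     (\<forall>x. \<exists>!v. v \<in> (\<Pi>\<^sub>E j\<in>{1..m}. V j) \<and> (\<Sum>j=1..m. v j) = x) \<and>
     (\<forall>j. 1 \<le> j \<and> j < m \<longrightarrow> V (Suc j) = span {br x y | x y. x \<in> V 1 \<and> y \<in> V j}) \<and>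
     (\<forall>x\<in>V 1. \<forall>y\<in>V m. br x y = 0)"

text \<open>
  The exponential map of the simply connected Lie group of a nilpotent Lie algebra is a
  diffeomorphism. We use it to identify the group with the vector space \<open>'a\<close> underlying its Lie
  algebra: \<open>mul x y\<close> stands for the product of \<open>exp x\<close> and \<open>exp y\<close>, and \<open>exp\<close> becomes the identity
  map. Hence the neutral element is \<open>0\<close> and the inverse of \<open>x\<close> is \<open>- x\<close>.
\<close>

text \<open>\<open>Ad mul g\<close> is the derivative at the neutral element of conjugation by \<open>g\<close>; the bracket of the
  Lie algebra of the group is the derivative of \<open>Ad\<close> at the neutral element.\<close>

definition Ad :: "('a::euclidean_space \<Rightarrow> 'a \<Rightarrow> 'a) \<Rightarrow> 'a \<Rightarrow> 'a \<Rightarrow> 'a" where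
  "Ad mul g v = frechet_derivative (\<lambda>h. mul (mul g h) (- g)) (at 0) v"

definition group_bracket :: "('a::euclidean_space \<Rightarrow> 'a \<Rightarrow> 'a) \<Rightarrow> 'a \<Rightarrow> 'a \<Rightarrow> 'a" where
  "group_bracket mul x y = frechet_derivative (\<lambda>g. Ad mul g y) (at 0) x"

text \<open>\<open>mul\<close> is a Lie group law on \<open>'a\<close> whose Lie algebra is \<open>('a, br)\<close> and whose exponential map is
  the identity, i.e. the one-parameter subgroup with initial velocity \<open>v\<close> is \<open>t \<mapsto> t v\<close>.\<close>

definition exponential_lie_group ::
    "('a::euclidean_space \<Rightarrow> 'a \<Rightarrow> 'a) \<Rightarrow> ('a \<Rightarrow> 'a \<Rightarrow> 'a) \<Rightarrow> bool" where
  "exponential_lie_group mul br \<longleftrightarrow>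
     group mul 0 uminus \<and>
     smooth_on (\<lambda>(x, y). mul x y) UNIV \<and>
     (\<forall>v s t. mul (s *\<^sub>R v) (t *\<^sub>R v) = (s + t) *\<^sub>R v) \<and>
     (\<forall>x y. group_bracket mul x y = br x y)"

definition stratified_lie_group ::
    "('a::euclidean_space \<Rightarrow> 'a \<Rightarrow> 'a) \<Rightarrow> ('a \<Rightarrow> 'a \<Rightarrow> 'a) \<Rightarrow> (nat \<Rightarrow> 'a set) \<Rightarrow> nat \<Rightarrow> bool" where
  "stratified_lie_group mul br V m \<longleftrightarrow>
     lie_algebra br \<and> stratification br V m \<and> exponential_lie_group mul br"

definition homogeneous_dim :: "(nat \<Rightarrow> 'a::euclidean_space set) \<Rightarrow> nat \<Rightarrow> nat" where
  "homogeneous_dim V m = (\<Sum>j=1..m. j * dim (V j))"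

definition layers :: "(nat \<Rightarrow> 'a::euclidean_space set) \<Rightarrow> nat \<Rightarrow> 'a \<Rightarrow> nat \<Rightarrow> 'a" where
  "layers V m x = (THE v. v \<in> (\<Pi>\<^sub>E j\<in>{1..m}. V j) \<and> (\<Sum>j=1..m. v j) = x)"

definition dilation :: "(nat \<Rightarrow> 'a::euclidean_space set) \<Rightarrow> nat \<Rightarrow> real \<Rightarrow> 'a \<Rightarrow> 'a" where
  "dilation V m r x = (\<Sum>j=1..m. r ^ j *\<^sub>R layers V m x j)"

definition homogeneous_norm ::
    "('a::euclidean_space \<Rightarrow> 'a \<Rightarrow> 'a) \<Rightarrow> (nat \<Rightarrow> 'a set) \<Rightarrow> nat \<Rightarrow> ('a \<Rightarrow> real) \<Rightarrow> bool" where
  "homogeneous_norm mul V m \<rho> \<longleftrightarrow>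
     (\<forall>x. 0 \<le> \<rho> x) \<and>
     continuous_on UNIV \<rho> \<and>
     smooth_on \<rho> (- {0}) \<and>
     (\<forall>x. \<rho> (- x) = \<rho> x) \<and>
     (\<forall>t x. 0 < t \<longrightarrow> \<rho> (dilation V m t x) = t * \<rho> x) \<and>
     (\<forall>x. \<rho> x = 0 \<longleftrightarrow> x = 0) \<and>
     (\<exists>c\<^sub>0\<ge>1. \<forall>x y. \<rho> (mul x y) \<le> c\<^sub>0 * (\<rho> x + \<rho> y))"

definition hball ::
    "('a::euclidean_space \<Rightarrow> 'a \<Rightarrow> 'a) \<Rightarrow> ('a \<Rightarrow> real) \<Rightarrow> 'a \<Rightarrow> real \<Rightarrow> 'a set" where
  "hball mul \<rho> x r = {y. \<rho> (mul (- y) x) < r}"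

section \<open>Young functions\<close>

text \<open>A function \<open>[0,\<infinity>) \<rightarrow> [0,\<infinity>]\<close> is represented by a function \<open>real \<Rightarrow> ennreal\<close> of which only the
  values at nonnegative arguments matter. In \<^typ>\<open>ennreal\<close>, \<open>\<infinity> \<cdot> 0 = 0\<close>, \<open>s / 0 = \<infinity>\<close> for \<open>s > 0\<close>,
  \<open>s / \<infinity> = 0\<close> for finite \<open>s\<close>, and the infimum of the empty set is \<open>\<infinity>\<close>.\<close>

definition young_function :: "(real \<Rightarrow> ennreal) \<Rightarrow> bool" where
  "young_function \<Phi> \<longleftrightarrow>
     (\<forall>r\<ge>0. \<forall>s\<ge>0. \<forall>u\<in>{0..1}.
        \<Phi> ((1 - u) * r + u * s) \<le> ennreal (1 - u) * \<Phi> r + ennreal u * \<Phi> s) \<and>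
     (\<forall>r>0. (\<Phi> \<longlongrightarrow> \<Phi> r) (at_left r)) \<and>
     \<Phi> 0 = 0 \<and>
     (\<Phi> \<longlongrightarrow> 0) (at_right 0) \<and>
     (\<Phi> \<longlongrightarrow> \<infinity>) at_top"

definition young_class_Y :: "(real \<Rightarrow> ennreal) set" where
  "young_class_Y = {\<Phi>. young_function \<Phi> \<and> (\<forall>r>0. 0 < \<Phi> r \<and> \<Phi> r < \<infinity>)}"

text \<open>Used for finite \<open>s \<ge> 0\<close> only, where the set is nonempty because \<open>\<Phi> r \<rightarrow> \<infinity>\<close>.\<close>

definition young_inverse :: "(real \<Rightarrow> ennreal) \<Rightarrow> real \<Rightarrow> real" where
  "young_inverse \<Phi> s = Inf {r. 0 \<le> r \<and> ennreal s < \<Phi> r}"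

definition almost_decreasing :: "(real \<Rightarrow> ennreal) \<Rightarrow> bool" where
  "almost_decreasing g \<longleftrightarrow> (\<exists>C>0. \<forall>s t. 0 < s \<and> s \<le> t \<longrightarrow> g t \<le> ennreal C * g s)"

section \<open>Function spaces\<close>

text \<open>The push-forward of Lebesgue measure by the exponential map is \<^term>\<open>lebesgue\<close> itself.\<close>

definition L1_loc :: "('a::euclidean_space \<Rightarrow> real) set" where
  "L1_loc = {f. \<forall>K. compact K \<longrightarrow> set_integrable lebesgue K f}"

definition orlicz_space :: "(real \<Rightarrow> ennreal) \<Rightarrow> ('a::euclidean_space \<Rightarrow> real) set" where
  "orlicz_space \<Phi> = {f \<in> L1_loc. \<exists>k>0. (\<integral>\<^sup>+x. \<Phi> (k * \<bar>f x\<bar>) \<partial>lebesgue) < \<infinity>}"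

definition orlicz_norm :: "(real \<Rightarrow> ennreal) \<Rightarrow> ('a::euclidean_space \<Rightarrow> real) \<Rightarrow> ennreal" where
  "orlicz_norm \<Phi> f = Inf {ennreal l | l. 0 < l \<and> (\<integral>\<^sup>+x. \<Phi> (\<bar>f x\<bar> / l) \<partial>lebesgue) \<le> 1}"

text \<open>Distribution function and weak Orlicz quasinorm of a \<open>[0,\<infinity>]\<close>-valued function; maximal
  functions may take the value \<open>\<infinity>\<close>.\<close>

definition distribution :: "('a::euclidean_space \<Rightarrow> ennreal) \<Rightarrow> real \<Rightarrow> ennreal" where
  "distribution f t = emeasure lebesgue {x. ennreal t < f x}"

definition weak_orlicz_norm :: "(real \<Rightarrow> ennreal) \<Rightarrow> ('a::euclidean_space \<Rightarrow> ennreal) \<Rightarrow> ennreal" where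
  "weak_orlicz_norm \<Psi> f =
     Inf {ennreal l | l. 0 < l \<and>
       (SUP t\<in>{0<..}. \<Psi> t * distribution (\<lambda>x. f x / ennreal l) t) \<le> 1}"

definition lipschitz_space ::
    "('a::euclidean_space \<Rightarrow> 'a \<Rightarrow> 'a) \<Rightarrow> ('a \<Rightarrow> real) \<Rightarrow> real \<Rightarrow> ('a \<Rightarrow> real) set" where
  "lipschitz_space mul \<rho> \<beta> =
     {b. \<exists>b'. (AE x in lebesgue. b x = b' x) \<and>
          (\<exists>C. \<forall>x y. \<bar>b' x - b' y\<bar> \<le> C * \<rho> (mul (- y) x) powr \<beta>)}"

section \<open>The maximal commutator\<close>

definition maximal_commutator ::
    "('a::euclidean_space \<Rightarrow> 'a \<Rightarrow> 'a) \<Rightarrow> ('a \<Rightarrow> real) \<Rightarrow> ('a \<Rightarrow> real) \<Rightarrow> ('a \<Rightarrow> real) \<Rightarrow> 'a \<Rightarrow> ennreal"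
  where
  "maximal_commutator mul \<rho> b f x =
     (SUP B\<in>{hball mul \<rho> z r | z r. 0 < r \<and> x \<in> hball mul \<rho> z r}.
        (\<integral>\<^sup>+y\<in>B. ennreal (\<bar>b x - b y\<bar> * \<bar>f y\<bar>) \<partial>lebesgue) / emeasure lebesgue B)"

definition bounded_orlicz_weak_orlicz ::
    "(real \<Rightarrow> ennreal) \<Rightarrow> (real \<Rightarrow> ennreal) \<Rightarrow>
     (('a::euclidean_space \<Rightarrow> real) \<Rightarrow> 'a \<Rightarrow> ennreal) \<Rightarrow> bool" where
  "bounded_orlicz_weak_orlicz \<Phi> \<Psi> T \<longleftrightarrow>
     (\<exists>C>0. \<forall>f\<in>orlicz_space \<Phi>. weak_orlicz_norm \<Psi> (T f) \<le> ennreal C * orlicz_norm \<Phi> f)"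

end

theory Submission
  imports Defs
begin

text \<open>Write \<open>Q\<close> for the homogeneous dimension, \<open>\<gamma> = \<beta> / Q\<close>, and \<open>B\<close> for balls. Everything rests on two
  facts about balls: \<open>|B(x, r)| = c r^Q\<close>, and the Vitali covering lemma, which follows from the
  quasi-triangle inequality.

  \<^emph>\<open>Volume of balls.\<close> Balls are left translates of dilates of the unit ball, so the left invariance
  of Lebesgue measure and the determinant \<open>r^Q\<close> of the dilation suffice (\<open>emeasure_B\<close>). For left
  invariance the differentials of the left translations must have determinant \<open>\<plusminus>1\<close>. In
  exponential coordinates this is a statement about the differential of \<open>exp\<close>. Cutting the
  segment from \<open>0\<close> to \<open>x\<close> into \<open>n\<close> equal pieces expresses that differential as the average of the maps
  \<open>Ad (- (k / n) x)\<close>, \<open>k < n\<close>, composed with the same differential at \<open>x / n\<close>. As \<open>n\<close> grows, the second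
  factor tends to the identity. The average is unipotent with respect to the gradation, since \<open>Ad\<close> is the
  exponential of the degree raising map \<open>ad\<close>, and a unipotent map has determinant 1 because
  conjugation with dilations deforms it into the identity (\<open>absdet_unipotent\<close>, \<open>absdet_dleft\<close>).

  \<^emph>\<open>Sufficiency.\<close> If \<open>b\<close> is Lipschitz, then \<open>M\<^sub>b f\<close> is dominated by a fractional maximal function. For a
  ball of volume \<open>v\<close> let \<open>u\<close> be the mean of \<open>\<Phi>(|f|)\<close>. Convexity bounds the mean of \<open>|f|\<close> by
  \<open>2 \<Phi>\<inverse>(u)\<close>, and \<open>u \<le> 1 / v\<close> if \<open>f\<close> is normalised, so that \<open>v^\<gamma>\<close> times the mean of \<open>|f|\<close> is at most
  \<open>2 u^(-\<gamma>) \<Phi>\<inverse>(u) \<le> 2 C \<Psi>\<inverse>(u)\<close>. If this exceeds \<open>2 C t\<close>, then \<open>\<Psi>(t) \<le> u\<close>: the superlevel set of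
  \<open>M\<^sub>b f\<close> is covered by balls on which the mean of \<open>\<Phi>(|f|)\<close> is at least \<open>\<Psi>(t)\<close>, and the weak type
  inequality for the maximal function of \<open>\<Phi>(|f|)\<close> finishes the proof (\<open>fractional_average_bound\<close>,
  \<open>weak_type_maximal\<close>, \<open>lipschitz_sufficient\<close>).

  \<^emph>\<open>Necessity.\<close> On a ball of volume \<open>v\<close>, \<open>M\<^sub>b\<close> applied to the indicator of the ball is at least the mean
  of \<open>y \<mapsto> |b x - b y|\<close>. Boundedness controls its distribution function by \<open>1 / \<Psi>\<close>. Almost
  monotonicity of \<open>t^(1+\<epsilon>) / \<Psi>(t)\<close> makes a dyadic layer cake sum converge, so that the mean oscillation
  of \<open>b\<close> on the ball is at most a constant times \<open>\<Psi>\<inverse>(1/v) / \<Phi>\<inverse>(1/v) \<le> C v^\<gamma>\<close>, that is, at most a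
  constant times \<open>r^\<beta>\<close> (\<open>oscillation_bound\<close>). Then the means of \<open>b\<close> over shrinking balls converge to a
  Lipschitz function, which is \<open>b\<close> almost everywhere (\<open>campanato_lipschitz\<close>).\<close>

section \<open>Determinants and volume on a Euclidean space\<close>

text \<open>The change of variables theorem is about \<open>real ^ 'n\<close> with a well-ordered finite index type. The
  type \<open>'a coord\<close> indexes a basis of \<open>'a\<close>, and so transports the theorem to every Euclidean space.\<close>

typedef (overloaded) ('a::euclidean_space) coord = "{..<DIM('a)}"
  by (intro exI[of _ 0]) auto

instance coord :: (euclidean_space) finite
proof
  have "finite (Abs_coord ` {..<DIM('a)} :: 'a coord set)"
    by simp
  then show "finite (UNIV :: 'a coord set)"
    by (simp only: type_definition.Abs_image[OF type_definition_coord])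
qed

instantiation coord :: (euclidean_space) wellorder
begin

definition less_eq_coord :: "'a coord \<Rightarrow> 'a coord \<Rightarrow> bool" where
  "less_eq_coord i j \<longleftrightarrow> Rep_coord i \<le> Rep_coord j"

definition less_coord :: "'a coord \<Rightarrow> 'a coord \<Rightarrow> bool" where
  "less_coord i j \<longleftrightarrow> Rep_coord i < Rep_coord j"

instance
proof
  fix P :: "'a coord \<Rightarrow> bool" and i :: "'a coord"
  assume step: "\<And>i. (\<And>j. j < i \<Longrightarrow> P j) \<Longrightarrow> P i"
  show "P i"
    by (induction i rule: measure_induct_rule[where f = Rep_coord])
       (metis step less_coord_def)
qed (auto simp: less_eq_coord_def less_coord_def Rep_coord_inject)

end

definition basis_vec :: "'a coord \<Rightarrow> 'a::euclidean_space" where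
  "basis_vec = (SOME e. bij_betw e UNIV Basis)"

lemma bij_basis_vec: "bij_betw (basis_vec :: 'a coord \<Rightarrow> 'a::euclidean_space) UNIV Basis"
proof -
  have "card (UNIV :: 'a coord set) = DIM('a)"
    by (simp only: type_definition.card[OF type_definition_coord] card_lessThan)
  then have "\<exists>e :: 'a coord \<Rightarrow> 'a. bij_betw e UNIV Basis"
    by (intro finite_same_card_bij) auto
  then show ?thesis
    unfolding basis_vec_def by (rule someI_ex)
qed

definition to_vec :: "'a::euclidean_space \<Rightarrow> real ^ 'a coord" where
  "to_vec x = (\<chi> i. x \<bullet> basis_vec i)"

definition of_vec :: "real ^ 'a coord \<Rightarrow> 'a::euclidean_space" where
  "of_vec v = (\<Sum>i\<in>UNIV. v $ i *\<^sub>R basis_vec i)"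

lemma range_basis_vec: "range (basis_vec :: 'a coord \<Rightarrow> 'a::euclidean_space) = Basis"
  using bij_betw_imp_surj_on[OF bij_basis_vec] .

lemma basis_vec_in_Basis [simp]: "basis_vec i \<in> Basis"
  using bij_betw_imp_surj_on[OF bij_basis_vec] by blast

lemma inner_basis_vec: "(basis_vec i :: 'a::euclidean_space) \<bullet> basis_vec j = (if i = j then 1 else 0)"
  using bij_basis_vec[where 'a='a] by (auto simp: bij_betw_def inj_eq inner_Basis)

lemma to_of_vec [simp]: "to_vec (of_vec v) = v"
  by (simp add: to_vec_def of_vec_def inner_sum_left inner_basis_vec vec_eq_iff if_distrib
      cong: if_cong)

lemma of_to_vec [simp]: "of_vec (to_vec x) = x"
proof -
  have "of_vec (to_vec x) = (\<Sum>b\<in>Basis. (x \<bullet> b) *\<^sub>R b)"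
    unfolding of_vec_def to_vec_def
    using sum.reindex_bij_betw[OF bij_basis_vec, of "\<lambda>b. (x \<bullet> b) *\<^sub>R b"] by simp
  then show ?thesis by (simp add: euclidean_representation)
qed

lemma linear_to_vec: "linear to_vec"
  by (rule linearI) (auto simp: to_vec_def vec_eq_iff inner_add_left)

lemma linear_of_vec: "linear of_vec"
  by (rule linearI)
     (auto simp: of_vec_def scaleR_add_left sum.distrib scaleR_sum_right scaleR_scaleR)

lemma lborel_eq_distr_of_vec: "lborel = distr (lborel :: (real ^ 'a coord) measure) borel
  (of_vec :: _ \<Rightarrow> 'a::euclidean_space)"
proof (rule lborel_eqI)
  fix l u :: 'a
  assume lu: "\<And>b. b \<in> Basis \<Longrightarrow> l \<bullet> b \<le> u \<bullet> b"
  have *: "of_vec -` box l u = box (to_vec l) (to_vec u)"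
  proof -
    have "v \<in> of_vec -` box l u \<longleftrightarrow> v \<in> box (to_vec l) (to_vec u)" for v :: "real ^ 'a coord"
    proof -
      have "(\<forall>b\<in>Basis. l \<bullet> b < of_vec v \<bullet> b \<and> of_vec v \<bullet> b < u \<bullet> b) \<longleftrightarrow>
        (\<forall>i. l \<bullet> basis_vec i < of_vec v \<bullet> basis_vec i \<and> of_vec v \<bullet> basis_vec i < u \<bullet> basis_vec i)"
        using range_basis_vec[where 'a='a] by (metis rangeE rangeI)
      moreover have "of_vec v \<bullet> basis_vec i = v $ i" for i
        using to_of_vec[of v] by (metis to_vec_def vec_lambda_beta)
      ultimately show ?thesis
        by (simp add: box_def[of l u] mem_box_cart to_vec_def)
    qed
    then show ?thesis by blast
  qed
  have "continuous_on UNIV (of_vec :: _ \<Rightarrow> 'a)"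
    using linear_of_vec linear_continuous_on linear_linear by blast
  then have [measurable]: "(of_vec :: _ \<Rightarrow> 'a) \<in> borel_measurable borel"
    by (rule borel_measurable_continuous_onI)
  have "emeasure lborel (box (to_vec l) (to_vec u)) = (\<Prod>b\<in>Basis. (to_vec u - to_vec l) \<bullet> b)"
    using lu range_basis_vec[where 'a='a]
    by (subst emeasure_lborel_box) (auto simp: Basis_vec_def inner_axis to_vec_def)
  also have "(\<Prod>b\<in>Basis. (to_vec u - to_vec l) \<bullet> b) = (\<Prod>i\<in>UNIV. (u - l) \<bullet> basis_vec i)"
  proof -
    have B: "(Basis :: (real ^ 'a coord) set) = range (\<lambda>i. axis i 1)"
      by (auto simp: Basis_vec_def)
    show ?thesis
      by (subst B) (simp add: prod.reindex inj_on_def axis_eq_axis inner_axis to_vec_def inner_diff_left)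
  qed
  also have "(\<Prod>i\<in>UNIV. (u - l) \<bullet> basis_vec i) = (\<Prod>b\<in>Basis. (u - l) \<bullet> b)"
    by (rule prod.reindex_bij_betw[OF bij_basis_vec])
  finally show "emeasure (distr lborel borel of_vec) (box l u) = (\<Prod>b\<in>Basis. (u - l) \<bullet> b)"
    by (simp add: emeasure_distr *)
qed simp

text \<open>The factor by which a linear map scales Lebesgue measure.\<close>

definition absdet :: "('a::euclidean_space \<Rightarrow> 'a) \<Rightarrow> real" where
  "absdet T = \<bar>det (matrix (to_vec \<circ> T \<circ> of_vec))\<bar>"

lemma linear_conj_vec: "linear T \<Longrightarrow> linear (to_vec \<circ> T \<circ> of_vec)"
  by (intro linear_compose linear_to_vec linear_of_vec)

lemma absdet_compose:
  assumes "linear S" "linear T"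
  shows "absdet (S \<circ> T) = absdet S * absdet T"
proof -
  have "to_vec \<circ> (S \<circ> T) \<circ> of_vec = (to_vec \<circ> S \<circ> of_vec) \<circ> (to_vec \<circ> T \<circ> of_vec)"
    by (auto simp: fun_eq_iff)
  then show ?thesis
    using matrix_compose[OF linear_conj_vec[OF assms(2)] linear_conj_vec[OF assms(1)]]
    by (simp add: absdet_def det_mul abs_mult)
qed

lemma absdet_id [simp]: "absdet (\<lambda>x. x) = 1"
proof -
  have "to_vec \<circ> (\<lambda>x. x) \<circ> of_vec = (id :: real ^ 'a coord \<Rightarrow> _)"
    by (auto simp: fun_eq_iff)
  then show ?thesis
    by (simp add: absdet_def matrix_id_mat_1)
qed

lemma absdet_diagonal:
  "absdet (\<lambda>x. \<Sum>b\<in>Basis. (c b * (x \<bullet> b)) *\<^sub>R b) = (\<Prod>b\<in>Basis. \<bar>c b\<bar>)"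
proof -
  let ?T = "\<lambda>x :: 'a. \<Sum>b\<in>Basis. (c b * (x \<bullet> b)) *\<^sub>R b"
  let ?M = "matrix (to_vec \<circ> ?T \<circ> of_vec)"
  have M: "?M $ i $ j = (if i = j then c (basis_vec i) else 0)" for i j
  proof -
    have e: "of_vec (axis j 1) = basis_vec j"
      by (simp add: of_vec_def axis_def if_distrib[of "\<lambda>r. r *\<^sub>R _"] cong: if_cong)
    have B: "basis_vec k \<in> Basis" for k :: "'a coord"
      using bij_basis_vec by (metis bij_betwE UNIV_I)
    have "?M $ i $ j = ?T (basis_vec j) \<bullet> basis_vec i"
      by (simp add: matrix_def e to_vec_def)
    also have "\<dots> = (\<Sum>b\<in>Basis. if b = basis_vec i then c b * (basis_vec j \<bullet> b) else 0)"
      unfolding inner_sum_left by (intro sum.cong) (auto simp: inner_Basis B)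
    also have "\<dots> = c (basis_vec i) * (basis_vec j \<bullet> basis_vec i)"
      using B by simp
    finally show ?thesis by (auto simp: inner_basis_vec)
  qed
  have "det ?M = (\<Prod>i\<in>UNIV. ?M $ i $ i)"
    by (rule det_diagonal) (simp add: M)
  also have "\<dots> = (\<Prod>i\<in>UNIV. c (basis_vec i))"
    by (simp add: M)
  also have "\<dots> = (\<Prod>b\<in>Basis. c b)"
    by (rule prod.reindex_bij_betw[OF bij_basis_vec])
  finally show ?thesis
    by (simp add: absdet_def abs_prod)
qed

lemma tendsto_absdet:
  assumes "\<And>v. ((\<lambda>k. T k v) \<longlongrightarrow> S v) F"
  shows "((\<lambda>k. absdet (T k)) \<longlongrightarrow> absdet S) F"
proof -
  have "((\<lambda>k. matrix (to_vec \<circ> T k \<circ> of_vec) $ i $ j) \<longlongrightarrow> matrix (to_vec \<circ> S \<circ> of_vec) $ i $ j) F"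
    for i j
    by (auto simp: matrix_def to_vec_def intro!: tendsto_intros assms)
  then show ?thesis
    unfolding absdet_def det_def
    by (intro tendsto_rabs tendsto_sum tendsto_mult tendsto_prod tendsto_const)
qed

text \<open>The change of variables inequality of \<open>real ^ 'n\<close>, transported by the isometry \<open>to_vec\<close>. An
  inequality is enough: for invertible maps the inverse gives the converse.\<close>

lemma emeasure_differentiable_image_le:
  fixes f :: "'a::euclidean_space \<Rightarrow> 'a"
  assumes S: "S \<in> sets borel" "emeasure lborel S < \<infinity>" and fS: "f ` S \<in> sets borel"
    and deriv: "\<And>x. x \<in> S \<Longrightarrow> (f has_derivative f' x) (at x)"
    and det: "\<And>x. x \<in> S \<Longrightarrow> absdet (f' x) = c"
  shows "emeasure lborel (f ` S) \<le> ennreal c * emeasure lborel S"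
proof -
  have cont: "continuous_on UNIV (of_vec :: _ \<Rightarrow> 'a)"
    using linear_of_vec linear_continuous_on linear_linear by blast
  then have meas: "(of_vec :: _ \<Rightarrow> 'a) \<in> borel_measurable borel"
    by (rule borel_measurable_continuous_onI)
  have pull: "emeasure lborel X = emeasure lborel (of_vec -` X)" "of_vec -` X \<in> sets borel"
    if X: "X \<in> sets borel" for X :: "'a set"
  proof -
    show "of_vec -` X \<in> sets borel"
      by (rule measurable_sets_borel[OF meas X])
    show "emeasure lborel X = emeasure lborel (of_vec -` X)"
      using X by (subst lborel_eq_distr_of_vec) (simp add: emeasure_distr meas)
  qed
  define g where "g = to_vec \<circ> f \<circ> of_vec"
  define g' where "g' v = to_vec \<circ> f' (of_vec v) \<circ> of_vec" for v
  let ?S = "of_vec -` S :: (real ^ 'a coord) set"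
  have img: "of_vec -` (f ` S) = g ` ?S"
  proof (intro set_eqI iffI)
    fix v assume "v \<in> of_vec -` (f ` S)"
    then obtain x where "x \<in> S" "of_vec v = f x" by auto
    then have "v = g (to_vec x)" "to_vec x \<in> ?S"
      using to_of_vec[of v] by (auto simp: g_def)
    then show "v \<in> g ` ?S" by blast
  qed (auto simp: g_def)
  have Sl: "?S \<in> lmeasurable"
    using S pull[of S] by (intro fmeasurableI) auto
  have gd: "(g has_derivative g' v) (at v within ?S)" if "v \<in> ?S" for v
  proof -
    have 1: "(of_vec has_derivative of_vec) (at v within ?S)"
      using linear_of_vec by (rule linear_imp_has_derivative)
    have 2: "(f has_derivative f' (of_vec v)) (at (of_vec v))"
      using deriv[of "of_vec v"] that by simp
    have 3: "(to_vec has_derivative to_vec) (at (f (of_vec v)))"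
      using linear_to_vec by (rule linear_imp_has_derivative)
    show ?thesis
      using has_derivative_compose[OF has_derivative_compose[OF 1 2] 3]
      unfolding g_def g'_def comp_def .
  qed
  have gdet: "\<bar>det (matrix (g' v))\<bar> = c" if "v \<in> ?S" for v
    using det[of "of_vec v"] that unfolding g'_def absdet_def by auto
  have int: "(\<lambda>v. \<bar>det (matrix (g' v))\<bar>) integrable_on ?S"
    using integrable_on_const[OF Sl, of c] gdet by (subst integrable_cong[where g = "\<lambda>_. c"]) auto
  have le: "g ` ?S \<in> lmeasurable" "measure lebesgue (g ` ?S) \<le> c * measure lebesgue ?S"
    using measurable_bounded_differentiable_image[OF Sl gd int, of c]
      measure_bounded_differentiable_image[OF Sl gd int, of c] gdet by auto
  have eq: "emeasure lborel (f ` S) = ennreal (measure lebesgue (g ` ?S))"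
    using pull[OF fS] emeasure_eq_measure2[OF le(1)] img by (simp del: measure_completion)
  have eqS: "emeasure lborel S = ennreal (measure lebesgue ?S)"
    using pull[OF S(1)] emeasure_eq_measure2[OF Sl] by (simp del: measure_completion)
  show ?thesis
  proof (cases "S = {}")
    case False
    then have "0 \<le> c" using det unfolding absdet_def by fastforce
    then show ?thesis
      unfolding eq eqS using le(2) by (simp add: ennreal_mult[symmetric] ennreal_leI)
  qed simp
qed

lemma emeasure_linear_image:
  fixes T :: "'a::euclidean_space \<Rightarrow> 'a"
  assumes T: "linear T" "bij T" and S: "open S" "emeasure lborel S < \<infinity>"
  shows "emeasure lborel (T ` S) = ennreal (absdet T) * emeasure lborel S"
proof -
  have lin: "linear (inv T)"
    using T by (simp add: bij_is_inj inj_linear_imp_inv_linear)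
  have op: "open (T ` S)"
    using T S(1) by (simp add: open_surjective_linear_image bij_is_surj)
  have inv: "inv T ` T ` S = S"
    using T(2) by (simp add: image_inv_f_f bij_is_inj)
  have one: "absdet T * absdet (inv T) = 1"
  proof -
    have "T \<circ> inv T = (\<lambda>x. x)"
      using T(2) by (auto simp: fun_eq_iff bij_is_surj surj_f_inv_f)
    then show ?thesis
      using absdet_compose[OF T(1) lin] by simp
  qed
  have nn: "0 \<le> absdet T" "0 \<le> absdet (inv T)" by (auto simp: absdet_def)
  have le: "emeasure lborel (T ` S) \<le> ennreal (absdet T) * emeasure lborel S"
    using T S op by (intro emeasure_differentiable_image_le[where f' = "\<lambda>_. T"])
      (auto intro: linear_imp_has_derivative)
  then have fin: "emeasure lborel (T ` S) < \<infinity>"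
    using S(2) by (metis ennreal_mult_less_top ennreal_less_top infinity_ennreal_def order_le_less_trans)
  have "emeasure lborel S \<le> ennreal (absdet (inv T)) * emeasure lborel (T ` S)"
    using emeasure_differentiable_image_le[of "T ` S" "inv T" "\<lambda>_. inv T"] fin op S(1) lin inv
    by (auto intro: linear_imp_has_derivative)
  then have "ennreal (absdet T) * emeasure lborel S
      \<le> ennreal (absdet T) * (ennreal (absdet (inv T)) * emeasure lborel (T ` S))"
    by (rule mult_left_mono) simp
  also have "\<dots> = emeasure lborel (T ` S)"
    using nn one by (simp add: mult.assoc[symmetric] ennreal_mult[symmetric])
  finally show ?thesis
    using le by simp
qed

section \<open>The gradation of a stratified Lie algebra\<close>

lemma subspace_vimage_linear: "linear f \<Longrightarrow> subspace S \<Longrightarrow> subspace {x. f x \<in> S}"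
  by (auto simp: subspace_def linear_0 linear_add linear_cmul)

locale stratified =
  fixes br :: "'a::euclidean_space \<Rightarrow> 'a \<Rightarrow> 'a" and V :: "nat \<Rightarrow> 'a set" and m :: nat
  assumes lie: "lie_algebra br" and strat: "stratification br V m"
begin

lemma subspace_V: "j \<in> {1..m} \<Longrightarrow> subspace (V j)"
  using strat by (auto simp: stratification_def)

lemma layers_works: "layers V m x \<in> (\<Pi>\<^sub>E j\<in>{1..m}. V j)" "(\<Sum>j=1..m. layers V m x j) = x"
proof -
  have "\<exists>!v. v \<in> (\<Pi>\<^sub>E j\<in>{1..m}. V j) \<and> (\<Sum>j=1..m. v j) = x"
    using strat by (auto simp: stratification_def)
  from theI'[OF this]
  show "layers V m x \<in> (\<Pi>\<^sub>E j\<in>{1..m}. V j)" "(\<Sum>j=1..m. layers V m x j) = x"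
    unfolding layers_def by auto
qed

lemma sum_layers [simp]: "sum (layers V m x) {Suc 0..m} = x"
  using layers_works(2)[of x] by simp

lemma layers_in_V: "j \<in> {1..m} \<Longrightarrow> layers V m x j \<in> V j"
  using layers_works(1) by (rule PiE_mem)

lemma layers_eqI:
  assumes "\<And>j. j \<in> {1..m} \<Longrightarrow> v j \<in> V j" "(\<Sum>j=1..m. v j) = x" "j \<in> {1..m}"
  shows "layers V m x j = v j"
proof -
  have ex1: "\<exists>!v. v \<in> (\<Pi>\<^sub>E j\<in>{1..m}. V j) \<and> (\<Sum>j=1..m. v j) = x"
    using strat by (auto simp: stratification_def)
  have "restrict v {1..m} \<in> (\<Pi>\<^sub>E j\<in>{1..m}. V j) \<and> (\<Sum>j=1..m. restrict v {1..m} j) = x"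
    using assms by auto
  then have "layers V m x = restrict v {1..m}"
    using ex1 layers_works[of x] by blast
  then show ?thesis using assms by simp
qed

lemma layers_V:
  assumes "i \<in> {1..m}" "x \<in> V i" "j \<in> {1..m}"
  shows "layers V m x j = (if j = i then x else 0)"
  using assms subspace_V by (intro layers_eqI) (auto simp: subspace_0)

lemma linear_layers: "j \<in> {1..m} \<Longrightarrow> linear (\<lambda>x. layers V m x j)"
proof (rule linearI)
  assume j: "j \<in> {1..m}"
  show "layers V m (x + y) j = layers V m x j + layers V m y j" for x y
    by (rule layers_eqI[where v = "\<lambda>j. layers V m x j + layers V m y j", OF _ _ j])
       (auto simp: sum.distrib layers_works(2) intro!: subspace_add subspace_V layers_in_V)
  show "layers V m (c *\<^sub>R x) j = c *\<^sub>R layers V m x j" for c x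
    by (rule layers_eqI[where v = "\<lambda>j. c *\<^sub>R layers V m x j", OF _ _ j])
       (auto simp: scaleR_sum_right[symmetric] layers_works(2)
        intro!: subspace_scale subspace_V layers_in_V)
qed

lemma linear_dilation: "linear (dilation V m r)"
  unfolding dilation_def[abs_def]
  by (intro linear_compose_sum ballI linear_compose_scale_right linear_layers) auto

lemma dilation_V: "i \<in> {1..m} \<Longrightarrow> x \<in> V i \<Longrightarrow> dilation V m r x = r ^ i *\<^sub>R x"
proof -
  assume i: "i \<in> {1..m}" "x \<in> V i"
  have "dilation V m r x = (\<Sum>j=1..m. if j = i then r ^ i *\<^sub>R x else 0)"
    unfolding dilation_def by (intro sum.cong) (auto simp: layers_V[OF i])
  also have "\<dots> = r ^ i *\<^sub>R x" using i by simp
  finally show ?thesis .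
qed

lemma dilation_dilation: "dilation V m r (dilation V m s x) = dilation V m (r * s) x"
proof -
  have "layers V m (dilation V m s x) j = s ^ j *\<^sub>R layers V m x j" if "j \<in> {1..m}" for j
    by (rule layers_eqI[OF _ _ that])
       (auto simp: dilation_def intro!: subspace_scale subspace_V layers_in_V)
  then show ?thesis
    by (simp add: dilation_def power_mult_distrib)
qed

lemma dilation_1 [simp]: "dilation V m 1 x = x"
  by (simp add: dilation_def layers_works(2))

lemma bij_dilation: "r \<noteq> 0 \<Longrightarrow> bij (dilation V m r)"
  by (rule o_bij[of "dilation V m (1 / r)"]) (auto simp: fun_eq_iff dilation_dilation)

definition tail :: "nat \<Rightarrow> 'a set" where
  "tail j = span (\<Union>i\<in>{j..m}. V i)"

lemma subspace_tail: "subspace (tail j)"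
  by (simp add: tail_def)

lemma tail_mono: "i \<le> j \<Longrightarrow> tail j \<subseteq> tail i"
  unfolding tail_def by (intro span_mono UN_mono) auto

lemma V_subset_tail: "j \<le> i \<Longrightarrow> i \<le> m \<Longrightarrow> V i \<subseteq> tail j"
  unfolding tail_def by (force intro: span_base)

lemma tail_eq_0: "m < j \<Longrightarrow> tail j = {0}"
  by (simp add: tail_def)

lemma bilinear_br: "bilinear br"
  using lie by (simp add: lie_algebra_def)

lemma linear_br: "linear (br x)" "linear (\<lambda>x. br x y)"
  using bilinear_br by (auto simp: bilinear_def)

lemma br_anti: "br x y = - br y x"
proof -
  have "br (x + y) (x + y) = 0" "br x x = 0" "br y y = 0"
    using lie by (auto simp: lie_algebra_def)
  then show ?thesis
    by (simp add: bilinear_ladd[OF bilinear_br] bilinear_radd[OF bilinear_br] eq_neg_iff_add_eq_0 add.commute)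
qed

lemma jacobi: "br (br x y) z = br x (br y z) - br y (br x z)"
proof -
  have "br x (br y z) + br y (br z x) + br z (br x y) = 0"
    using lie by (auto simp: lie_algebra_def)
  then show ?thesis
    using br_anti[of z "br x y"] br_anti[of z x] bilinear_rneg[OF bilinear_br, of y "br x z"]
    by (simp add: algebra_simps add_eq_0_iff2)
qed

text \<open>Bracketing with the first layer raises the degree by one; the Jacobi identity extends this
  from the first layer to the Lie algebra that it generates.\<close>

lemma br_tail:
  assumes "1 \<le> j" "y \<in> tail j"
  shows "br x y \<in> tail (Suc j)"
proof -
  define N where "N = {x. \<forall>j\<ge>1. \<forall>y\<in>tail j. br x y \<in> tail (Suc j)}"
  have subN: "subspace N"
  proof -
    have "N = (\<Inter>j\<in>{1..}. \<Inter>y\<in>tail j. {x. br x y \<in> tail (Suc j)})"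
      by (auto simp: N_def)
    then show ?thesis
      by (auto intro!: subspace_Int subspace_vimage_linear linear_br subspace_tail)
  qed
  have V1: "V 1 \<subseteq> N"
  proof
    fix a assume a: "a \<in> V 1"
    have "br a y \<in> tail (Suc j)" if "1 \<le> j" "y \<in> tail j" for j y
    proof -
      show "br a y \<in> tail (Suc j)"
        using that(2) unfolding tail_def[of j]
      proof (rule span_induct)
        show "subspace {y. br a y \<in> tail (Suc j)}"
          by (intro subspace_vimage_linear linear_br subspace_tail)
        fix y assume "y \<in> (\<Union>i\<in>{j..m}. V i)"
        then obtain i where i: "j \<le> i" "i \<le> m" "y \<in> V i" by auto
        show "br a y \<in> tail (Suc j)"
        proof (cases "i = m")
          case True
          then have "br a y = 0" using strat a i by (auto simp: stratification_def)
          then show ?thesis by (simp add: subspace_0 subspace_tail)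
        next
          case False
          then have "V (Suc i) = span {br x y | x y. x \<in> V 1 \<and> y \<in> V i}"
            using strat i that by (auto simp: stratification_def)
          then have "br a y \<in> V (Suc i)" using a i by (auto intro: span_base)
          then show ?thesis using V_subset_tail[of "Suc j" "Suc i"] i False by auto
        qed
      qed
    qed
    then show "a \<in> N" by (auto simp: N_def)
  qed
  \<comment> \<open>By the Jacobi identity a bracket of two elements of \<open>N\<close> even raises the degree by two.\<close>
  have step: "br a b \<in> N" if "a \<in> N" "b \<in> N" for a b
  proof -
    have "br (br a b) y \<in> tail (Suc j)" if "1 \<le> j" "y \<in> tail j" for j y
    proof -
      have "br a (br b y) \<in> tail (Suc (Suc j))" "br b (br a y) \<in> tail (Suc (Suc j))"
        using \<open>a \<in> N\<close> \<open>b \<in> N\<close> that by (auto simp: N_def)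
      then have "br (br a b) y \<in> tail (Suc (Suc j))"
        unfolding jacobi by (intro subspace_diff subspace_tail)
      then show ?thesis using tail_mono[of "Suc j" "Suc (Suc j)"] by auto
    qed
    then show ?thesis by (auto simp: N_def)
  qed
  have "V (Suc i) \<subseteq> N" if "Suc i \<le> m" for i
    using that
  proof (induction i)
    case (Suc i)
    then have "V (Suc (Suc i)) = span {br x y | x y. x \<in> V 1 \<and> y \<in> V (Suc i)}"
      using strat by (auto simp: stratification_def)
    moreover have "{br x y | x y. x \<in> V 1 \<and> y \<in> V (Suc i)} \<subseteq> N"
      using Suc V1 step by auto
    ultimately show ?case using subN by (simp add: span_minimal)
  qed (use V1 in simp)
  then have VN: "V i \<subseteq> N" if "i \<in> {1..m}" for i
    using that by (cases i) auto
  have "(\<Sum>j=1..m. layers V m x j) \<in> N"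
    using layers_in_V VN by (intro subspace_sum subN) blast
  then have "x \<in> N" by (simp add: layers_works(2))
  then show ?thesis using assms by (auto simp: N_def)
qed

text \<open>A unipotent map becomes arbitrarily close to the identity after conjugation with dilations,
  and conjugation does not change the determinant.\<close>

lemma absdet_unipotent:
  assumes T: "linear T" and uni: "\<And>j v. 1 \<le> j \<Longrightarrow> v \<in> tail j \<Longrightarrow> T v - v \<in> tail (Suc j)"
  shows "absdet T = 1"
proof -
  let ?d = "dilation V m"
  \<comment> \<open>On a vector \<open>v\<close> of degree \<open>j\<close>, \<open>C r v - v\<close> is \<open>r ^ j\<close> times a dilation by \<open>1 / r\<close> of a vector of
    degree greater than \<open>j\<close>, and thus tends to 0 as \<open>r\<close> grows.\<close>
  define C where "C r = ?d (1 / r) \<circ> (T \<circ> ?d r)" for r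
  have det_C: "absdet (C r) = absdet T" if "r > 0" for r
  proof -
    have "?d (1 / r) \<circ> ?d r = (\<lambda>x. x)"
      using that by (auto simp: fun_eq_iff dilation_dilation)
    then have "absdet (?d (1 / r)) * absdet (?d r) = 1"
      using absdet_compose[OF linear_dilation linear_dilation] absdet_id by metis
    moreover have "absdet (C r) = absdet (?d (1 / r)) * (absdet T * absdet (?d r))"
      unfolding C_def by (simp add: absdet_compose linear_compose linear_dilation T)
    ultimately show ?thesis by (simp add: mult.left_commute)
  qed
  have lim0: "((\<lambda>r. r ^ j *\<^sub>R ?d (1 / r) w) \<longlongrightarrow> 0) at_top" if "w \<in> tail (Suc j)" for j w
  proof -
    show ?thesis
      using that unfolding tail_def
    proof (rule span_induct)
      show "subspace {w. ((\<lambda>r. r ^ j *\<^sub>R ?d (1 / r) w) \<longlongrightarrow> 0) at_top}"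
      proof (rule subspaceI; clarsimp simp: linear_0 linear_dilation)
        fix x y
        assume "((\<lambda>r. r ^ j *\<^sub>R ?d (1 / r) x) \<longlongrightarrow> 0) at_top"
          "((\<lambda>r. r ^ j *\<^sub>R ?d (1 / r) y) \<longlongrightarrow> 0) at_top"
        from tendsto_add[OF this]
        show "((\<lambda>r. r ^ j *\<^sub>R ?d (1 / r) (x + y)) \<longlongrightarrow> 0) at_top"
          by (simp add: linear_add[OF linear_dilation] scaleR_add_right)
      next
        fix c x
        assume "((\<lambda>r. r ^ j *\<^sub>R ?d (1 / r) x) \<longlongrightarrow> 0) at_top"
        from tendsto_scaleR[OF tendsto_const[of c] this]
        show "((\<lambda>r. r ^ j *\<^sub>R ?d (1 / r) (c *\<^sub>R x)) \<longlongrightarrow> 0) at_top"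
          by (simp add: linear_cmul[OF linear_dilation] mult.commute)
      qed
      fix w assume "w \<in> (\<Union>i\<in>{Suc j..m}. V i)"
      then obtain i where i: "Suc j \<le> i" "i \<le> m" "w \<in> V i" by auto
      have "((\<lambda>r::real. inverse (r ^ (i - j)) *\<^sub>R w) \<longlongrightarrow> 0 *\<^sub>R w) at_top"
        using i by (intro tendsto_intros tendsto_inverse_0_at_top filterlim_pow_at_top filterlim_ident) auto
      moreover have "inverse (r ^ (i - j)) *\<^sub>R w = r ^ j *\<^sub>R ?d (1 / r) w" if "r > 0" for r :: real
        using i that power_add[of r j "i - j"] dilation_V[of i w "1 / r"]
        by (simp add: power_divide field_simps)
      ultimately show "((\<lambda>r. r ^ j *\<^sub>R ?d (1 / r) w) \<longlongrightarrow> 0) at_top"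
        by (auto elim!: Lim_transform_eventually intro: eventually_mono[OF eventually_gt_at_top[of 0]])
    qed
  qed
  have linC: "linear (C r)" for r
    unfolding C_def by (intro linear_compose linear_dilation T)
  have limV: "((\<lambda>r. C r v) \<longlongrightarrow> v) at_top" if "j \<in> {1..m}" "v \<in> V j" for j v
  proof -
    have w: "T v - v \<in> tail (Suc j)"
      using uni[of j v] V_subset_tail[of j j] that by auto
    have "C r v = r ^ j *\<^sub>R ?d (1 / r) (T v - v) + v" if "r > 0" for r
    proof -
      have "C r v = r ^ j *\<^sub>R ?d (1 / r) (T v)"
        using dilation_V[OF \<open>j \<in> {1..m}\<close> \<open>v \<in> V j\<close>] T
        by (simp add: C_def linear_cmul linear_dilation)
      also have "\<dots> = r ^ j *\<^sub>R ?d (1 / r) (T v - v) + r ^ j *\<^sub>R ?d (1 / r) v"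
        by (simp add: linear_diff linear_dilation algebra_simps)
      also have "r ^ j *\<^sub>R ?d (1 / r) v = v"
        using dilation_V[OF \<open>j \<in> {1..m}\<close> \<open>v \<in> V j\<close>] \<open>r > 0\<close> by (simp add: power_divide)
      finally show ?thesis .
    qed
    moreover have "((\<lambda>r. r ^ j *\<^sub>R ?d (1 / r) (T v - v) + v) \<longlongrightarrow> 0 + v) at_top"
      by (intro tendsto_add lim0[OF w] tendsto_const)
    ultimately show ?thesis
      by (auto elim!: Lim_transform_eventually intro: eventually_mono[OF eventually_gt_at_top[of 0]])
  qed
  have "((\<lambda>r. C r x) \<longlongrightarrow> x) at_top" for x
  proof -
    have "((\<lambda>r. \<Sum>j=1..m. C r (layers V m x j)) \<longlongrightarrow> (\<Sum>j=1..m. layers V m x j)) at_top"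
      using limV layers_in_V by (intro tendsto_sum) blast
    moreover have "(\<Sum>j=1..m. C r (layers V m x j)) = C r x" for r
      using linear_sum[OF linC[of r], of "layers V m x" "{1..m}"] layers_works(2)[of x] by metis
    ultimately show ?thesis by (simp add: layers_works(2))
  qed
  then have "((\<lambda>r. absdet (C r)) \<longlongrightarrow> absdet (\<lambda>x :: 'a. x)) at_top"
    by (rule tendsto_absdet)
  moreover have "((\<lambda>r. absdet (C r)) \<longlongrightarrow> absdet T) at_top"
    by (rule tendsto_eventually) (use det_C in \<open>auto intro: eventually_mono[OF eventually_gt_at_top[of 0]]\<close>)
  ultimately show ?thesis
    using tendsto_unique[OF trivial_limit_at_top_linorder] by fastforce
qed

end

section \<open>Lebesgue measure is left invariant\<close>

text \<open>The component orthogonal to \<open>S\<close> has derivative zero, and hence is constant.\<close>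

lemma subspace_of_derivative_in_subspace:
  fixes \<phi> :: "real \<Rightarrow> 'a::euclidean_space"
  assumes S: "subspace S" and d: "\<And>t. (\<phi> has_vector_derivative \<phi>' t) (at t)" "\<And>t. \<phi>' t \<in> S"
  shows "\<phi> t - \<phi> 0 \<in> S"
proof -
  obtain a c where ac: "a \<in> span S" "\<And>w. w \<in> span S \<Longrightarrow> orthogonal c w" "\<phi> t - \<phi> 0 = a + c"
    using orthogonal_subspace_decomp_exists[of S "\<phi> t - \<phi> 0"] by blast
  have "((\<lambda>t. \<phi> t \<bullet> c) has_real_derivative 0) (at s)" for s
  proof -
    have "((\<lambda>t. \<phi> t \<bullet> c) has_vector_derivative \<phi>' s \<bullet> c) (at s)"
      using d(1)[of s] by (rule bounded_linear.has_vector_derivative[OF bounded_linear_inner_left])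
    moreover have "\<phi>' s \<bullet> c = 0"
      using ac(2)[of "\<phi>' s"] d(2) by (auto simp: orthogonal_def inner_commute span_base)
    ultimately show ?thesis by (simp add: has_real_derivative_iff_has_vector_derivative)
  qed
  then have "\<phi> t \<bullet> c = \<phi> 0 \<bullet> c"
    using DERIV_isconst_all by blast
  moreover have "a \<bullet> c = 0" using ac by (auto simp: orthogonal_def inner_commute)
  ultimately have "c \<bullet> c = 0"
    using ac(3) by (metis inner_add_left inner_diff_left add_0 cancel_comm_monoid_add_class.diff_cancel)
  then have "c = 0" by simp
  then show ?thesis using ac S by (simp add: span_eq_iff[THEN iffD2])
qed

locale stratified_group = stratified br V m
  for mul br :: "'a::euclidean_space \<Rightarrow> 'a \<Rightarrow> 'a" and V :: "nat \<Rightarrow> 'a set" and m :: nat +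
  assumes exp_group: "exponential_lie_group mul br"
begin

sublocale G: group mul 0 uminus
  using exp_group by (simp add: exponential_lie_group_def)

lemma mul_minus_cancel [simp]: "mul (- x) (mul x y) = y" "mul x (mul (- x) y) = y"
  by (simp_all flip: G.assoc)

lemma minus_mul: "- mul x y = mul (- y) (- x)"
  by (rule G.inverse_distrib_swap)

lemma mul_scaleR: "mul (s *\<^sub>R v) (t *\<^sub>R v) = (s + t) *\<^sub>R v"
  using exp_group by (simp add: exponential_lie_group_def)

definition dmul :: "'a \<times> 'a \<Rightarrow> 'a \<times> 'a \<Rightarrow> 'a" where
  "dmul p = frechet_derivative (\<lambda>(x, y). mul x y) (at p)"

lemma Ck_mul: "Ck_on k (\<lambda>(x, y). mul x y) UNIV"
  using exp_group by (simp add: exponential_lie_group_def smooth_on_def)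

lemma has_derivative_mul: "((\<lambda>(x, y). mul x y) has_derivative dmul p) (at p)"
  using Ck_mul[of "Suc 0"] unfolding dmul_def Ck_on.simps frechet_derivative_works by blast

lemma differentiable_dmul: "(\<lambda>p. dmul p v) differentiable (at p)"
  using Ck_mul[of "Suc (Suc 0)"] unfolding dmul_def Ck_on.simps by blast

lemma linear_dmul: "linear (dmul p)"
  using has_derivative_mul by (rule has_derivative_linear)

lemma continuous_mul: "continuous_on UNIV (\<lambda>(x, y). mul x y)"
  using has_derivative_mul by (intro continuous_at_imp_continuous_on ballI has_derivative_continuous)

lemma continuous_on_mul [continuous_intros]:
  assumes "continuous_on S f" "continuous_on S g"
  shows "continuous_on S (\<lambda>x. mul (f x) (g x))"
  using continuous_on_compose2[OF continuous_mul continuous_on_Pair[OF assms]] by simp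

definition dleft :: "'a \<Rightarrow> 'a \<Rightarrow> 'a \<Rightarrow> 'a" where
  "dleft g x v = dmul (g, x) (0, v)"

definition dright :: "'a \<Rightarrow> 'a \<Rightarrow> 'a \<Rightarrow> 'a" where
  "dright g x v = dmul (g, x) (v, 0)"

lemma dmul_split: "dmul (g, x) (u, v) = dright g x u + dleft g x v"
  using linear_add[OF linear_dmul, of "(g, x)" "(u, 0)" "(0, v)"] by (simp add: dleft_def dright_def)

lemma has_derivative_dleft: "(mul g has_derivative dleft g x) (at x)"
proof -
  have "((\<lambda>y. (g, y)) has_derivative (\<lambda>v. (0, v))) (at x)"
    by (auto intro!: derivative_eq_intros)
  from has_derivative_compose[OF this has_derivative_mul]
  show ?thesis unfolding dleft_def[abs_def] by simp
qed

lemma has_derivative_dright: "((\<lambda>y. mul y x) has_derivative dright g x) (at g)"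
proof -
  have "((\<lambda>y. (y, x)) has_derivative (\<lambda>v. (v, 0))) (at g)"
    by (auto intro!: derivative_eq_intros)
  from has_derivative_compose[OF this has_derivative_mul]
  show ?thesis unfolding dright_def[abs_def] by simp
qed

lemma linear_dleft: "linear (dleft g x)" and linear_dright: "linear (dright g x)"
  using has_derivative_dleft has_derivative_dright by (blast intro: has_derivative_linear)+

lemma dleft_mul: "dleft g (mul h x) \<circ> dleft h x = dleft (mul g h) x"
proof -
  have "((\<lambda>y. mul g (mul h y)) has_derivative dleft g (mul h x) \<circ> dleft h x) (at x)"
    using has_derivative_compose[OF has_derivative_dleft has_derivative_dleft] by (simp add: comp_def)
  moreover have "((\<lambda>y. mul g (mul h y)) has_derivative dleft (mul g h) x) (at x)"
  proof -
    have "mul (mul g h) = (\<lambda>y. mul g (mul h y))"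
      by (simp add: fun_eq_iff G.assoc)
    then show ?thesis
      using has_derivative_dleft[of "mul g h" x] by simp
  qed
  ultimately show ?thesis by (rule has_derivative_unique)
qed

lemma dleft_0 [simp]: "dleft 0 x = (\<lambda>v. v)" and dright_0 [simp]: "dright g 0 = (\<lambda>v. v)"
proof -
  have "mul 0 = (\<lambda>y. y)" by (simp add: fun_eq_iff)
  then have "((\<lambda>y. y) has_derivative dleft 0 x) (at x)" "((\<lambda>y. y) has_derivative dright g 0) (at g)"
    using has_derivative_dleft[of 0 x] has_derivative_dright[of 0 g] by simp_all
  then show "dleft 0 x = (\<lambda>v. v)" "dright g 0 = (\<lambda>v. v)"
    using has_derivative_ident has_derivative_unique by blast+
qed

definition conjugate :: "'a \<Rightarrow> 'a \<Rightarrow> 'a" where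
  "conjugate g x = mul (mul g x) (- g)"

lemma has_derivative_conjugate: "(conjugate g has_derivative (\<lambda>v. dright g (- g) (dleft g 0 v))) (at 0)"
  using has_derivative_compose[OF has_derivative_dleft[of g 0] has_derivative_dright[of "- g"]]
  unfolding conjugate_def[abs_def] by simp

lemma Ad_eq: "Ad mul g v = dright g (- g) (dleft g 0 v)"
  using frechet_derivative_at[OF has_derivative_conjugate[of g]]
  unfolding Ad_def conjugate_def[abs_def] by metis

lemma has_derivative_conjugate_Ad: "(conjugate g has_derivative Ad mul g) (at 0)"
  using has_derivative_conjugate[of g] unfolding Ad_eq[abs_def] .

lemma linear_Ad: "linear (Ad mul g)"
  using has_derivative_conjugate_Ad by (rule has_derivative_linear)

lemma Ad_mul: "Ad mul (mul g h) = Ad mul g \<circ> Ad mul h"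
proof -
  have "conjugate h 0 = 0" by (simp add: conjugate_def)
  then have "((\<lambda>x. conjugate g (conjugate h x)) has_derivative Ad mul g \<circ> Ad mul h) (at 0)"
    using has_derivative_compose[OF has_derivative_conjugate_Ad[of h], of "conjugate g" "Ad mul g"]
      has_derivative_conjugate_Ad[of g] by (simp add: comp_def)
  moreover have "(\<lambda>x. conjugate g (conjugate h x)) = conjugate (mul g h)"
    by (auto simp: fun_eq_iff conjugate_def minus_mul G.assoc)
  ultimately show ?thesis
    using has_derivative_conjugate_Ad has_derivative_unique by metis
qed

lemma Ad_0 [simp]: "Ad mul 0 v = v"
  by (simp add: Ad_eq)

text \<open>The bracket is given as a \<open>frechet_derivative\<close>, which says nothing unless the derivative exists.
  Here it does: in a basis, \<open>Ad g v\<close> is a combination of derivatives of the smooth group law.\<close>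

lemma has_derivative_Ad: "((\<lambda>g. Ad mul g v) has_derivative (\<lambda>x. br x v)) (at 0)"
proof -
  have 1: "(\<lambda>g. dmul (g, h g) w) differentiable (at 0)" if "h differentiable (at 0)" for h w
  proof -
    have "(\<lambda>g. (g, h g)) differentiable (at 0)"
      using that has_derivative_Pair[OF has_derivative_ident] unfolding differentiable_def by blast
    then show ?thesis
      using differentiable_compose[where f = "\<lambda>p. dmul p w" and g = "\<lambda>g. (g, h g)"] differentiable_dmul
      by blast
  qed
  have "Ad mul g v = (\<Sum>i\<in>Basis. (dleft g 0 v \<bullet> i) *\<^sub>R dright g (- g) i)" for g
  proof -
    have "Ad mul g v = dright g (- g) (\<Sum>i\<in>Basis. (dleft g 0 v \<bullet> i) *\<^sub>R i)"
      by (simp add: Ad_eq euclidean_representation)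
    also have "\<dots> = (\<Sum>i\<in>Basis. (dleft g 0 v \<bullet> i) *\<^sub>R dright g (- g) i)"
      by (simp add: linear_sum[OF linear_dright] linear_cmul[OF linear_dright])
    finally show ?thesis .
  qed
  moreover have "(\<lambda>g. \<Sum>i\<in>Basis. (dleft g 0 v \<bullet> i) *\<^sub>R dright g (- g) i) differentiable (at 0)"
    unfolding dleft_def dright_def
    by (intro differentiable_sum finite_Basis ballI differentiable_scaleR differentiable_inner 1
        differentiable_const differentiable_minus differentiable_ident)
  ultimately have "(\<lambda>g. Ad mul g v) differentiable (at 0)" by simp
  then have "((\<lambda>g. Ad mul g v) has_derivative (\<lambda>x. group_bracket mul x v)) (at 0)"
    unfolding group_bracket_def by (simp add: frechet_derivative_works[symmetric])
  then show ?thesis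
    using exp_group by (simp add: exponential_lie_group_def)
qed

text \<open>Since \<open>t \<mapsto> Ad (t x)\<close> is a one-parameter group of linear maps, its derivative at \<open>t\<close> is the derivative
  at \<open>0\<close> followed by \<open>Ad (t x)\<close>.\<close>

lemma Ad_ray_derivative:
  "((\<lambda>t. Ad mul (t *\<^sub>R x) v) has_vector_derivative Ad mul (t *\<^sub>R x) (br x v)) (at t)"
proof -
  have "((\<lambda>s. (s - t) *\<^sub>R x) has_derivative (\<lambda>h. h *\<^sub>R x)) (at t)"
    by (auto intro!: derivative_eq_intros)
  moreover have "((\<lambda>g. Ad mul g v) has_derivative (\<lambda>x. br x v)) (at ((t - t) *\<^sub>R x))"
    using has_derivative_Ad by simp
  ultimately have "((\<lambda>s. Ad mul ((s - t) *\<^sub>R x) v) has_derivative (\<lambda>h. br (h *\<^sub>R x) v)) (at t)"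
    by (rule has_derivative_compose)
  from bounded_linear.has_derivative[OF linear_conv_bounded_linear[THEN iffD1, OF linear_Ad[of "t *\<^sub>R x"]] this]
  have "((\<lambda>s. Ad mul (t *\<^sub>R x) (Ad mul ((s - t) *\<^sub>R x) v)) has_derivative
      (\<lambda>h. Ad mul (t *\<^sub>R x) (br (h *\<^sub>R x) v))) (at t)" .
  moreover have "Ad mul (t *\<^sub>R x) (Ad mul ((s - t) *\<^sub>R x) v) = Ad mul (s *\<^sub>R x) v" for s
    using Ad_mul[of "t *\<^sub>R x" "(s - t) *\<^sub>R x"] by (simp add: mul_scaleR fun_eq_iff)
  moreover have "Ad mul (t *\<^sub>R x) (br (h *\<^sub>R x) v) = h *\<^sub>R Ad mul (t *\<^sub>R x) (br x v)" for h
    by (simp add: linear_cmul[OF linear_Ad] bilinear_lmul[OF bilinear_br])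
  ultimately show ?thesis
    by (simp add: has_vector_derivative_def)
qed

text \<open>Downward induction on \<open>j\<close>: the derivative of \<open>t \<mapsto> Ad (t x) v\<close> is \<open>Ad (t x) [x, v]\<close>, and \<open>[x, v]\<close> has
  degree greater than \<open>j\<close>, where \<open>Ad (t x)\<close> is already known to respect the degree.\<close>

lemma Ad_unipotent:
  assumes "1 \<le> j" "v \<in> tail j"
  shows "Ad mul x v - v \<in> tail (Suc j)"
proof -
  have "\<forall>v\<in>tail j. \<forall>t. Ad mul (t *\<^sub>R x) v - v \<in> tail (Suc j)" if "1 \<le> j" "m < j + k" for j k
    using that
  proof (induction k arbitrary: j)
    case 0
    then show ?case
      by (simp add: tail_eq_0 linear_0[OF linear_Ad])
  next
    case (Suc k)
    show ?case
    proof (intro ballI allI)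
      fix v t assume v: "v \<in> tail j"
      have b: "br x v \<in> tail (Suc j)"
        using br_tail Suc v by blast
      have "Ad mul (t *\<^sub>R x) (br x v) \<in> tail (Suc j)" for t
      proof -
        have "Ad mul (t *\<^sub>R x) (br x v) - br x v \<in> tail (Suc j)"
          using Suc.IH[of "Suc j"] Suc.prems b tail_mono[of "Suc j" "Suc (Suc j)"] by auto
        from subspace_add[OF subspace_tail this b] show ?thesis by simp
      qed
      from subspace_of_derivative_in_subspace[OF subspace_tail Ad_ray_derivative this, of t]
      show "Ad mul (t *\<^sub>R x) v - v \<in> tail (Suc j)" by simp
    qed
  qed
  from this[of j m] assms have "\<forall>v\<in>tail j. \<forall>t. Ad mul (t *\<^sub>R x) v - v \<in> tail (Suc j)"
    by linarith
  then have "Ad mul (1 *\<^sub>R x) v - v \<in> tail (Suc j)"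
    using assms by blast
  then show ?thesis by simp
qed

text \<open>The left logarithmic derivative at \<open>t x\<close> of the exponential map, in direction \<open>t v\<close>; equivalently,
  the derivative of \<open>u \<mapsto> (t x)\<inverse> (t u)\<close> at \<open>u = x\<close> in direction \<open>v\<close>.\<close>

definition log_deriv :: "'a \<Rightarrow> real \<Rightarrow> 'a \<Rightarrow> 'a" where
  "log_deriv x t v = t *\<^sub>R dleft (- (t *\<^sub>R x)) (t *\<^sub>R x) v"

lemma has_derivative_log_deriv:
  "((\<lambda>u. mul (- (t *\<^sub>R x)) (t *\<^sub>R u)) has_derivative log_deriv x t) (at x)"
proof -
  have "((\<lambda>u. t *\<^sub>R u) has_derivative (\<lambda>v. t *\<^sub>R v)) (at x)"
    by (auto intro!: derivative_eq_intros)
  from has_derivative_compose[OF this has_derivative_dleft]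
  show ?thesis
    by (simp add: log_deriv_def[abs_def] linear_cmul[OF linear_dleft])
qed

text \<open>Differentiate the identity \<open>(t + h) u = (t u) (h u)\<close> with respect to \<open>u\<close>. Moving both factors to the
  neutral element conjugates the first one with \<open>h x\<close>.\<close>

lemma log_deriv_add:
  "log_deriv x (t + h) v = Ad mul (- (h *\<^sub>R x)) (log_deriv x t v) + log_deriv x h v"
proof -
  define P where "P t u = mul (- (t *\<^sub>R x)) (t *\<^sub>R u)" for t u
  have P: "(P t has_derivative log_deriv x t) (at x)" for t
    unfolding P_def using has_derivative_log_deriv .
  have Px: "P t x = 0" for t by (simp add: P_def)
  have "P (t + h) = (\<lambda>u. mul (conjugate (- (h *\<^sub>R x)) (P t u)) (P h u))"
    unfolding P_def conjugate_def fun_eq_iff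
    by (simp add: mul_scaleR[symmetric] minus_mul G.assoc)
  moreover
  have "((\<lambda>u. conjugate (- (h *\<^sub>R x)) (P t u)) has_derivative (\<lambda>v. Ad mul (- (h *\<^sub>R x)) (log_deriv x t v))) (at x)"
    by (rule has_derivative_compose[OF P]) (simp add: Px has_derivative_conjugate_Ad)
  from has_derivative_Pair[OF this P[of h]]
  have "((\<lambda>u. mul (conjugate (- (h *\<^sub>R x)) (P t u)) (P h u)) has_derivative
     (\<lambda>v. Ad mul (- (h *\<^sub>R x)) (log_deriv x t v) + log_deriv x h v)) (at x)"
    using has_derivative_compose[OF _ has_derivative_mul] 
    by (fastforce simp: Px conjugate_def dmul_split)
  ultimately have "(P (t + h) has_derivative
     (\<lambda>v. Ad mul (- (h *\<^sub>R x)) (log_deriv x t v) + log_deriv x h v)) (at x)"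
    by (simp only:)
  from has_derivative_unique[OF P this] show ?thesis by metis
qed

lemma log_deriv_sum:
  "log_deriv x (real n * h) v = (\<Sum>k<n. Ad mul (- ((real k * h) *\<^sub>R x)) (log_deriv x h v))"
proof (induction n)
  case 0
  then show ?case by (simp add: log_deriv_def)
next
  case (Suc n)
  have "real (Suc n) * h = h + real n * h" by (simp add: algebra_simps)
  then show ?case using Suc log_deriv_add[of x h "real n * h" v] by simp
qed

text \<open>A discrete form of the formula \<open>(1 - exp (- ad x)) / ad x\<close> for the differential of the exponential
  map: cut the segment from \<open>0\<close> to \<open>x\<close> into \<open>n + 1\<close> pieces and let \<open>n\<close> tend to infinity.\<close>

lemma absdet_dleft_inverse: "absdet (dleft (- x) x) = 1"
proof -
  \<comment> \<open>The differential at one of the \<open>n + 1\<close> pieces; it tends to the identity.\<close>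
  define D where "D n = dleft (- (inverse (real (Suc n)) *\<^sub>R x)) (inverse (real (Suc n)) *\<^sub>R x)" for n
  have eq: "absdet (dleft (- x) x) = absdet (D n)" for n
  proof -
    define h where "h = inverse (real (Suc n))"
    have nh: "real (Suc n) * h = 1" by (simp add: h_def)
    \<comment> \<open>The average of the maps \<open>Ad\<close> along the segment, a unipotent map.\<close>
    define T where "T v = h *\<^sub>R (\<Sum>k<Suc n. Ad mul (- ((real k * h) *\<^sub>R x)) v)" for v
    have linT: "linear T"
      unfolding T_def[abs_def]
      by (intro linear_compose_scale_right linear_compose_sum ballI linear_Ad)
    have "absdet T = 1"
    proof (rule absdet_unipotent[OF linT])
      fix j v assume jv: "1 \<le> j" "v \<in> tail j"
      have "T v - v = h *\<^sub>R (\<Sum>k<Suc n. Ad mul (- ((real k * h) *\<^sub>R x)) v - v)"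
      proof -
        have "h *\<^sub>R (\<Sum>k<Suc n. v) = (real (Suc n) * h) *\<^sub>R v"
          by (simp only: sum_constant_scaleR card_lessThan scaleR_scaleR mult.commute)
        then show ?thesis
          unfolding T_def sum_subtractf scaleR_diff_right nh by simp
      qed
      also have "\<dots> \<in> tail (Suc j)"
        using jv by (intro subspace_scale subspace_sum subspace_tail Ad_unipotent)
      finally show "T v - v \<in> tail (Suc j)" .
    qed
    moreover have "dleft (- x) x = T \<circ> D n"
    proof
      fix v
      have "dleft (- x) x v = log_deriv x (real (Suc n) * h) v"
        unfolding nh by (simp add: log_deriv_def)
      also have "\<dots> = (T \<circ> D n) v"
        unfolding log_deriv_sum unfolding T_def D_def comp_def h_def[symmetric] log_deriv_def
        by (simp only: linear_cmul[OF linear_Ad] scaleR_sum_right)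
      finally show "dleft (- x) x v = (T \<circ> D n) v" .
    qed
    ultimately show ?thesis
      using absdet_compose[OF linT, of "D n"] linear_dleft by (simp add: D_def)
  qed
  have "(\<lambda>n. absdet (D n)) \<longlonglongrightarrow> absdet (dleft 0 0)"
  proof (rule tendsto_absdet)
    fix v
    have "isCont (\<lambda>p. dmul p (0, v)) (0, 0)"
      using differentiable_dmul by (rule differentiable_imp_continuous_within)
    moreover have "(\<lambda>n. (- (inverse (real (Suc n)) *\<^sub>R x), inverse (real (Suc n)) *\<^sub>R x)) \<longlonglongrightarrow> (- (0 *\<^sub>R x), 0 *\<^sub>R x)"
      by (intro tendsto_intros LIMSEQ_inverse_real_of_nat)
    ultimately show "(\<lambda>n. D n v) \<longlonglongrightarrow> dleft 0 0 v"
      unfolding D_def dleft_def by (intro isCont_tendsto_compose[of _ "\<lambda>p. dmul p (0, v)"]) simp_all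
  qed
  then have "(\<lambda>n::nat. absdet (dleft (- x) x)) \<longlonglongrightarrow> 1" by (simp flip: eq)
  then show ?thesis by (simp add: LIMSEQ_const_iff)
qed

lemma absdet_dleft: "absdet (dleft g x) = 1"
proof -
  have "dleft (- y) y \<circ> dleft y 0 = (\<lambda>v. v)" for y
    using dleft_mul[of "- y" y 0] by simp
  then have 1: "absdet (dleft y 0) = 1" for y
    using absdet_compose[OF linear_dleft linear_dleft, of "- y" y y 0] absdet_dleft_inverse by simp
  have "dleft g x \<circ> dleft x 0 = dleft (mul g x) 0"
    using dleft_mul[of g x 0] by simp
  then show ?thesis
    using absdet_compose[OF linear_dleft linear_dleft, of g x x 0] 1 by simp
qed

lemma open_left_translation:
  assumes "open S" shows "open (mul g ` S)"
proof -
  have "mul g ` S = mul (- g) -` S"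
    by (auto simp: image_iff) (metis mul_minus_cancel(2))
  moreover have "continuous_on UNIV (mul (- g))" by (intro continuous_intros)
  ultimately show ?thesis using assms by (simp add: open_vimage)
qed

lemma emeasure_left_translation:
  assumes "open S" "emeasure lborel S < \<infinity>"
  shows "emeasure lborel (mul g ` S) = emeasure lborel S"
proof -
  have le: "emeasure lborel (mul g ` S) \<le> emeasure lborel S"
    if "open S" "emeasure lborel S < \<infinity>" for g S
    using emeasure_differentiable_image_le[of S "mul g" "dleft g" 1] that
      open_left_translation[of S g] has_derivative_dleft absdet_dleft by simp
  have "mul (- g) ` (mul g ` S) = S" by (auto simp: image_image)
  then have "emeasure lborel S \<le> emeasure lborel (mul g ` S)"
    using le[of "mul g ` S" "- g"] assms open_left_translation le[OF assms]
    by (metis order_le_less_trans)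
  then show ?thesis using le[OF assms] by (rule antisym[rotated])
qed

end

section \<open>Homogeneous balls\<close>

context stratified
begin

text \<open>Bases of the layers combine to a basis of eigenvectors of the dilation.\<close>

lemma absdet_dilation:
  assumes r: "0 < r"
  shows "absdet (dilation V m r) = r ^ homogeneous_dim V m"
proof -
  have "\<exists>B. B \<subseteq> V j \<and> independent B \<and> V j \<subseteq> span B \<and> card B = dim (V j)" for j
    using basis_exists[of "V j"] by metis
  then obtain B where B: "\<And>j. B j \<subseteq> V j" "\<And>j. independent (B j)" "\<And>j. V j \<subseteq> span (B j)"
    "\<And>j. card (B j) = dim (V j)"
    by metis
  have finB: "finite (B j)" for j using B(2) by (rule independent_imp_finite)
  have disj: "B i \<inter> B j = {}" if "i \<in> {1..m}" "j \<in> {1..m}" "i \<noteq> j" for i j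
  proof (rule ccontr)
    assume "B i \<inter> B j \<noteq> {}"
    then obtain v where v: "v \<in> B i" "v \<in> B j" by blast
    then have "v = 0"
      using layers_V[of i v i] layers_V[of j v i] subsetD[OF B(1) v(1)] subsetD[OF B(1) v(2)] that
      by auto
    then show False using v B(2) dependent_zero by blast
  qed
  define A where "A = (\<Union>j\<in>{1..m}. B j)"
  have finA: "finite A" using finB by (simp add: A_def)
  have sumA: "(\<Sum>v\<in>A. f v) = (\<Sum>j=1..m. \<Sum>v\<in>B j. f v)" for f :: "'a \<Rightarrow> 'a"
    unfolding A_def using finB disj by (intro sum.UNION_disjoint) auto
  have indep: "independent A"
  proof (rule independent_if_scalars_zero[OF finA])
    fix f v assume *: "(\<Sum>v\<in>A. f v *\<^sub>R v) = 0" "v \<in> A"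
    then obtain j where j: "j \<in> {1..m}" "v \<in> B j" by (auto simp: A_def)
    have mem: "(\<Sum>v\<in>B j. f v *\<^sub>R v) \<in> V j" if "j \<in> {1..m}" for j
      by (intro subspace_sum subspace_scale subspace_V that) (use B(1) in blast)
    have "layers V m 0 j = (\<Sum>v\<in>B j. f v *\<^sub>R v)"
      by (rule layers_eqI[where v = "\<lambda>j. \<Sum>v\<in>B j. f v *\<^sub>R v", OF mem _ j(1)])
         (use * sumA in simp_all)
    moreover have "layers V m 0 j = 0"
      using linear_0[OF linear_layers[OF j(1)]] .
    ultimately show "f v = 0"
      using independentD[OF B(2)[of j] finB[of j] subset_refl, of f v] j(2) by metis
  qed
  have spanA: "span A = UNIV"
  proof -
    have "layers V m x j \<in> span A" if "j \<in> {1..m}" for x j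
    proof -
      have "B j \<subseteq> A" using that by (auto simp: A_def)
      then show ?thesis
        using layers_in_V[OF that] B(3)[of j] span_mono[of "B j" A] by blast
    qed
    then have "(\<Sum>j=1..m. layers V m x j) \<in> span A" for x
      by (intro span_sum)
    then show ?thesis by auto
  qed
  have "card A = DIM('a)"
    using indep spanA by (metis dim_span_eq_card_independent dim_UNIV)
  then obtain \<phi> where \<phi>: "bij_betw \<phi> (Basis :: 'a set) A"
    using finite_same_card_bij[OF finite_Basis finA] by auto
  obtain T where T: "linear T" "\<And>b. b \<in> Basis \<Longrightarrow> T b = \<phi> b"
    using linear_independent_extend[OF independent_Basis, of \<phi>] by auto
  have "span A \<subseteq> range T"
  proof (rule span_minimal)
    show "A \<subseteq> range T"
    proof
      fix v assume "v \<in> A"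
      then obtain b where "b \<in> Basis" "v = \<phi> b" using \<phi> by (auto simp: bij_betw_def)
      then show "v \<in> range T" using T(2)[of b] by (metis rangeI)
    qed
    show "subspace (range T)" using T(1) by (simp add: linear_subspace_image)
  qed
  then have surjT: "surj T" using spanA by auto
  then have injT: "inj T"
    using linear_surjective_imp_injective[OF T(1)] by (simp add: dim_UNIV)
  have "absdet T \<noteq> 0"
  proof -
    have "inv T \<circ> T = (\<lambda>x. x)" unfolding fun_eq_iff comp_def using injT by (simp add: inv_f_f)
    then have "absdet (inv T) * absdet T = 1"
      using absdet_compose[OF inj_linear_imp_inv_linear[OF T(1) injT] T(1)] by simp
    then show ?thesis by auto
  qed
  define deg where "deg v = (THE j. j \<in> {1..m} \<and> v \<in> B j)" for v
  have deg: "deg v = j" if "j \<in> {1..m}" "v \<in> B j" for v j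
    unfolding deg_def using that disj by (intro the_equality) blast+
  let ?D = "\<lambda>x. \<Sum>b\<in>Basis. (r ^ deg (\<phi> b) * (x \<bullet> b)) *\<^sub>R b"
  have linD: "linear ?D"
    by (intro linear_compose_sum ballI linearI) (auto simp: inner_simps algebra_simps)
  have "dilation V m r \<circ> T = T \<circ> ?D"
  proof
    fix x
    have 1: "dilation V m r (\<phi> b) = r ^ deg (\<phi> b) *\<^sub>R \<phi> b" if b: "b \<in> Basis" for b
    proof -
      obtain j where "j \<in> {1..m}" "\<phi> b \<in> B j"
      proof -
        have "\<phi> b \<in> A" using b \<phi> by (auto simp: bij_betw_def)
        then show ?thesis using that by (auto simp: A_def)
      qed
      then show ?thesis using B(1) by (subst dilation_V[of j]) (auto simp: deg)
    qed
    have "dilation V m r (T x) = dilation V m r (T (\<Sum>b\<in>Basis. (x \<bullet> b) *\<^sub>R b))"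
      by (simp add: euclidean_representation)
    also have "\<dots> = (\<Sum>b\<in>Basis. (x \<bullet> b) *\<^sub>R dilation V m r (\<phi> b))"
      by (simp add: linear_sum[OF T(1)] linear_cmul[OF T(1)] T(2)
          linear_sum[OF linear_dilation] linear_cmul[OF linear_dilation])
    also have "\<dots> = (\<Sum>b\<in>Basis. (r ^ deg (\<phi> b) * (x \<bullet> b)) *\<^sub>R \<phi> b)"
      by (intro sum.cong) (auto simp: 1)
    also have "\<dots> = T (?D x)"
      by (simp add: linear_sum[OF T(1)] linear_cmul[OF T(1)] T(2))
    finally show "(dilation V m r \<circ> T) x = (T \<circ> ?D) x" by simp
  qed
  then have "absdet (dilation V m r) * absdet T = absdet T * absdet ?D"
    using absdet_compose[OF linear_dilation T(1)] absdet_compose[OF T(1) linD] by metis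
  then have "absdet (dilation V m r) = absdet ?D" using \<open>absdet T \<noteq> 0\<close> by simp
  also have "\<dots> = (\<Prod>b\<in>Basis. r ^ deg (\<phi> b))"
    using r by (simp add: absdet_diagonal)
  also have "\<dots> = (\<Prod>v\<in>A. r ^ deg v)"
    by (rule prod.reindex_bij_betw[OF \<phi>])
  also have "\<dots> = (\<Prod>j=1..m. \<Prod>v\<in>B j. r ^ deg v)"
    unfolding A_def using finB disj by (intro prod.UNION_disjoint) auto
  also have "\<dots> = (\<Prod>j=1..m. \<Prod>v\<in>B j. r ^ j)"
    by (intro prod.cong) (auto simp: deg)
  also have "\<dots> = r ^ homogeneous_dim V m"
    by (simp add: homogeneous_dim_def power_sum B(4) power_mult)
  finally show ?thesis .
qed

lemma homogeneous_dim_pos: "0 < homogeneous_dim V m"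
proof (rule ccontr)
  assume "\<not> 0 < homogeneous_dim V m"
  then have "\<forall>j\<in>{1..m}. V j \<subseteq> {0}"
    by (simp add: homogeneous_dim_def Suc_le_eq)
  then have "layers V m x j = 0" if "j \<in> {1..m}" for x j
    using that layers_in_V by blast
  then have "x = 0" for x :: 'a
    using layers_works(2)[of x] by simp
  then show False using nonzero_Basis SOME_Basis by blast
qed

end

locale homogeneous_group = stratified_group mul br V m
  for mul br :: "'a::euclidean_space \<Rightarrow> 'a \<Rightarrow> 'a" and V :: "nat \<Rightarrow> 'a set" and m :: nat +
  fixes \<rho> :: "'a \<Rightarrow> real"
  assumes hnorm: "homogeneous_norm mul V m \<rho>"
begin

abbreviation hdim :: nat where "hdim \<equiv> homogeneous_dim V m"

abbreviation B :: "'a \<Rightarrow> real \<Rightarrow> 'a set" where "B \<equiv> hball mul \<rho>"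

lemma rho_nonneg [simp]: "0 \<le> \<rho> x"
  and cont_rho: "continuous_on UNIV \<rho>"
  and rho_minus [simp]: "\<rho> (- x) = \<rho> x"
  and rho_dilation: "0 < t \<Longrightarrow> \<rho> (dilation V m t x) = t * \<rho> x"
  and rho_eq_0 [simp]: "\<rho> x = 0 \<longleftrightarrow> x = 0"
  using hnorm by (auto simp: homogeneous_norm_def)

definition c0 :: real where
  "c0 = (SOME c. 1 \<le> c \<and> (\<forall>x y. \<rho> (mul x y) \<le> c * (\<rho> x + \<rho> y)))"

lemma c0: "1 \<le> c0" "\<rho> (mul x y) \<le> c0 * (\<rho> x + \<rho> y)"
proof -
  have "\<exists>c. 1 \<le> c \<and> (\<forall>x y. \<rho> (mul x y) \<le> c * (\<rho> x + \<rho> y))"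
    using hnorm by (auto simp: homogeneous_norm_def)
  from someI_ex[OF this] show "1 \<le> c0" "\<rho> (mul x y) \<le> c0 * (\<rho> x + \<rho> y)"
    unfolding c0_def by blast+
qed

definition qd :: "'a \<Rightarrow> 'a \<Rightarrow> real" where
  "qd x y = \<rho> (mul (- y) x)"

lemma mem_B: "y \<in> B x r \<longleftrightarrow> qd x y < r"
  by (simp add: hball_def qd_def)

lemma qd_nonneg [simp]: "0 \<le> qd x y"
  by (simp add: qd_def)

lemma qd_self [simp]: "qd x x = 0"
  by (simp add: qd_def)

lemma qd_commute: "qd x y = qd y x"
  using rho_minus[of "mul (- y) x"] by (simp add: qd_def minus_mul)

lemma qd_triangle: "qd x z \<le> c0 * (qd x y + qd y z)"
proof -
  have "mul (- z) x = mul (mul (- z) y) (mul (- y) x)" by (simp add: G.assoc)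
  then show ?thesis using c0(2)[of "mul (- z) y" "mul (- y) x"] by (simp add: qd_def add.commute)
qed

lemma qd_eq_0: "qd x y = 0 \<longleftrightarrow> x = y"
proof
  assume "qd x y = 0"
  then have "mul (- y) x = 0" by (simp add: qd_def)
  then have "mul y (mul (- y) x) = mul y 0" by simp
  then show "x = y" by simp
qed simp

lemma continuous_on_qd [continuous_intros]:
  assumes "continuous_on S f" "continuous_on S g"
  shows "continuous_on S (\<lambda>x. qd (f x) (g x))"
  unfolding qd_def
  by (rule continuous_on_compose2[OF cont_rho]) (auto intro!: continuous_intros assms)

lemma center_in_B: "0 < r \<Longrightarrow> x \<in> B x r"
  by (simp add: mem_B)

lemma open_B: "open (B x r)"
proof -
  have "B x r = {y. qd x y < r}" by (auto simp: mem_B)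
  then show ?thesis by (simp add: open_Collect_less continuous_intros)
qed

lemma B_sets [measurable, simp]: "B x r \<in> sets borel" "B x r \<in> sets lebesgue"
  using open_B by auto

lemma B_translate: "B x r = mul x ` B 0 r"
proof -
  have "y \<in> B x r \<longleftrightarrow> mul (- x) y \<in> B 0 r" for y
    by (simp add: mem_B qd_def minus_mul)
  then have "B x r = mul (- x) -` B 0 r" by blast
  also have "\<dots> = mul x ` B 0 r"
  proof (intro set_eqI iffI)
    fix y assume "y \<in> mul (- x) -` B 0 r"
    then show "y \<in> mul x ` B 0 r" by (intro image_eqI[of _ _ "mul (- x) y"]) simp_all
  qed auto
  finally show ?thesis .
qed

lemma B_dilate:
  assumes r: "0 < r"
  shows "B 0 (r * s) = dilation V m r ` B 0 s"
proof -
  have 0: "y \<in> B 0 t \<longleftrightarrow> \<rho> y < t" for y t by (simp add: mem_B qd_def)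
  show ?thesis
  proof (intro set_eqI iffI)
    fix y assume "y \<in> B 0 (r * s)"
    moreover have "y = dilation V m r (dilation V m (1 / r) y)"
      using r by (simp add: dilation_dilation)
    moreover have "\<rho> (dilation V m (1 / r) y) = \<rho> y / r"
      using r by (simp add: rho_dilation)
    moreover have "\<rho> y / r < s \<longleftrightarrow> \<rho> y < r * s"
      using r by (simp add: field_simps)
    ultimately show "y \<in> dilation V m r ` B 0 s"
      by (intro image_eqI[of _ _ "dilation V m (1 / r) y"]) (simp_all add: 0)
  next
    fix y assume "y \<in> dilation V m r ` B 0 s"
    then show "y \<in> B 0 (r * s)" using r by (auto simp: 0 rho_dilation)
  qed
qed

lemma continuous_dilation: "continuous_on UNIV (\<lambda>t. dilation V m t x)"
  unfolding dilation_def by (intro continuous_intros)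

text \<open>Let \<open>\<eta>\<close> be the minimum of \<open>\<rho>\<close> on the Euclidean unit sphere. A point outside the open unit ball is
  brought to the sphere by a dilation with factor at most 1, which does not increase \<open>\<rho>\<close>. Hence
  \<open>\<rho> < \<eta>\<close> implies \<open>norm < 1\<close>. All other balls are translates of dilates of \<open>B 0 \<eta>\<close>.\<close>

lemma bounded_B: "bounded (B x r)"
proof -
  obtain \<eta> where \<eta>: "\<eta> > 0" "\<And>x. norm x = 1 \<Longrightarrow> \<eta> \<le> \<rho> x"
  proof -
    have "sphere (0::'a) 1 \<noteq> {}" by simp
    then obtain z where z: "z \<in> sphere (0::'a) 1" "\<And>x. x \<in> sphere 0 1 \<Longrightarrow> \<rho> z \<le> \<rho> x"
      using continuous_attains_inf[OF compact_sphere _ continuous_on_subset[OF cont_rho]] by blast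
    then have "z \<noteq> 0" by auto
    then have "0 < \<rho> z" using rho_nonneg[of z] rho_eq_0[of z] by linarith
    with that z show ?thesis by auto
  qed
  have small: "norm x < 1" if "\<rho> x < \<eta>" for x
  proof (rule ccontr)
    assume "\<not> norm x < 1"
    moreover have "dilation V m 0 x = 0" unfolding dilation_def by (intro sum.neutral) auto
    ultimately obtain t where t: "0 \<le> t" "t \<le> 1" "norm (dilation V m t x) = 1"
      using IVT'[of "\<lambda>t. norm (dilation V m t x)" 0 1 1]
        continuous_on_subset[OF continuous_on_norm[OF continuous_dilation[of x]], of "{0..1}"]
      by auto
    then have "t \<noteq> 0" using \<open>dilation V m 0 x = 0\<close> by auto
    then have "\<eta> \<le> t * \<rho> x" using \<eta>(2)[OF t(3)] t(1) by (simp add: rho_dilation)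
    also have "\<dots> \<le> \<rho> x" using t by (simp add: mult_left_le_one_le)
    finally show False using that by simp
  qed
  have B0: "bounded (B 0 r)"
  proof (cases "0 < r")
    case True
    have "bounded (B 0 \<eta>)"
      using small by (intro boundedI[of _ 1]) (auto simp: mem_B qd_def intro: less_imp_le)
    then have "bounded (dilation V m (r / \<eta>) ` B 0 \<eta>)"
      using linear_conv_bounded_linear linear_dilation by (blast intro: bounded_linear_image)
    then show ?thesis
      using B_dilate[of "r / \<eta>" \<eta>] True \<eta>(1) by simp
  next
    case False
    then have "B 0 r = {}"
      using order_le_less_trans[OF qd_nonneg] by (auto simp: mem_B)
    then show ?thesis by simp
  qed
  have cont: "continuous_on UNIV (\<lambda>y. mul x y)"
    by (rule continuous_on_mul[OF continuous_on_const continuous_on_id])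
  have "compact (mul x ` closure (B 0 r))"
    using continuous_on_subset[OF cont subset_UNIV] compact_closure[THEN iffD2, OF B0]
    by (rule compact_continuous_image)
  then have "bounded (mul x ` closure (B 0 r))" by (rule compact_imp_bounded)
  then show ?thesis
    unfolding B_translate[of x r] by (rule bounded_subset) (rule image_mono[OF closure_subset])
qed

definition unit_vol :: real where "unit_vol = measure lborel (B 0 1)"

lemma emeasure_B_finite: "emeasure lborel (B x r) < \<infinity>"
  using bounded_B by (rule emeasure_bounded_finite)

lemma unit_vol_pos: "0 < unit_vol"
proof -
  have "\<not> negligible (B 0 1)"
    using open_B center_in_B[of 1 0] by (intro open_not_negligible) auto
  then have "emeasure lborel (B 0 1) \<noteq> 0"
    using negligible_iff_emeasure0[of "B 0 1"] by simp
  moreover have "emeasure lborel (B 0 1) = ennreal (measure lborel (B 0 1))"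
    using emeasure_B_finite[of 0 1] by (intro emeasure_eq_ennreal_measure) simp
  ultimately have "measure lborel (B 0 1) \<noteq> 0"
    by (metis ennreal_0)
  then show ?thesis
    unfolding unit_vol_def using measure_nonneg[of lborel "B 0 1"] by linarith
qed

lemma emeasure_B:
  assumes "0 < r"
  shows "emeasure lborel (B x r) = ennreal (unit_vol * r ^ hdim)"
proof -
  have "emeasure lborel (B x r) = emeasure lborel (B 0 r)"
    unfolding B_translate[of x r] using emeasure_B_finite open_B by (intro emeasure_left_translation)
  also have "\<dots> = emeasure lborel (dilation V m r ` B 0 1)"
    using B_dilate[OF assms, of 1] by simp
  also have "\<dots> = ennreal (r ^ hdim) * emeasure lborel (B 0 1)"
    using emeasure_linear_image[OF linear_dilation bij_dilation open_B emeasure_B_finite, of r] assms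
    by (simp add: absdet_dilation)
  also have "emeasure lborel (B 0 1) = ennreal unit_vol"
    unfolding unit_vol_def using emeasure_B_finite[of 0 1] by (simp add: emeasure_eq_ennreal_measure)
  also have "ennreal (r ^ hdim) * ennreal unit_vol = ennreal (unit_vol * r ^ hdim)"
    using unit_vol_pos assms by (subst ennreal_mult[symmetric]) (simp_all add: mult.commute)
  finally show ?thesis .
qed

section \<open>Vitali covering and the weak-type maximal inequality\<close>

text \<open>The factor by which a ball must be enlarged to contain all balls of no larger radius that meet it: two
  quasi-triangle inequalities give \<open>c0 (r + 2 c0 r) \<le> 3 c0\<^sup>2 r\<close>.\<close>

definition \<kappa> :: real where "\<kappa> = 3 * c0\<^sup>2"

lemma kappa_pos: "1 \<le> \<kappa>"
  using one_le_power[OF c0(1), of 2] unfolding \<kappa>_def by linarith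

lemma B_engulf:
  assumes "B z r \<inter> B w s \<noteq> {}" "s \<le> r"
  shows "B w s \<subseteq> B z (\<kappa> * r)"
proof
  obtain u where u: "qd z u < r" "qd w u < s" using assms by (auto simp: mem_B)
  fix y assume "y \<in> B w s"
  then have "qd w y < s" by (simp add: mem_B)
  then have uy: "qd u w + qd w y < 2 * r" using u assms(2) qd_commute[of u w] by linarith
  have r: "0 < r" using u(1) qd_nonneg[of z u] by linarith
  have "qd z y \<le> c0 * (qd z u + qd u y)" by (rule qd_triangle)
  also have "\<dots> \<le> c0 * (qd z u + c0 * (qd u w + qd w y))"
    using c0(1) qd_triangle by (intro mult_left_mono add_left_mono) auto
  also have "\<dots> < c0 * (r + c0 * (2 * r))"
    using c0(1) uy u by (intro mult_strict_left_mono add_strict_mono) auto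
  also have "\<dots> \<le> c0 * (c0 * r + c0 * (2 * r))"
    using c0(1) r mult_right_mono[of 1 c0 r] by (intro mult_left_mono add_right_mono) auto
  also have "\<dots> = \<kappa> * r" by (simp add: \<kappa>_def power2_eq_square algebra_simps)
  finally show "y \<in> B z (\<kappa> * r)" by (simp add: mem_B)
qed

text \<open>Greedy choice: keep a ball of largest radius and discard the balls that meet it, since its
  enlargement covers them.\<close>

lemma finite_Vitali:
  assumes "finite F"
  shows "\<exists>D\<subseteq>F. disjoint_family_on (\<lambda>(z, r). B z r) D \<and>
    (\<Union>(z, r)\<in>F. B z r) \<subseteq> (\<Union>(z, r)\<in>D. B z (\<kappa> * r))"
  using assms
proof (induction F rule: finite_psubset_induct)
  case (psubset F)
  show ?case
  proof (cases "\<exists>(z, r)\<in>F. B z r \<noteq> {}")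
    case False
    then have "(\<Union>(z, r)\<in>F. B z r) = {}" by auto
    then show ?thesis by (intro exI[of _ "{}"]) (auto simp: disjoint_family_on_def)
  next
    case True
    then have F: "finite (snd ` F)" "snd ` F \<noteq> {}" using psubset by auto
    obtain z r where zr: "(z, r) \<in> F" "r = Max (snd ` F)"
      using Max_in[OF F] by auto
    have rmax: "s \<le> r" if "(w, s) \<in> F" for w s
      using Max_ge[OF F(1), of s] that unfolding zr(2) by force
    have "B z r \<noteq> {}"
    proof -
      obtain w s where ws: "(w, s) \<in> F" "B w s \<noteq> {}" using True by auto
      then obtain y where "qd w y < s" by (auto simp: mem_B)
      then have "0 < r" using rmax[OF ws(1)] qd_nonneg[of w y] by linarith
      then show ?thesis using center_in_B by blast
    qed
    define F' where "F' = {(w, s) \<in> F. B z r \<inter> B w s = {}}"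
    have "F' \<subset> F" using zr(1) \<open>B z r \<noteq> {}\<close> by (auto simp: F'_def)
    from psubset.IH[OF this] obtain D where D: "D \<subseteq> F'" "disjoint_family_on (\<lambda>(z, r). B z r) D"
      "(\<Union>(z, r)\<in>F'. B z r) \<subseteq> (\<Union>(z, r)\<in>D. B z (\<kappa> * r))" by blast
    have "disjoint_family_on (\<lambda>(z, r). B z r) (insert (z, r) D)"
    proof -
      have "B z r \<inter> B w s = {}" "B w s \<inter> B z r = {}" if "(w, s) \<in> D" for w s
        using D(1) that by (auto simp: F'_def)
      then show ?thesis
        using D(2) unfolding disjoint_family_on_def by (auto simp: case_prod_beta split: prod.splits)
    qed
    moreover have "B w s \<subseteq> (\<Union>(z, r)\<in>insert (z, r) D. B z (\<kappa> * r))" if "(w, s) \<in> F" for w s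
    proof (cases "(w, s) \<in> F'")
      case True
      then show ?thesis using D(3) by blast
    next
      case False
      then show ?thesis using B_engulf[of z r w s] rmax[OF that] that by (auto simp: F'_def)
    qed
    ultimately show ?thesis
      using D(1) zr(1) by (intro exI[of _ "insert (z, r) D"]) (auto simp: F'_def)
  qed
qed

lemma emeasure_dilated_B:
  "0 < r \<Longrightarrow> emeasure lborel (B z (\<kappa> * r)) = ennreal (\<kappa> ^ hdim) * emeasure lborel (B z r)"
proof -
  assume r: "0 < r"
  have "ennreal (\<kappa> ^ hdim) * ennreal (unit_vol * r ^ hdim) = ennreal (unit_vol * (\<kappa> * r) ^ hdim)"
    using kappa_pos unit_vol_pos r
    by (subst ennreal_mult[symmetric]) (simp_all add: power_mult_distrib mult.left_commute)
  then show ?thesis using r kappa_pos by (simp add: emeasure_B)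
qed

lemma Vitali_compact:
  assumes K: "compact K" "K \<subseteq> (\<Union>(z, r)\<in>U. B z r)" and U: "\<And>z r. (z, r) \<in> U \<Longrightarrow> 0 < r"
  obtains D where "finite D" "D \<subseteq> U" "disjoint_family_on (\<lambda>(z, r). B z r) D"
    "K \<subseteq> (\<Union>(z, r)\<in>D. B z (\<kappa> * r))"
proof -
  obtain F where F: "F \<subseteq> U" "finite F" "K \<subseteq> (\<Union>(z, r)\<in>F. B z r)"
    using compactE_image[OF K(1), of U "\<lambda>(z, r). B z r"] K(2) open_B by (metis (no_types, lifting) case_prod_beta)
  obtain D where "D \<subseteq> F" "disjoint_family_on (\<lambda>(z, r). B z r) D"
    "(\<Union>(z, r)\<in>F. B z r) \<subseteq> (\<Union>(z, r)\<in>D. B z (\<kappa> * r))"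
    using finite_Vitali[OF F(2)] by blast
  with F that show ?thesis by (meson finite_subset subset_trans)
qed

lemma sum_nn_integral_disjoint_le:
  assumes D: "finite D" "disjoint_family_on (\<lambda>(z, r). B z r) D"
    and h: "h \<in> borel_measurable lebesgue"
  shows "(\<Sum>(z, r)\<in>D. \<integral>\<^sup>+y\<in>B z r. h y \<partial>lebesgue) \<le> (\<integral>\<^sup>+y\<in>(\<Union>(z, r)\<in>D. B z r). h y \<partial>lebesgue)"
proof -
  have [measurable]: "h \<in> borel_measurable lebesgue" by fact
  have "(\<Sum>(z, r)\<in>D. \<integral>\<^sup>+y\<in>B z r. h y \<partial>lebesgue) = (\<integral>\<^sup>+y. (\<Sum>p\<in>D. h y * indicator (B (fst p) (snd p)) y) \<partial>lebesgue)"
    by (subst nn_integral_sum) (auto simp: case_prod_beta)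
  also have "\<dots> = (\<integral>\<^sup>+y\<in>(\<Union>(z, r)\<in>D. B z r). h y \<partial>lebesgue)"
  proof (intro nn_integral_cong)
    fix y
    have "(\<Sum>p\<in>D. indicator (B (fst p) (snd p)) y) = (indicator (\<Union>(z, r)\<in>D. B z r) y :: ennreal)"
      using D by (subst indicator_UN_disjoint) (auto simp: case_prod_beta disjoint_family_on_def)
    then show "(\<Sum>p\<in>D. h y * indicator (B (fst p) (snd p)) y) = h y * indicator (\<Union>(z, r)\<in>D. B z r) y"
      by (simp flip: sum_distrib_left)
  qed
  finally show ?thesis by simp
qed

text \<open>The weak type inequality for the maximal function of \<open>h\<close>. The union of balls is exhausted by compact
  sets, and a compact set is covered by the enlargements of finitely many disjoint balls.\<close>

lemma weak_type_maximal:
  assumes U: "\<And>z r. (z, r) \<in> U \<Longrightarrow> 0 < r \<and>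
      c * emeasure lebesgue (B z r) \<le> (\<integral>\<^sup>+y\<in>B z r. h y \<partial>lebesgue)"
    and h: "h \<in> borel_measurable lebesgue"
  shows "c * emeasure lebesgue (\<Union>(z, r)\<in>U. B z r) \<le> ennreal (\<kappa> ^ hdim) * (\<integral>\<^sup>+y. h y \<partial>lebesgue)"
proof -
  let ?E = "\<Union>(z, r)\<in>U. B z r"
  have opE: "open ?E" using open_B by auto
  then obtain C :: "nat \<Rightarrow> 'a set" where C: "\<And>n. compact (C n)" "\<And>n. C n \<subseteq> ?E"
    "\<And>n. C n \<subseteq> interior (C (Suc n))" "\<Union>(range C) = ?E"
    using open_Union_compact_subsets[OF opE] by metis
  have step: "c * emeasure lebesgue K \<le> ennreal (\<kappa> ^ hdim) * (\<integral>\<^sup>+y. h y \<partial>lebesgue)"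
    if K: "compact K" "K \<subseteq> ?E" for K
  proof -
    obtain D where D: "finite D" "D \<subseteq> U" "disjoint_family_on (\<lambda>(z, r). B z r) D"
      "K \<subseteq> (\<Union>(z, r)\<in>D. B z (\<kappa> * r))"
      using Vitali_compact[OF K] U by blast
    have "emeasure lebesgue K \<le> emeasure lebesgue (\<Union>(z, r)\<in>D. B z (\<kappa> * r))"
      using D by (intro emeasure_mono) (auto intro!: sets.finite_UN)
    also have "\<dots> \<le> (\<Sum>(z, r)\<in>D. emeasure lebesgue (B z (\<kappa> * r)))"
    proof -
      have "(\<lambda>(z, r). B z (\<kappa> * r)) ` D \<subseteq> sets lebesgue" by auto
      from emeasure_subadditive_finite[OF D(1) this] show ?thesis
        unfolding case_prod_beta' .
    qed
    also have "\<dots> = (\<Sum>(z, r)\<in>D. ennreal (\<kappa> ^ hdim) * emeasure lebesgue (B z r))"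
      using D(2) U by (intro sum.cong) (auto simp: emeasure_dilated_B)
    finally have "c * emeasure lebesgue K \<le> c * (\<Sum>(z, r)\<in>D. ennreal (\<kappa> ^ hdim) * emeasure lebesgue (B z r))"
      by (rule mult_left_mono) simp
    also have "\<dots> = ennreal (\<kappa> ^ hdim) * (\<Sum>(z, r)\<in>D. c * emeasure lebesgue (B z r))"
      by (simp add: sum_distrib_left case_prod_beta mult_ac)
    also have "\<dots> \<le> ennreal (\<kappa> ^ hdim) * (\<Sum>(z, r)\<in>D. \<integral>\<^sup>+y\<in>B z r. h y \<partial>lebesgue)"
      using U D(2) by (intro mult_left_mono sum_mono) auto
    also have "\<dots> \<le> ennreal (\<kappa> ^ hdim) * (\<integral>\<^sup>+y. h y \<partial>lebesgue)"
      by (intro mult_left_mono order_trans[OF sum_nn_integral_disjoint_le[OF D(1,3) h]] nn_integral_mono)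
         (auto simp: indicator_def)
    finally show ?thesis .
  qed
  have "incseq C" using C(3) interior_subset by (intro incseq_SucI) blast
  have Cs: "range C \<subseteq> sets lebesgue"
    using C(1) by (auto intro!: lmeasurable_compact fmeasurableD)
  have "emeasure lebesgue ?E = (SUP n. emeasure lebesgue (C n))"
    using SUP_emeasure_incseq[OF Cs \<open>incseq C\<close>] C(4) by simp
  then have "c * emeasure lebesgue ?E = (SUP n. c * emeasure lebesgue (C n))"
    by (simp add: SUP_mult_left_ennreal)
  also have "\<dots> \<le> ennreal (\<kappa> ^ hdim) * (\<integral>\<^sup>+y. h y \<partial>lebesgue)"
    using step C by (intro SUP_least) auto
  finally show ?thesis .
qed

end

section \<open>Young functions\<close>

lemma young_0: "young_function \<Phi> \<Longrightarrow> \<Phi> 0 = 0"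
  by (simp add: young_function_def)

lemma young_scale:
  assumes \<Phi>: "young_function \<Phi>" and "0 \<le> u" "u \<le> 1" "0 \<le> r"
  shows "\<Phi> (u * r) \<le> ennreal u * \<Phi> r"
proof -
  have "\<Phi> ((1 - u) * 0 + u * r) \<le> ennreal (1 - u) * \<Phi> 0 + ennreal u * \<Phi> r"
    using assms unfolding young_function_def by (meson atLeastAtMost_iff order_refl)
  then show ?thesis using young_0[OF \<Phi>] by simp
qed

lemma young_mono:
  assumes \<Phi>: "young_function \<Phi>" and "0 \<le> r" "r \<le> s"
  shows "\<Phi> r \<le> \<Phi> s"
proof (cases "s = 0")
  case False
  have "\<Phi> (r / s * s) \<le> ennreal (r / s) * \<Phi> s"
    using assms False by (intro young_scale) auto
  also have "\<dots> \<le> 1 * \<Phi> s"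
    using assms False by (intro mult_right_mono) auto
  finally show ?thesis using False by simp
qed (use assms in simp)

lemma young_inverse_nonempty:
  assumes "young_function \<Phi>"
  shows "{r. 0 \<le> r \<and> ennreal s < \<Phi> r} \<noteq> {}"
proof -
  have "(\<Phi> \<longlongrightarrow> \<infinity>) at_top" using assms by (simp add: young_function_def)
  then have "eventually (\<lambda>r. ennreal s < \<Phi> r) at_top"
    by (rule order_tendstoD) simp
  then have "eventually (\<lambda>r. 0 \<le> r \<and> ennreal s < \<Phi> r) at_top"
    using eventually_ge_at_top[of 0] by eventually_elim auto
  then show ?thesis
    using eventually_happens[of "\<lambda>r. 0 \<le> r \<and> ennreal s < \<Phi> r" "at_top :: real filter"] by auto
qed

lemma young_inverse_le:
  assumes "0 \<le> r" "ennreal s < \<Phi> r"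
  shows "young_inverse \<Phi> s \<le> r"
  unfolding young_inverse_def using assms by (intro cInf_lower bdd_belowI[of _ 0]) auto

lemma young_inverse_less:
  assumes \<Phi>: "young_function \<Phi>" and r: "young_inverse \<Phi> s < r"
  shows "ennreal s < \<Phi> r"
proof -
  obtain q where q: "0 \<le> q" "ennreal s < \<Phi> q" "q < r"
    using cInf_lessD[OF young_inverse_nonempty[OF \<Phi>, of s]] r unfolding young_inverse_def by auto
  then show ?thesis using young_mono[OF \<Phi>, of q r] by (auto intro: order_less_le_trans)
qed

lemma young_inverse_pos:
  assumes \<Phi>: "young_function \<Phi>" and s: "0 < s"
  shows "0 < young_inverse \<Phi> s"
proof -
  have "(\<Phi> \<longlongrightarrow> 0) (at_right 0)" using \<Phi> by (simp add: young_function_def)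
  then have "eventually (\<lambda>r. \<Phi> r < ennreal s) (at_right 0)"
    using s by (intro order_tendstoD) auto
  then obtain d where d: "0 < d" "\<And>r. 0 < r \<Longrightarrow> r < d \<Longrightarrow> \<Phi> r < ennreal s"
    unfolding eventually_at_right_field by auto
  have "d \<le> young_inverse \<Phi> s"
    unfolding young_inverse_def
  proof (rule cInf_greatest[OF young_inverse_nonempty[OF \<Phi>]])
    fix r assume r: "r \<in> {r. 0 \<le> r \<and> ennreal s < \<Phi> r}"
    then have "r \<noteq> 0" using young_0[OF \<Phi>] by auto
    then show "d \<le> r" using r d(2)[of r] by (auto simp: not_less[symmetric] dest: less_asym)
  qed
  then show ?thesis using d by simp
qed

lemma borel_measurable_young:
  assumes \<Phi>: "young_function \<Phi>" and fin: "\<And>r. 0 < r \<Longrightarrow> \<Phi> r < \<infinity>"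
    and f: "f \<in> borel_measurable M" "\<And>x. 0 \<le> f x"
  shows "(\<lambda>x. \<Phi> (f x)) \<in> borel_measurable M"
proof -
  have fin': "\<Phi> r < top" if "0 \<le> r" for r
    using that fin[of r] young_0[OF \<Phi>] by (cases "r = 0") auto
  define \<phi> where "\<phi> r = enn2real (\<Phi> (max 0 r))" for r
  have "mono \<phi>"
    unfolding \<phi>_def by (intro monoI enn2real_mono young_mono[OF \<Phi>] fin') auto
  then have "\<phi> \<in> borel_measurable borel" by (rule borel_measurable_mono)
  then have "(\<lambda>x. ennreal (\<phi> (f x))) \<in> borel_measurable M" using f by measurable
  moreover have "ennreal (\<phi> (f x)) = \<Phi> (f x)" for x
    using f(2) fin'[of "f x"] by (simp add: \<phi>_def max_absorb2)
  ultimately show ?thesis by simp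
qed

lemma L1_loc_measurable:
  assumes "f \<in> L1_loc"
  shows "f \<in> borel_measurable lebesgue"
proof (rule borel_measurable_LIMSEQ_real)
  fix n :: nat
  have "set_integrable lebesgue (cball 0 (real n)) f"
    using assms by (auto simp: L1_loc_def)
  then show "(\<lambda>x. indicator (cball 0 (real n)) x *\<^sub>R f x) \<in> borel_measurable lebesgue"
    unfolding set_integrable_def by auto
next
  fix x :: 'a
  have "eventually (\<lambda>n. indicator (cball 0 (real n)) x *\<^sub>R f x = f x) sequentially"
    using eventually_ge_at_top[of "nat \<lceil>norm x\<rceil>"]
  proof eventually_elim
    case (elim n)
    then have "norm x \<le> real n" by linarith
    then show ?case by (simp add: indicator_def)
  qed
  then show "(\<lambda>n. indicator (cball 0 (real n)) x *\<^sub>R f x) \<longlonglongrightarrow> f x"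
    by (rule tendsto_eventually)
qed

text \<open>Jensen's inequality up to the factor 2, for \<open>a\<close> slightly above \<open>\<Phi>\<inverse>(s)\<close>: if \<open>\<Phi> a \<ge> s\<close>, then by
  convexity \<open>g \<le> (a / s) \<Phi> g\<close> wherever \<open>g > a\<close>.\<close>

lemma nn_integral_le_young:
  assumes \<Phi>: "young_function \<Phi>" and g: "\<And>y. 0 \<le> g y" and [measurable]: "A \<in> sets M"
    and \<Phi>g [measurable]: "(\<lambda>y. \<Phi> (g y)) \<in> borel_measurable M"
    and v: "emeasure M A = ennreal v" "0 \<le> v"
    and a: "0 < a" "0 < s" "ennreal s \<le> \<Phi> a"
    and I: "(\<integral>\<^sup>+y\<in>A. \<Phi> (g y) \<partial>M) \<le> ennreal (s * v)"
  shows "(\<integral>\<^sup>+y\<in>A. ennreal (g y) \<partial>M) \<le> ennreal (2 * a * v)"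
proof -
  have pt: "ennreal (g y) \<le> ennreal a + ennreal (a / s) * \<Phi> (g y)" for y
  proof (cases "g y \<le> a")
    case True
    then show ?thesis by (intro add_increasing2) (auto intro: ennreal_leI)
  next
    case False
    have "ennreal s \<le> \<Phi> (a / g y * g y)" using a False by simp
    also have "\<dots> \<le> ennreal (a / g y) * \<Phi> (g y)"
      using a False by (intro young_scale[OF \<Phi>]) auto
    finally have "ennreal (g y / s) * ennreal s \<le> ennreal (g y / s) * (ennreal (a / g y) * \<Phi> (g y))"
      by (rule mult_left_mono) simp
    moreover have "ennreal (g y / s) * ennreal s = ennreal (g y)"
      using a g[of y] by (simp add: ennreal_mult[symmetric])
    moreover have "ennreal (g y / s) * (ennreal (a / g y) * \<Phi> (g y)) = ennreal (a / s) * \<Phi> (g y)"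
      using a False g[of y] by (simp add: mult.assoc[symmetric] ennreal_mult[symmetric])
    ultimately show ?thesis by (simp add: add_increasing)
  qed
  have "(\<integral>\<^sup>+y\<in>A. ennreal (g y) \<partial>M) \<le>
      (\<integral>\<^sup>+y. ennreal a * indicator A y + ennreal (a / s) * (\<Phi> (g y) * indicator A y) \<partial>M)"
    using pt by (intro nn_integral_mono) (auto simp: indicator_def)
  also have "\<dots> = ennreal a * emeasure M A + ennreal (a / s) * (\<integral>\<^sup>+y\<in>A. \<Phi> (g y) \<partial>M)"
    by (subst nn_integral_add) (auto simp: nn_integral_cmult)
  also have "\<dots> \<le> ennreal a * ennreal v + ennreal (a / s) * ennreal (s * v)"
    using I v by (intro add_mono mult_left_mono) auto
  also have "\<dots> = ennreal (2 * a * v)"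
    using a v by (simp add: ennreal_mult[symmetric] ennreal_plus[symmetric] del: ennreal_plus)
  finally show ?thesis .
qed

lemma le_mult_Inf_ennreal:
  fixes x :: ennreal
  assumes "0 < c" "\<And>l. l \<in> S \<Longrightarrow> x \<le> ennreal c * l"
  shows "x \<le> ennreal c * Inf S"
proof -
  have "ennreal (1 / c) * x \<le> Inf S"
  proof (rule Inf_greatest)
    fix l assume "l \<in> S"
    then have "ennreal (1 / c) * x \<le> ennreal (1 / c) * (ennreal c * l)"
      by (intro mult_left_mono assms(2)) auto
    also have "\<dots> = l" using assms(1) by (simp add: mult.assoc[symmetric] ennreal_mult[symmetric])
    finally show "ennreal (1 / c) * x \<le> l" .
  qed
  then have "ennreal c * (ennreal (1 / c) * x) \<le> ennreal c * Inf S"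
    by (rule mult_left_mono) simp
  moreover have "ennreal c * (ennreal (1 / c) * x) = x"
    using assms(1) by (simp add: mult.assoc[symmetric] ennreal_mult[symmetric])
  ultimately show ?thesis by simp
qed

lemma less_divide_ennreal_iff:
  assumes "0 < v"
  shows "t < i / ennreal v \<longleftrightarrow> t * ennreal v < i"
proof -
  have "i / ennreal v \<le> t \<longleftrightarrow> i \<le> t * ennreal v"
  proof
    assume "i / ennreal v \<le> t"
    then have "i / ennreal v * ennreal v \<le> t * ennreal v" by (rule mult_right_mono) simp
    then show "i \<le> t * ennreal v" using assms by (simp add: ennreal_divide_times)
  next
    assume "i \<le> t * ennreal v"
    then show "i / ennreal v \<le> t"
      using assms by (intro divide_le_posI_ennreal) (auto simp: mult.commute)
  qed
  then show ?thesis by (simp add: not_le[symmetric])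
qed

section \<open>Lipschitz functions give bounded maximal commutators\<close>

text \<open>Let \<open>s\<close> be the mean of \<open>\<Phi> g\<close> over \<open>A\<close>, so that \<open>s v \<le> 1\<close> and \<open>s < \<Psi> t\<close>. The latter gives
  \<open>\<Psi>\<inverse>(s) \<le> t\<close>, hence \<open>\<Phi>\<inverse>(s) \<le> C s^\<gamma> t\<close>, and the mean of \<open>g\<close> is at most
  \<open>2 \<Phi>\<inverse>(s)\<close>. Finally \<open>v^\<gamma> s^\<gamma> \<le> 1\<close>.\<close>

lemma fractional_average_bound:
  assumes \<Phi>: "young_function \<Phi>" and \<Psi>: "young_function \<Psi>"
    and C: "0 < C" "\<And>t. 0 < t \<Longrightarrow> t powr (- \<gamma>) * young_inverse \<Phi> t \<le> C * young_inverse \<Psi> t"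
    and \<gamma>: "0 < \<gamma>"
    and g: "\<And>y. 0 \<le> g y" "(\<lambda>y. \<Phi> (g y)) \<in> borel_measurable M"
    and A: "A \<in> sets M" "emeasure M A = ennreal v" "0 < v"
    and I: "(\<integral>\<^sup>+y\<in>A. \<Phi> (g y) \<partial>M) \<le> 1" "(\<integral>\<^sup>+y\<in>A. \<Phi> (g y) \<partial>M) < \<Psi> t * ennreal v"
    and t: "0 < t"
  shows "ennreal (v powr \<gamma>) * (\<integral>\<^sup>+y\<in>A. ennreal (g y) \<partial>M) \<le> ennreal (2 * C * t * v)"
proof -
  let ?I = "\<integral>\<^sup>+y\<in>A. \<Phi> (g y) \<partial>M"
  obtain i where i: "?I = ennreal i" "0 \<le> i" "i \<le> 1"
    using I(1) by (cases ?I) (auto simp: top_unique)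
  \<comment> \<open>The mean of \<open>\<Phi> g\<close>, except that a mean 0 is replaced by a small positive number.\<close>
  obtain s where s: "0 < s" "i \<le> s * v" "ennreal s < \<Psi> t" "s * v \<le> 1"
  proof (cases "i = 0")
    case False
    have "ennreal (i / v) * ennreal v < \<Psi> t * ennreal v"
      using I(2) A(3) i by (simp add: ennreal_mult[symmetric])
    then have "ennreal (i / v) < \<Psi> t"
      by (metis mult_right_mono not_less zero_le)
    then show thesis using that[of "i / v"] False i A(3) by simp
  next
    case True
    then have "\<Psi> t \<noteq> 0" using I(2) i(1) by auto
    then obtain p where p: "0 < p" "ennreal p \<le> \<Psi> t"
    proof (cases "\<Psi> t")
      case (real r)
      then show thesis using \<open>\<Psi> t \<noteq> 0\<close> by (intro that[of r]) auto
    qed (auto intro: that[of 1])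
    define s where "s = min (p / 2) (1 / v)"
    have "ennreal s < ennreal p" using p A(3) by (simp add: s_def ennreal_less_iff min_less_iff_disj)
    moreover have "0 < s" using p A(3) by (simp add: s_def)
    moreover have "s * v \<le> 1 / v * v" using A(3) by (intro mult_right_mono) (auto simp: s_def)
    ultimately show thesis using that[of s] True p A(3) by (auto intro: order_less_le_trans)
  qed
  have "young_inverse \<Psi> s \<le> t" using t s by (intro young_inverse_le) auto
  then have "s powr (- \<gamma>) * young_inverse \<Phi> s \<le> C * t"
    using C(2)[OF s(1)] C(1) by (meson mult_left_mono order_trans less_imp_le)
  then have inv: "young_inverse \<Phi> s \<le> C * t * s powr \<gamma>"
    using s(1) by (simp add: powr_minus field_simps)
  have "(\<integral>\<^sup>+y\<in>A. ennreal (g y) \<partial>M) \<le> ennreal (2 * a * v)" if "C * t * s powr \<gamma> < a" for a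
  proof (rule nn_integral_le_young[OF \<Phi> g(1) A(1) g(2) A(2), of a s])
    have "0 \<le> C * t * s powr \<gamma>" using C t by simp
    then show "0 < a" using that by linarith
    show "ennreal s \<le> \<Phi> a" using young_inverse_less[OF \<Phi>, of s a] inv that by auto
    show "?I \<le> ennreal (s * v)" using i s by (simp add: ennreal_leI)
  qed (use s A in auto)
  then have "(\<integral>\<^sup>+y\<in>A. ennreal (g y) \<partial>M) \<le> ennreal (2 * (C * t * s powr \<gamma>) * v)"
  proof (intro tendsto_lowerbound)
    show "((\<lambda>a. ennreal (2 * a * v)) \<longlongrightarrow> ennreal (2 * (C * t * s powr \<gamma>) * v)) (at_right (C * t * s powr \<gamma>))"
      by (intro tendsto_intros)
    show "eventually (\<lambda>a. (\<integral>\<^sup>+y\<in>A. ennreal (g y) \<partial>M) \<le> ennreal (2 * a * v)) (at_right (C * t * s powr \<gamma>))"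
      using \<open>\<And>a. C * t * s powr \<gamma> < a \<Longrightarrow> _\<close> by (auto simp: eventually_at_right_field intro!: gt_ex)
  qed simp
  then have "ennreal (v powr \<gamma>) * (\<integral>\<^sup>+y\<in>A. ennreal (g y) \<partial>M)
      \<le> ennreal (v powr \<gamma>) * ennreal (2 * (C * t * s powr \<gamma>) * v)"
    by (rule mult_left_mono) simp
  also have "\<dots> = ennreal (2 * C * t * v * (s * v) powr \<gamma>)"
    using C t s A(3) by (subst ennreal_mult[symmetric]) (auto simp: powr_mult mult_ac)
  also have "\<dots> \<le> ennreal (2 * C * t * v)"
  proof (rule ennreal_leI)
    have "(s * v) powr \<gamma> \<le> 1" using s A(3) \<gamma> powr_mono2[of \<gamma> "s * v" 1] by simp
    then show "2 * C * t * v * (s * v) powr \<gamma> \<le> 2 * C * t * v"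
      using C t A(3) by (simp add: mult_le_cancel_left1)
  qed
  finally show ?thesis .
qed

context homogeneous_group
begin

text \<open>On a ball of radius \<open>r\<close> containing \<open>x\<close> the factor \<open>|b x - b y|\<close> is at most a constant times \<open>r^\<beta>\<close>, so
  that \<open>fractional_average_bound\<close> applies. The weak type inequality contributes a constant \<open>K\<close>, which is
  absorbed into the level because \<open>\<Psi>(t) \<le> \<Psi>(K t) / K\<close>.\<close>

lemma lipschitz_sufficient:
  assumes \<Phi>: "young_function \<Phi>" "\<And>r. 0 < r \<Longrightarrow> \<Phi> r < \<infinity>" and \<Psi>: "young_function \<Psi>"
    and \<beta>: "0 < \<beta>"
    and C: "0 < C" "\<And>t. 0 < t \<Longrightarrow> t powr (- \<beta> / real hdim) * young_inverse \<Phi> t \<le> C * young_inverse \<Psi> t"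
    and b: "b \<in> lipschitz_space mul \<rho> \<beta>"
  shows "bounded_orlicz_weak_orlicz \<Phi> \<Psi> (maximal_commutator mul \<rho> b)"
proof -
  define \<gamma> where "\<gamma> = \<beta> / real hdim"
  have \<gamma>: "0 < \<gamma>" using \<beta> homogeneous_dim_pos by (simp add: \<gamma>_def)
  obtain b' L0 where b': "AE x in lebesgue. b x = b' x"
    and L0: "\<And>x y. \<bar>b' x - b' y\<bar> \<le> L0 * qd x y powr \<beta>"
    using b unfolding lipschitz_space_def qd_def by auto
  \<comment> \<open>A strictly positive constant, because only positive \<open>l\<close> are admissible in the weak norm.\<close>
  define L where "L = max 1 L0"
  have L: "\<bar>b' x - b' y\<bar> \<le> L * qd x y powr \<beta>" for x y
    using L0[of x y] mult_right_mono[of L0 L "qd x y powr \<beta>"] by (simp add: L_def)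
  have "0 < L" by (simp add: L_def)
  define K where "K = \<kappa> ^ hdim"
  have K: "1 \<le> K" unfolding K_def using kappa_pos by (rule one_le_power)
  define D where "D = L * (2 * c0) powr \<beta> * unit_vol powr (- \<gamma>) * 2 * C"
  have D: "0 < D" using \<open>0 < L\<close> c0(1) unit_vol_pos C(1) by (simp add: D_def)
  obtain N where N: "N \<in> null_sets lebesgue" "\<And>x. x \<notin> N \<Longrightarrow> b x = b' x"
  proof -
    from b' obtain N where N: "{x \<in> space lebesgue. b x \<noteq> b' x} \<subseteq> N" "N \<in> null_sets lebesgue"
      by (rule AE_E) (auto simp: null_sets_def)
    then show thesis by (intro that[of N]) auto
  qed
  have main: "weak_orlicz_norm \<Psi> (maximal_commutator mul \<rho> b f) \<le> ennreal (D * K) * ennreal l"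
    if f: "f \<in> L1_loc" and l: "0 < l" "(\<integral>\<^sup>+x. \<Phi> (\<bar>f x\<bar> / l) \<partial>lebesgue) \<le> 1" for f l
  proof -
    have [measurable]: "f \<in> borel_measurable lebesgue" using f by (rule L1_loc_measurable)
    define g where "g y = \<bar>f y\<bar> / l" for y
    have g: "0 \<le> g y" for y using l by (simp add: g_def)
    have mg: "(\<lambda>y. \<Phi> (g y)) \<in> borel_measurable lebesgue"
      by (rule borel_measurable_young[OF \<Phi>]) (use g in \<open>auto simp: g_def\<close>)
    have level: "\<Psi> t * emeasure lebesgue {x. ennreal (D * l * t) < maximal_commutator mul \<rho> b f x} \<le> ennreal K"
      if t: "0 < t" for t
    proof -
      define U where "U = {(z, r). 0 < r \<and> \<Psi> t * emeasure lebesgue (B z r) \<le> (\<integral>\<^sup>+y\<in>B z r. \<Phi> (g y) \<partial>lebesgue)}"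
      let ?E = "\<Union>(z, r)\<in>U. B z r"
      have "{x. ennreal (D * l * t) < maximal_commutator mul \<rho> b f x} \<subseteq> N \<union> ?E"
      proof
        fix x assume x: "x \<in> {x. ennreal (D * l * t) < maximal_commutator mul \<rho> b f x}"
        show "x \<in> N \<union> ?E"
        proof (cases "x \<in> N")
          case False
          obtain z r where zr: "0 < r" "x \<in> B z r" "ennreal (D * l * t) <
            (\<integral>\<^sup>+y\<in>B z r. ennreal (\<bar>b x - b y\<bar> * \<bar>f y\<bar>) \<partial>lebesgue) / emeasure lebesgue (B z r)"
            using x unfolding maximal_commutator_def less_SUP_iff by auto
          define v where "v = unit_vol * r ^ hdim"
          have v: "0 < v" "emeasure lebesgue (B z r) = ennreal v"
            using zr(1) unit_vol_pos by (simp_all add: v_def emeasure_B)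
          have vg: "r powr \<beta> = unit_vol powr (- \<gamma>) * v powr \<gamma>"
          proof -
            have "(r ^ hdim) powr \<gamma> = r powr \<beta>"
              using zr(1) homogeneous_dim_pos by (simp add: powr_realpow[symmetric] powr_powr \<gamma>_def)
            then show ?thesis
              using unit_vol_pos zr(1) by (simp add: v_def powr_mult powr_minus)
          qed
          have osc: "AE y in lebesgue. ennreal (\<bar>b x - b y\<bar> * \<bar>f y\<bar>) * indicator (B z r) y \<le>
              ennreal (L * (2 * c0 * r) powr \<beta> * l) * (ennreal (g y) * indicator (B z r) y)"
            using b'
          proof eventually_elim
            case (elim y)
            show ?case
            proof (cases "y \<in> B z r")
              case True
              have "qd x y \<le> c0 * (qd x z + qd z y)" by (rule qd_triangle)
              also have "\<dots> \<le> c0 * (2 * r)"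
                using zr(2) True c0(1) by (intro mult_left_mono) (auto simp: mem_B qd_commute)
              finally have "qd x y powr \<beta> \<le> (2 * c0 * r) powr \<beta>"
                using \<beta> by (intro powr_mono2) (auto simp: mult_ac)
              then have "L * qd x y powr \<beta> \<le> L * (2 * c0 * r) powr \<beta>"
                using \<open>0 < L\<close> by (intro mult_left_mono) auto
              with L[of x y] have "\<bar>b x - b y\<bar> \<le> L * (2 * c0 * r) powr \<beta>"
                unfolding N(2)[OF False] elim by linarith
              then have "\<bar>b x - b y\<bar> * \<bar>f y\<bar> \<le> L * (2 * c0 * r) powr \<beta> * l * g y"
                using l(1) mult_right_mono[of "\<bar>b x - b y\<bar>" "L * (2 * c0 * r) powr \<beta>" "\<bar>f y\<bar>"]
                by (simp add: g_def mult.assoc)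
              then show ?thesis
                using True \<open>0 < L\<close> l(1) g[of y] by (simp add: ennreal_mult[symmetric] ennreal_leI)
            qed simp
          qed
          have "\<Psi> t * ennreal v \<le> (\<integral>\<^sup>+y\<in>B z r. \<Phi> (g y) \<partial>lebesgue)"
          proof (rule ccontr)
            assume "\<not> \<Psi> t * ennreal v \<le> (\<integral>\<^sup>+y\<in>B z r. \<Phi> (g y) \<partial>lebesgue)"
            then have less: "(\<integral>\<^sup>+y\<in>B z r. \<Phi> (g y) \<partial>lebesgue) < \<Psi> t * ennreal v" by simp
            have "(\<integral>\<^sup>+y\<in>B z r. \<Phi> (g y) \<partial>lebesgue) \<le> (\<integral>\<^sup>+y. \<Phi> (g y) \<partial>lebesgue)"
              by (intro nn_integral_mono) (auto simp: indicator_def)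
            also have "\<dots> \<le> 1" using l(2) by (simp add: g_def)
            finally have I1: "(\<integral>\<^sup>+y\<in>B z r. \<Phi> (g y) \<partial>lebesgue) \<le> 1" .
            have fr: "ennreal (v powr \<gamma>) * (\<integral>\<^sup>+y\<in>B z r. ennreal (g y) \<partial>lebesgue) \<le> ennreal (2 * C * t * v)"
              by (rule fractional_average_bound[OF \<Phi>(1) \<Psi> C(1) _ \<gamma> g mg B_sets(2) v(2,1) I1 less t])
                 (use C(2) in \<open>simp add: \<gamma>_def\<close>)
            have "(\<integral>\<^sup>+y\<in>B z r. ennreal (\<bar>b x - b y\<bar> * \<bar>f y\<bar>) \<partial>lebesgue) \<le>
                (\<integral>\<^sup>+y. ennreal (L * (2 * c0 * r) powr \<beta> * l) * (ennreal (g y) * indicator (B z r) y) \<partial>lebesgue)"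
              using osc by (rule nn_integral_mono_AE)
            also have "\<dots> = ennreal (L * (2 * c0 * r) powr \<beta> * l) * (\<integral>\<^sup>+y\<in>B z r. ennreal (g y) \<partial>lebesgue)"
              by (intro nn_integral_cmult) (auto simp: g_def)
            also have "ennreal (L * (2 * c0 * r) powr \<beta> * l) =
                ennreal (L * (2 * c0) powr \<beta> * unit_vol powr (- \<gamma>) * l) * ennreal (v powr \<gamma>)"
              using \<open>0 < L\<close> l(1) c0(1) zr(1)
              by (subst ennreal_mult[symmetric]) (auto simp: powr_mult vg mult_ac)
            also have "\<dots> * (\<integral>\<^sup>+y\<in>B z r. ennreal (g y) \<partial>lebesgue) \<le>
                ennreal (L * (2 * c0) powr \<beta> * unit_vol powr (- \<gamma>) * l) * ennreal (2 * C * t * v)"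
              unfolding mult.assoc[of "ennreal _" "ennreal _"] by (intro mult_left_mono fr) simp
            also have "\<dots> = ennreal (D * l * t) * ennreal v"
              using \<open>0 < L\<close> l(1) C(1) t v(1)
              by (simp add: ennreal_mult[symmetric] D_def mult_ac)
            finally have "(\<integral>\<^sup>+y\<in>B z r. ennreal (\<bar>b x - b y\<bar> * \<bar>f y\<bar>) \<partial>lebesgue) / ennreal v \<le> ennreal (D * l * t)"
              using v(1) by (intro divide_le_posI_ennreal) (auto simp: mult.commute)
            then show False using zr(3) v(2) by simp
          qed
          then show ?thesis using zr v(2) by (auto simp: U_def)
        qed simp
      qed
      moreover have "open ?E" using open_B by auto
      ultimately have "emeasure lebesgue {x. ennreal (D * l * t) < maximal_commutator mul \<rho> b f x}
          \<le> emeasure lebesgue (N \<union> ?E)"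
        using N(1) by (intro emeasure_mono) auto
      also have "\<dots> = emeasure lebesgue ?E"
        using N(1) \<open>open ?E\<close> by (subst Un_commute) (intro emeasure_Un_null_set, auto)
      finally have "\<Psi> t * emeasure lebesgue {x. ennreal (D * l * t) < maximal_commutator mul \<rho> b f x}
          \<le> \<Psi> t * emeasure lebesgue ?E"
        by (rule mult_left_mono) simp
      also have "\<dots> \<le> ennreal (\<kappa> ^ hdim) * (\<integral>\<^sup>+y. \<Phi> (g y) \<partial>lebesgue)"
        by (intro weak_type_maximal mg) (auto simp: U_def)
      also have "\<dots> \<le> ennreal K * 1"
        unfolding K_def using l(2) by (intro mult_left_mono) (auto simp: g_def)
      finally show ?thesis by simp
    qed
    have "\<Psi> t * distribution (\<lambda>x. maximal_commutator mul \<rho> b f x / ennreal (D * K * l)) t \<le> 1"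
      if t: "0 < t" for t
    proof -
      have DKl: "0 < D * K * l" using D K l by simp
      have "distribution (\<lambda>x. maximal_commutator mul \<rho> b f x / ennreal (D * K * l)) t =
          emeasure lebesgue {x. ennreal (D * l * (K * t)) < maximal_commutator mul \<rho> b f x}"
      proof -
        have "ennreal t < y / ennreal (D * K * l) \<longleftrightarrow> ennreal (D * l * (K * t)) < y" for y
        proof -
          have eq: "ennreal t * ennreal (D * K * l) = ennreal (D * l * (K * t))"
            using DKl t by (subst ennreal_mult[symmetric]) (auto simp: mult_ac)
          show ?thesis unfolding less_divide_ennreal_iff[OF DKl] eq ..
        qed
        then show ?thesis by (simp add: distribution_def)
      qed
      moreover have "\<Psi> t \<le> ennreal (1 / K) * \<Psi> (K * t)"
        using young_scale[OF \<Psi>, of "1 / K" "K * t"] K t by simp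
      ultimately have "\<Psi> t * distribution (\<lambda>x. maximal_commutator mul \<rho> b f x / ennreal (D * K * l)) t
          \<le> ennreal (1 / K) * \<Psi> (K * t) *
            emeasure lebesgue {x. ennreal (D * l * (K * t)) < maximal_commutator mul \<rho> b f x}"
        by (simp add: mult_right_mono)
      also have "\<dots> \<le> ennreal (1 / K) * ennreal K"
        unfolding mult.assoc[of "ennreal _"] using level[of "K * t"] K t by (intro mult_left_mono) auto
      also have "\<dots> = 1" using K by (simp add: ennreal_mult[symmetric])
      finally show ?thesis .
    qed
    then have "weak_orlicz_norm \<Psi> (maximal_commutator mul \<rho> b f) \<le> ennreal (D * K * l)"
      unfolding weak_orlicz_norm_def using D K l
      by (intro Inf_lower CollectI exI[of _ "D * K * l"]) (auto intro!: SUP_least)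
    then show ?thesis using D K l by (simp add: ennreal_mult[symmetric])
  qed
  have "weak_orlicz_norm \<Psi> (maximal_commutator mul \<rho> b f) \<le> ennreal (D * K) * orlicz_norm \<Phi> f"
    if "f \<in> orlicz_space \<Phi>" for f
  proof -
    have "f \<in> L1_loc" using that by (simp add: orlicz_space_def)
    then show ?thesis
      unfolding orlicz_norm_def using main D K by (intro le_mult_Inf_ennreal) auto
  qed
  moreover have "0 < D * K" using D K by simp
  ultimately show ?thesis unfolding bounded_orlicz_weak_orlicz_def by blast
qed

end

section \<open>Oscillation of the symbol of a bounded maximal commutator\<close>

text \<open>A dyadic layer cake bound: if \<open>a < M < \<infinity>\<close>, the term of the last \<open>k\<close> with \<open>a 2^k < M\<close> is at least \<open>M\<close>.\<close>

lemma le_dyadic_sum: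
  fixes M :: ennreal
  assumes a: "0 < a"
  shows "M \<le> ennreal a + (\<Sum>k. ennreal (a * 2 ^ Suc k) * (if ennreal (a * 2 ^ k) < M then 1 else 0))"
proof -
  define T where "T k = ennreal (a * 2 ^ Suc k) * (if ennreal (a * 2 ^ k) < M then 1 else 0)" for k
  have part: "min M (ennreal (a * 2 ^ n)) \<le> ennreal a + (\<Sum>k<n. T k)" for n
  proof (induction n)
    case (Suc n)
    show ?case
    proof (cases "ennreal (a * 2 ^ n) < M")
      case True
      then have "min M (ennreal (a * 2 ^ Suc n)) \<le> T n"
        by (simp add: T_def)
      also have "\<dots> \<le> ennreal a + (\<Sum>k<Suc n. T k)"
        by (simp add: add_increasing)
      finally show ?thesis .
    next
      case False
      then have "min M (ennreal (a * 2 ^ Suc n)) \<le> min M (ennreal (a * 2 ^ n))" by (auto simp: min_le_iff_disj not_less)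
      also have "\<dots> \<le> ennreal a + (\<Sum>k<Suc n. T k)"
        using Suc by (rule order_trans) (simp add: add_left_mono)
      finally show ?thesis .
    qed
  qed simp
  have "M \<le> ennreal a + (\<Sum>k. T k)"
  proof (rule dense_le)
    fix y assume y: "y < M"
    then obtain r where r: "y = ennreal r" "0 \<le> r" by (cases y) auto
    obtain n where "r / a < 2 ^ n" using real_arch_pow[of 2 "r / a"] by auto
    then have "r \<le> a * 2 ^ n" using a by (simp add: field_simps)
    then have "y \<le> min M (ennreal (a * 2 ^ n))" using y r by (simp add: ennreal_leI)
    also have "\<dots> \<le> ennreal a + (\<Sum>k<n. T k)" by (rule part)
    also have "\<dots> \<le> ennreal a + (\<Sum>k. T k)" by (intro add_left_mono sum_le_suminf) auto
    finally show "y \<le> ennreal a + (\<Sum>k. T k)" .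
  qed
  then show ?thesis by (simp add: T_def)
qed

text \<open>Lower semicontinuity in \<open>s\<close>, by Fatou's lemma.\<close>

lemma open_superlevel_nn_integral:
  assumes b: "b \<in> borel_measurable M" and f: "f \<in> borel_measurable M" and A: "A \<in> sets M"
  shows "open {s::real. T < (\<integral>\<^sup>+y\<in>A. ennreal (\<bar>s - b y\<bar> * \<bar>f y\<bar>) \<partial>M)}"
proof -
  note [measurable] = b f A
  let ?\<phi> = "\<lambda>s. \<integral>\<^sup>+y\<in>A. ennreal (\<bar>s - b y\<bar> * \<bar>f y\<bar>) \<partial>M"
  have "closed {s. ?\<phi> s \<le> T}"
    unfolding closed_sequential_limits
  proof (intro allI impI)
    fix s :: "nat \<Rightarrow> real" and l assume s: "(\<forall>n. s n \<in> {s. ?\<phi> s \<le> T}) \<and> s \<longlonglongrightarrow> l"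
    have "?\<phi> l = (\<integral>\<^sup>+y. liminf (\<lambda>n. ennreal (\<bar>s n - b y\<bar> * \<bar>f y\<bar>) * indicator A y) \<partial>M)"
    proof (intro nn_integral_cong)
      fix y
      have "(\<lambda>n. ennreal (\<bar>s n - b y\<bar> * \<bar>f y\<bar>) * indicator A y)
          \<longlonglongrightarrow> ennreal (\<bar>l - b y\<bar> * \<bar>f y\<bar>) * indicator A y"
      proof (cases "y \<in> A")
        case True
        then show ?thesis using s by (auto intro!: tendsto_intros)
      qed simp
      then show "ennreal (\<bar>l - b y\<bar> * \<bar>f y\<bar>) * indicator A y =
          liminf (\<lambda>n. ennreal (\<bar>s n - b y\<bar> * \<bar>f y\<bar>) * indicator A y)"
        by (intro lim_imp_Liminf[symmetric]) auto
    qed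
    also have "\<dots> \<le> liminf (\<lambda>n. ?\<phi> (s n))"
      by (intro nn_integral_liminf) measurable
    also have "\<dots> \<le> T" using s by (intro Liminf_le) auto
    finally show "l \<in> {s. ?\<phi> s \<le> T}" by simp
  qed
  then have "open (- {s. ?\<phi> s \<le> T})" by (rule open_Compl)
  moreover have "- {s. ?\<phi> s \<le> T} = {s. T < ?\<phi> s}" by auto
  ultimately show ?thesis by simp
qed

context homogeneous_group
begin

text \<open>A weak norm bounds the measure of superlevel sets only if they are measurable, as nonmeasurable
  sets have \<open>emeasure\<close> 0. Replacing \<open>b x\<close> by a free variable \<open>s\<close> makes the maximal function lower
  semicontinuous in \<open>(x, s)\<close>, so that its superlevel sets are open; those of the maximal commutator are
  their preimages under the measurable map \<open>x \<mapsto> (x, b x)\<close>.\<close>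

lemma sets_superlevel_maximal_commutator:
  assumes b: "b \<in> borel_measurable lebesgue" and f: "f \<in> borel_measurable lebesgue"
  shows "{x. t < maximal_commutator mul \<rho> b f x} \<in> sets lebesgue"
proof -
  let ?avg = "\<lambda>z r s. (\<integral>\<^sup>+y\<in>B z r. ennreal (\<bar>s - b y\<bar> * \<bar>f y\<bar>) \<partial>lebesgue) / emeasure lebesgue (B z r)"
  define W where "W = (\<Union>z. \<Union>r\<in>{0<..}. B z r \<times> {s. t < ?avg z r s})"
  have "open {s. t < ?avg z r s}" if "0 < r" for z r
  proof -
    define v where "v = unit_vol * r ^ hdim"
    have v: "emeasure lebesgue (B z r) = ennreal v" "0 < v"
      using that unit_vol_pos by (simp_all add: emeasure_B v_def)
    show ?thesis
      unfolding v(1) less_divide_ennreal_iff[OF v(2)]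
      using open_superlevel_nn_integral[OF b f B_sets(2)] .
  qed
  then have "open W" unfolding W_def by (intro open_UN ballI open_Times open_B) auto
  have "(\<lambda>x. (x, b x)) \<in> lebesgue \<rightarrow>\<^sub>M borel"
    using b by (intro borel_measurable_Pair) (auto simp: measurable_completion)
  then have "(\<lambda>x. (x, b x)) -` W \<inter> space lebesgue \<in> sets lebesgue"
    using \<open>open W\<close> by (intro measurable_sets) auto
  moreover have "(\<lambda>x. (x, b x)) -` W \<inter> space lebesgue = {x. t < maximal_commutator mul \<rho> b f x}"
    unfolding W_def maximal_commutator_def less_SUP_iff by (auto simp del: emeasure_completion)
  ultimately show ?thesis by simp
qed

lemma L1_loc_indicator_B: "(indicator (B z r) :: 'a \<Rightarrow> real) \<in> L1_loc"
proof -
  have "integrable lebesgue (\<lambda>x. indicator (K \<inter> B z r) x :: real)" if "compact K" for K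
  proof -
    have "K \<in> lmeasurable" using that by (rule lmeasurable_compact)
    then have "K \<inter> B z r \<in> lmeasurable" by (rule fmeasurable_Int_fmeasurable) simp
    then show ?thesis by (auto simp: fmeasurable_def)
  qed
  then show ?thesis
    by (simp add: L1_loc_def set_integrable_def indicator_inter_arith)
qed

lemma orlicz_norm_indicator_B:
  assumes \<Phi>: "young_function \<Phi>" and r: "0 < r"
  defines "v \<equiv> unit_vol * r ^ hdim"
  shows "indicator (B z r) \<in> orlicz_space \<Phi>"
    and "orlicz_norm \<Phi> (indicator (B z r)) \<le> ennreal (2 / young_inverse \<Phi> (1 / v))"
proof -
  have v: "0 < v" "emeasure lebesgue (B z r) = ennreal v"
    using r unit_vol_pos by (simp_all add: v_def emeasure_B)
  define a where "a = young_inverse \<Phi> (1 / v) / 2"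
  have i: "0 < young_inverse \<Phi> (1 / v)" using v by (intro young_inverse_pos[OF \<Phi>]) simp
  then have a: "0 < a" "a < young_inverse \<Phi> (1 / v)" by (auto simp: a_def)
  then have \<Phi>a: "\<Phi> a \<le> ennreal (1 / v)"
    using young_inverse_le[of a "1 / v" \<Phi>] by (simp add: not_less[symmetric] del: not_less) force
  have int: "(\<integral>\<^sup>+x. \<Phi> (a * \<bar>indicator (B z r) x\<bar>) \<partial>lebesgue) \<le> 1"
  proof -
    have "(\<integral>\<^sup>+x. \<Phi> (a * \<bar>indicator (B z r) x\<bar>) \<partial>lebesgue) = (\<integral>\<^sup>+x. \<Phi> a * indicator (B z r) x \<partial>lebesgue)"
      by (intro nn_integral_cong) (auto simp: indicator_def young_0[OF \<Phi>])
    also have "\<dots> = \<Phi> a * ennreal v" using v by (simp add: nn_integral_cmult_indicator)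
    also have "\<dots> \<le> ennreal (1 / v) * ennreal v" using \<Phi>a by (rule mult_right_mono) simp
    also have "\<dots> = 1" using v by (simp add: ennreal_mult[symmetric])
    finally show ?thesis .
  qed
  have "(\<integral>\<^sup>+x. \<Phi> (a * \<bar>indicator (B z r) x\<bar>) \<partial>lebesgue) < \<infinity>"
    using int by (rule order_le_less_trans) simp
  then show "indicator (B z r) \<in> orlicz_space \<Phi>"
    using a(1) L1_loc_indicator_B unfolding orlicz_space_def by auto
  have "orlicz_norm \<Phi> (indicator (B z r)) \<le> ennreal (1 / a)"
    unfolding orlicz_norm_def using a(1) int
    by (intro Inf_lower CollectI exI[of _ "1 / a"]) (simp add: mult.commute)
  then show "orlicz_norm \<Phi> (indicator (B z r)) \<le> ennreal (2 / young_inverse \<Phi> (1 / v))"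
    by (simp add: a_def)
qed

text \<open>Apply \<open>M\<^sub>b\<close> to the indicator \<open>f\<close> of a ball of volume \<open>v\<close>. Beyond \<open>s \<approx> \<Psi>\<inverse>(1 / v)\<close> the distribution
  function of \<open>M\<^sub>b f / N\<close> at \<open>2^k s\<close> is at most \<open>1 / \<Psi>(2^k s)\<close>, which is at most a constant times
  \<open>2^(- k (1 + \<epsilon>)) v\<close> since \<open>t^(1+\<epsilon>) / \<Psi>(t)\<close> is almost decreasing. The exponent exceeds 1, so the sum over
  the dyadic levels converges.\<close>

lemma oscillation_bound:
  assumes \<Phi>: "young_function \<Phi>" and \<Psi>: "young_function \<Psi>" and \<gamma>: "\<gamma> = \<beta> / real hdim"
    and b: "b \<in> borel_measurable lebesgue"
    and C: "0 < C" "\<And>t. 0 < t \<Longrightarrow> young_inverse \<Psi> t \<le> C * young_inverse \<Phi> t * t powr (- \<gamma>)"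
    and dec: "0 < \<epsilon>" "almost_decreasing (\<lambda>t. ennreal (t powr (1 + \<epsilon>)) / \<Psi> t)"
    and bdd: "bounded_orlicz_weak_orlicz \<Phi> \<Psi> (maximal_commutator mul \<rho> b)"
  shows "\<exists>A>0. \<forall>z r. 0 < r \<longrightarrow>
    (\<integral>\<^sup>+x\<in>B z r. (\<integral>\<^sup>+y\<in>B z r. ennreal \<bar>b x - b y\<bar> \<partial>lebesgue) \<partial>lebesgue)
      \<le> ennreal (A * r powr \<beta> * (unit_vol * r ^ hdim)\<^sup>2)"
proof -
  obtain C1 where C1: "0 < C1" "\<And>f. f \<in> orlicz_space \<Phi> \<Longrightarrow>
      weak_orlicz_norm \<Psi> (maximal_commutator mul \<rho> b f) \<le> ennreal C1 * orlicz_norm \<Phi> f"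
    using bdd unfolding bounded_orlicz_weak_orlicz_def by auto
  obtain Ce where Ce: "0 < Ce" "\<And>s t. 0 < s \<Longrightarrow> s \<le> t \<Longrightarrow>
      ennreal (t powr (1 + \<epsilon>)) / \<Psi> t \<le> ennreal Ce * (ennreal (s powr (1 + \<epsilon>)) / \<Psi> s)"
    using dec(2) unfolding almost_decreasing_def by auto
  define q where "q = (2::real) powr (- \<epsilon>)"
  have q: "0 < q" "q < 1" using dec(1) by (simp_all add: q_def powr_less_one)
  define C2 where "C2 = 1 + 2 * Ce / (1 - q)"
  have C2: "0 < C2" using Ce q by (simp add: C2_def add_pos_pos)
  define A where "A = 8 * C1 * C * C2 * unit_vol powr \<gamma>"
  have "0 < A" using C1 C C2 unit_vol_pos by (simp add: A_def)
  moreover have "(\<integral>\<^sup>+x\<in>B z r. (\<integral>\<^sup>+y\<in>B z r. ennreal \<bar>b x - b y\<bar> \<partial>lebesgue) \<partial>lebesgue)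
      \<le> ennreal (A * r powr \<beta> * (unit_vol * r ^ hdim)\<^sup>2)" if r: "0 < r" for z r
  proof -
    define v where "v = unit_vol * r ^ hdim"
    have v: "0 < v" "emeasure lebesgue (B z r) = ennreal v"
      using r unit_vol_pos by (simp_all add: v_def emeasure_B)
    define f :: "'a \<Rightarrow> real" where "f = indicator (B z r)"
    define M where "M = maximal_commutator mul \<rho> b f"
    define i where "i = young_inverse \<Phi> (1 / v)"
    define j where "j = young_inverse \<Psi> (1 / v)"
    have ij: "0 < i" "0 < j" using v by (auto simp: i_def j_def intro!: young_inverse_pos \<Phi> \<Psi>)
    \<comment> \<open>Twice the bound for the weak norm of \<open>M\<close>, so that some \<open>l\<close> admissible in that norm lies below \<open>N\<close>.\<close>
    define N where "N = 4 * C1 / i"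
    have N: "0 < N" using C1 ij by (simp add: N_def)
    have "weak_orlicz_norm \<Psi> M \<le> ennreal C1 * orlicz_norm \<Phi> f"
      unfolding M_def f_def using orlicz_norm_indicator_B(1)[OF \<Phi> r] by (rule C1(2))
    also have "\<dots> \<le> ennreal C1 * ennreal (2 / i)"
      unfolding f_def i_def v_def using orlicz_norm_indicator_B(2)[OF \<Phi> r] by (rule mult_left_mono) simp
    also have "\<dots> < ennreal N"
      using C1 ij by (simp add: N_def ennreal_mult[symmetric] ennreal_less_iff divide_strict_right_mono)
    finally obtain l where l: "0 < l" "l < N"
      "\<And>t. 0 < t \<Longrightarrow> \<Psi> t * distribution (\<lambda>x. M x / ennreal l) t \<le> 1"
      unfolding weak_orlicz_norm_def Inf_less_iff SUP_le_iff by (auto simp: ennreal_less_iff)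
    have Mset: "{x. t < M x} \<in> sets lebesgue" for t
      unfolding M_def f_def using b by (intro sets_superlevel_maximal_commutator) auto
    have level: "\<Psi> t * emeasure lebesgue {x. ennreal (N * t) < M x} \<le> 1" if t: "0 < t" for t
    proof -
      have sub: "{x. ennreal (N * t) < M x} \<subseteq> {x. ennreal (t * l) < M x}"
      proof -
        have "ennreal (t * l) \<le> ennreal (N * t)"
          using l t by (intro ennreal_leI) (simp add: mult.commute)
        then show ?thesis using order_le_less_trans by auto
      qed
      have "{x. ennreal t < M x / ennreal l} = {x. ennreal (t * l) < M x}"
        using l(1) t by (simp add: less_divide_ennreal_iff ennreal_mult)
      then have "emeasure lebesgue {x. ennreal (N * t) < M x} \<le> distribution (\<lambda>x. M x / ennreal l) t"
        unfolding distribution_def using sub Mset by (intro emeasure_mono) auto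
      then have "\<Psi> t * emeasure lebesgue {x. ennreal (N * t) < M x} \<le> \<Psi> t * distribution (\<lambda>x. M x / ennreal l) t"
        by (rule mult_left_mono) simp
      then show ?thesis using l(3)[OF t] by (rule order_trans)
    qed
    obtain s where s: "0 < s" "s \<le> 2 * j" "ennreal (1 / v) < \<Psi> s"
      using young_inverse_less[OF \<Psi>, of "1 / v" "2 * j"] ij by (intro that[of "2 * j"]) (auto simp: j_def)
    define a where "a = N * s"
    have a: "0 < a" using N s by (simp add: a_def)
    define D where "D k = {x. ennreal (a * 2 ^ k) < M x}" for k :: nat
    have Ds [measurable]: "D k \<in> sets lebesgue" for k unfolding D_def by (rule Mset)
    have decay: "emeasure lebesgue (D k) \<le> ennreal (Ce * v / 2 powr (real k * (1 + \<epsilon>)))" for k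
    proof -
      define t where "t = s * 2 ^ k"
      have t: "0 < t" "s \<le> t" using s(1) by (simp_all add: t_def)
      have lev: "\<Psi> t * emeasure lebesgue (D k) \<le> 1"
        using level[OF t(1)] by (simp add: D_def a_def t_def mult.assoc)
      have \<Psi>t: "ennreal (1 / v) < \<Psi> t" using s(3) young_mono[OF \<Psi> _ t(2)] s(1) by (meson less_imp_le order_less_le_trans)
      show ?thesis
      proof (cases "\<Psi> t")
        case top
        then have "emeasure lebesgue (D k) = 0"
          using lev by (metis ennreal_top_mult ennreal_one_less_top not_le)
        then show ?thesis by simp
      next
        case (real p)
        then have p: "0 < p" using \<Psi>t v by (auto simp: ennreal_less_iff intro: less_trans[of 0 "1 / v"])
        have "\<Psi> s \<le> \<Psi> t" using young_mono[OF \<Psi> _ t(2)] s(1) by simp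
        then obtain p' where p': "\<Psi> s = ennreal p'" "0 \<le> p'" using real by (cases "\<Psi> s") (auto simp: top_unique)
        then have p'v: "1 / v < p'" using s(3) v(1) by (simp add: ennreal_less_iff)
        then have "0 < p'" using v(1) by (meson less_trans zero_less_divide_1_iff)
        have "ennreal (t powr (1 + \<epsilon>) / p) \<le> ennreal (Ce * (s powr (1 + \<epsilon>) / p'))"
          using Ce(2)[OF s(1) t(2)] Ce(1) p \<open>0 < p'\<close> real p'(1)
          by (simp add: divide_ennreal ennreal_mult[symmetric])
        then have "t powr (1 + \<epsilon>) / p \<le> Ce * (s powr (1 + \<epsilon>) / p')"
          using Ce(1) \<open>0 < p'\<close> by (subst (asm) ennreal_le_iff) auto
        also have "\<dots> \<le> Ce * (s powr (1 + \<epsilon>) * v)"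
        proof -
          have "1 / p' \<le> v" using p'v \<open>0 < p'\<close> v(1) by (simp add: field_simps)
          then have "s powr (1 + \<epsilon>) * (1 / p') \<le> s powr (1 + \<epsilon>) * v" by (rule mult_left_mono) simp
          then show ?thesis using Ce(1) by (intro mult_left_mono) auto
        qed
        also have "t powr (1 + \<epsilon>) = s powr (1 + \<epsilon>) * 2 powr (real k * (1 + \<epsilon>))"
          using s(1) by (simp add: t_def powr_mult powr_realpow[symmetric] powr_powr)
        finally have "1 / p \<le> Ce * v / 2 powr (real k * (1 + \<epsilon>))"
          using s(1) p by (simp add: field_simps)
        moreover have "emeasure lebesgue (D k) \<le> ennreal (1 / p)"
        proof -
          have "emeasure lebesgue (D k) = ennreal (1 / p) * (ennreal p * emeasure lebesgue (D k))"
            using p by (simp add: mult.assoc[symmetric] ennreal_mult[symmetric])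
          also have "\<dots> \<le> ennreal (1 / p) * 1" using lev real by (intro mult_left_mono) auto
          finally show ?thesis by simp
        qed
        ultimately show ?thesis by (meson ennreal_leI order_trans)
      qed
    qed
    have avg: "(\<integral>\<^sup>+y\<in>B z r. ennreal \<bar>b x - b y\<bar> \<partial>lebesgue) \<le> ennreal v * M x" if x: "x \<in> B z r" for x
    proof -
      have "(\<integral>\<^sup>+y\<in>B z r. ennreal (\<bar>b x - b y\<bar> * \<bar>f y\<bar>) \<partial>lebesgue) / emeasure lebesgue (B z r) \<le> M x"
        unfolding M_def maximal_commutator_def using r x by (intro SUP_upper) auto
      moreover have "(\<integral>\<^sup>+y\<in>B z r. ennreal (\<bar>b x - b y\<bar> * \<bar>f y\<bar>) \<partial>lebesgue) =
          (\<integral>\<^sup>+y\<in>B z r. ennreal \<bar>b x - b y\<bar> \<partial>lebesgue)"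
        by (intro nn_integral_cong) (auto simp: f_def indicator_def)
      ultimately have "ennreal v * ((\<integral>\<^sup>+y\<in>B z r. ennreal \<bar>b x - b y\<bar> \<partial>lebesgue) / ennreal v) \<le> ennreal v * M x"
        unfolding v(2) by (intro mult_left_mono) auto
      then show ?thesis
        using v(1) by (simp add: ennreal_times_divide mult.commute[of "ennreal v"] mult_divide_eq_ennreal)
    qed
    have "(\<integral>\<^sup>+x\<in>B z r. (\<integral>\<^sup>+y\<in>B z r. ennreal \<bar>b x - b y\<bar> \<partial>lebesgue) \<partial>lebesgue) \<le>
       (\<integral>\<^sup>+x. ennreal v * (ennreal a * indicator (B z r) x + (\<Sum>k. ennreal (a * 2 ^ Suc k) * indicator (D k) x)) \<partial>lebesgue)"
    proof (intro nn_integral_mono)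
      fix x
      show "(\<integral>\<^sup>+y\<in>B z r. ennreal \<bar>b x - b y\<bar> \<partial>lebesgue) * indicator (B z r) x \<le>
          ennreal v * (ennreal a * indicator (B z r) x + (\<Sum>k. ennreal (a * 2 ^ Suc k) * indicator (D k) x))"
      proof (cases "x \<in> B z r")
        case True
        have "(if ennreal (a * 2 ^ k) < M x then 1 else 0) = (indicator (D k) x :: ennreal)" for k
          by (simp add: D_def indicator_def)
        then have "M x \<le> ennreal a + (\<Sum>k. ennreal (a * 2 ^ Suc k) * indicator (D k) x)"
          using le_dyadic_sum[OF a, of "M x"] by simp
        then have "ennreal v * M x \<le> ennreal v * (ennreal a + (\<Sum>k. ennreal (a * 2 ^ Suc k) * indicator (D k) x))"
          by (rule mult_left_mono) simp
        then show ?thesis using avg[OF True] True by simp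
      qed simp
    qed
    also have "\<dots> = ennreal v * (ennreal a * ennreal v + (\<Sum>k. ennreal (a * 2 ^ Suc k) * emeasure lebesgue (D k)))"
      by (simp add: nn_integral_cmult nn_integral_add nn_integral_suminf nn_integral_cmult_indicator v(2)
          del: power_Suc)
    also have "\<dots> \<le> ennreal v * (ennreal a * ennreal v + ennreal (2 * a * Ce * v / (1 - q)))"
    proof (intro mult_left_mono add_left_mono)
      have "(\<Sum>k. ennreal (a * 2 ^ Suc k) * emeasure lebesgue (D k)) \<le> (\<Sum>k. ennreal (2 * a * Ce * v * q ^ k))"
      proof (intro suminf_le allI)
        fix k
        have "ennreal (a * 2 ^ Suc k) * emeasure lebesgue (D k) \<le>
            ennreal (a * 2 ^ Suc k) * ennreal (Ce * v / 2 powr (real k * (1 + \<epsilon>)))"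
          by (rule mult_left_mono[OF decay]) simp
        also have "\<dots> = ennreal (a * 2 ^ Suc k * (Ce * v / 2 powr (real k * (1 + \<epsilon>))))"
          using a Ce v by (intro ennreal_mult[symmetric]) auto
        also have "a * 2 ^ Suc k * (Ce * v / 2 powr (real k * (1 + \<epsilon>))) = 2 * a * Ce * v * q ^ k"
        proof -
          have "q ^ k = 2 powr (- \<epsilon> * real k)"
            unfolding q_def by (simp add: powr_realpow[symmetric] powr_powr)
          also have "\<dots> = 2 ^ k / 2 powr (real k * (1 + \<epsilon>))"
            by (simp add: powr_realpow[symmetric] powr_diff[symmetric] algebra_simps)
          finally show ?thesis by simp
        qed
        finally show "ennreal (a * 2 ^ Suc k) * emeasure lebesgue (D k) \<le> ennreal (2 * a * Ce * v * q ^ k)" .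
      qed auto
      also have "\<dots> = ennreal (\<Sum>k. 2 * a * Ce * v * q ^ k)"
        using a Ce v q by (intro suminf_ennreal2) (auto intro!: summable_mult)
      also have "(\<Sum>k. 2 * a * Ce * v * q ^ k) = 2 * a * Ce * v / (1 - q)"
        using q by (subst suminf_mult) (auto simp: suminf_geometric)
      finally show "(\<Sum>k. ennreal (a * 2 ^ Suc k) * emeasure lebesgue (D k)) \<le> ennreal (2 * a * Ce * v / (1 - q))" .
    qed auto
    also have "\<dots> = ennreal (a * C2 * v\<^sup>2)"
      using a v Ce q by (simp add: ennreal_mult[symmetric] ennreal_plus[symmetric] C2_def power2_eq_square algebra_simps
          del: ennreal_plus)
    also have "\<dots> \<le> ennreal (A * r powr \<beta> * v\<^sup>2)"
    proof (rule ennreal_leI)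
      have "a \<le> N * (2 * j)" using s N by (simp add: a_def)
      also have "\<dots> \<le> N * (2 * (C * i * (1 / v) powr (- \<gamma>)))"
        using C(2)[of "1 / v"] v N unfolding i_def j_def by (intro mult_left_mono) auto
      also have "\<dots> = 8 * C1 * C * v powr \<gamma>"
        using ij v by (simp add: N_def powr_minus powr_divide)
      also have "v powr \<gamma> = unit_vol powr \<gamma> * r powr \<beta>"
        using r unit_vol_pos homogeneous_dim_pos
        by (simp add: v_def powr_mult powr_realpow[symmetric] powr_powr \<gamma>)
      finally have "a * C2 * v\<^sup>2 \<le> 8 * C1 * C * (unit_vol powr \<gamma> * r powr \<beta>) * C2 * v\<^sup>2"
        using C2 by (intro mult_right_mono) auto
      then show "a * C2 * v\<^sup>2 \<le> A * r powr \<beta> * v\<^sup>2" by (simp add: A_def mult_ac)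
    qed
    finally show ?thesis by (simp add: v_def)
  qed
  ultimately show ?thesis by blast
qed

end

section \<open>Campanato's characterisation of Lipschitz functions\<close>

context homogeneous_group
begin

lemma integrable_B:
  assumes "b \<in> L1_loc"
  shows "set_integrable lebesgue (B x r) b"
proof (rule set_integrable_subset)
  show "set_integrable lebesgue (closure (B x r)) b"
    using assms bounded_B by (auto simp: L1_loc_def)
qed (use closure_subset in auto)

definition mean :: "('a \<Rightarrow> real) \<Rightarrow> 'a \<Rightarrow> real \<Rightarrow> real" where
  "mean b x r = (LINT y:B x r|lebesgue. b y) / (unit_vol * r ^ hdim)"

lemma diff_mean_le:
  assumes b: "b \<in> L1_loc" and r: "0 < r"
  shows "ennreal \<bar>c - mean b x r\<bar> * ennreal (unit_vol * r ^ hdim) \<le>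
    (\<integral>\<^sup>+y\<in>B x r. ennreal \<bar>c - b y\<bar> \<partial>lebesgue)"
proof -
  define v where "v = unit_vol * r ^ hdim"
  have v: "0 < v" "emeasure lebesgue (B x r) = ennreal v"
    using r unit_vol_pos by (simp_all add: v_def emeasure_B)
  have mv: "measure lebesgue (B x r) = v" using v by (simp add: measure_def)
  have const: "set_integrable lebesgue (B x r) (\<lambda>y. c)"
    unfolding set_integrable_def using v by (intro integrable_scaleR_left) auto
  have int: "set_integrable lebesgue (B x r) (\<lambda>y. c - b y)"
    using const integrable_B[OF b] by (rule set_integral_diff(1))
  have "(LINT y:B x r|lebesgue. c - b y) = c * v - mean b x r * v"
    using set_integral_diff(2)[OF const integrable_B[OF b]] v(1) mv
    by (simp add: mean_def set_lebesgue_integral_def v_def[symmetric])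
  then have "\<bar>c - mean b x r\<bar> * v = \<bar>LINT y:B x r|lebesgue. c - b y\<bar>"
    using v(1) by (simp add: abs_mult left_diff_distrib[symmetric])
  also have "ennreal \<dots> \<le> (\<integral>\<^sup>+y. norm (indicator (B x r) y *\<^sub>R (c - b y)) \<partial>lebesgue)"
    using integral_norm_bound_ennreal[OF int[unfolded set_integrable_def]]
    unfolding set_lebesgue_integral_def by simp
  also have "\<dots> = (\<integral>\<^sup>+y\<in>B x r. ennreal \<bar>c - b y\<bar> \<partial>lebesgue)"
    by (intro nn_integral_cong) (auto simp: indicator_def)
  finally show ?thesis using v(1) by (simp add: ennreal_mult v_def[symmetric])
qed

text \<open>Comparing \<open>b\<close> with a mean of \<open>b\<close> rather than with its values reduces the mean oscillation used by
  Campanato to the double integral that the maximal commutator controls.\<close>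

lemma nn_integral_diff_mean_le:
  assumes b: "b \<in> L1_loc" and r: "0 < r" and S: "S \<in> sets lebesgue"
  shows "(\<integral>\<^sup>+x\<in>S. ennreal \<bar>b x - mean b z r\<bar> \<partial>lebesgue) * ennreal (unit_vol * r ^ hdim) \<le>
    (\<integral>\<^sup>+x\<in>S. (\<integral>\<^sup>+y\<in>B z r. ennreal \<bar>b x - b y\<bar> \<partial>lebesgue) \<partial>lebesgue)"
proof -
  have [measurable]: "b \<in> borel_measurable lebesgue" "S \<in> sets lebesgue"
    using b S by (auto intro: L1_loc_measurable)
  have "(\<integral>\<^sup>+x\<in>S. ennreal \<bar>b x - mean b z r\<bar> \<partial>lebesgue) * ennreal (unit_vol * r ^ hdim) =
     (\<integral>\<^sup>+x. (ennreal \<bar>b x - mean b z r\<bar> * indicator S x) * ennreal (unit_vol * r ^ hdim) \<partial>lebesgue)"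
    by (intro nn_integral_multc[symmetric]) measurable
  also have "\<dots> \<le> (\<integral>\<^sup>+x\<in>S. (\<integral>\<^sup>+y\<in>B z r. ennreal \<bar>b x - b y\<bar> \<partial>lebesgue) \<partial>lebesgue)"
    using diff_mean_le[OF b r] by (intro nn_integral_mono) (auto simp: indicator_def)
  finally show ?thesis .
qed

lemma B_mono: "r \<le> s \<Longrightarrow> B x r \<subseteq> B x s"
  by (auto simp: mem_B)

text \<open>Means over comparable balls inside a ball of radius \<open>R\<close> differ by at most a constant times \<open>R^\<beta>\<close>.
  Summing a geometric series over dyadic radii shows that the means around \<open>x\<close> converge to some \<open>b' x\<close>
  at rate \<open>r^\<beta>\<close>, and comparing means around \<open>x\<close> and \<open>y\<close> at the scale of their distance shows that
  \<open>b'\<close> is Lipschitz. The integral of \<open>|b - b'|\<close> over a ball of radius \<open>R\<close> is at most a constant times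
  \<open>R^\<beta>\<close> times its volume. Covering a compact set by balls of radius \<open>R\<close> with bounded total volume and
  letting \<open>R\<close> tend to 0 gives \<open>b = b'\<close> almost everywhere.\<close>

lemma campanato_lipschitz:
  assumes b: "b \<in> L1_loc" and \<beta>: "0 < \<beta>" and A: "0 < A"
    and osc: "\<And>z r. 0 < r \<Longrightarrow>
      (\<integral>\<^sup>+x\<in>B z r. (\<integral>\<^sup>+y\<in>B z r. ennreal \<bar>b x - b y\<bar> \<partial>lebesgue) \<partial>lebesgue)
        \<le> ennreal (A * r powr \<beta> * (unit_vol * r ^ hdim)\<^sup>2)"
  shows "b \<in> lipschitz_space mul \<rho> \<beta>"
proof -
  have [measurable]: "b \<in> borel_measurable lebesgue" using b by (rule L1_loc_measurable)
  define vol where "vol r = unit_vol * r ^ hdim" for r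
  have vol: "0 < vol r" if "0 < r" for r using that unit_vol_pos by (simp add: vol_def)
  have mean_dist: "\<bar>mean b z r - mean b w s\<bar> \<le> A * R powr \<beta> * k ^ (2 * hdim)"
    if rs: "0 < r" "0 < s" and sub: "B z r \<subseteq> B c R" "B w s \<subseteq> B c R" and k: "R \<le> k * r" "R \<le> k * s"
      and R: "0 < R" for z w c r s R k
  proof -
    have "ennreal \<bar>mean b z r - mean b w s\<bar> * ennreal (vol r) \<le> (\<integral>\<^sup>+x\<in>B z r. ennreal \<bar>mean b w s - b x\<bar> \<partial>lebesgue)"
      using diff_mean_le[OF b rs(1), of "mean b w s" z] by (simp add: vol_def abs_minus_commute)
    then have "ennreal \<bar>mean b z r - mean b w s\<bar> * ennreal (vol r) * ennreal (vol s) \<le>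
        (\<integral>\<^sup>+x\<in>B z r. ennreal \<bar>b x - mean b w s\<bar> \<partial>lebesgue) * ennreal (vol s)"
      by (intro mult_right_mono) (auto simp: abs_minus_commute)
    also have "\<dots> \<le> (\<integral>\<^sup>+x\<in>B z r. (\<integral>\<^sup>+y\<in>B w s. ennreal \<bar>b x - b y\<bar> \<partial>lebesgue) \<partial>lebesgue)"
      unfolding vol_def by (intro nn_integral_diff_mean_le b rs B_sets)
    also have "\<dots> \<le> (\<integral>\<^sup>+x\<in>B c R. (\<integral>\<^sup>+y\<in>B c R. ennreal \<bar>b x - b y\<bar> \<partial>lebesgue) \<partial>lebesgue)"
      using sub by (intro nn_integral_mono mult_mono) (auto simp: indicator_def)
    also have "\<dots> \<le> ennreal (A * R powr \<beta> * (vol R)\<^sup>2)"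
      unfolding vol_def using R by (rule osc)
    finally have "ennreal (\<bar>mean b z r - mean b w s\<bar> * vol r * vol s) \<le> ennreal (A * R powr \<beta> * (vol R)\<^sup>2)"
      using vol[OF rs(1)] vol[OF rs(2)] by (simp add: ennreal_mult)
    then have le: "\<bar>mean b z r - mean b w s\<bar> * (vol r * vol s) \<le> A * R powr \<beta> * (vol R)\<^sup>2"
      using A by (subst (asm) ennreal_le_iff) (auto simp: mult.assoc)
    have volR: "vol R \<le> k ^ hdim * vol t" if "R \<le> k * t" for t
    proof -
      have "R ^ hdim \<le> (k * t) ^ hdim" using that R by (intro power_mono) auto
      then have "unit_vol * R ^ hdim \<le> unit_vol * (k * t) ^ hdim"
        using unit_vol_pos by (intro mult_left_mono) auto
      then show ?thesis by (simp add: vol_def power_mult_distrib mult_ac)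
    qed
    have "(vol R)\<^sup>2 \<le> (k ^ hdim * vol r) * (k ^ hdim * vol s)"
      unfolding power2_eq_square using volR[OF k(1)] volR[OF k(2)] vol[OF R] by (intro mult_mono) auto
    also have "\<dots> = k ^ (2 * hdim) * (vol r * vol s)" by (simp add: mult_2 power_add)
    finally have "A * R powr \<beta> * (vol R)\<^sup>2 \<le> A * R powr \<beta> * (k ^ (2 * hdim) * (vol r * vol s))"
      using A by (intro mult_left_mono) auto
    with le have "\<bar>mean b z r - mean b w s\<bar> * (vol r * vol s) \<le> A * R powr \<beta> * k ^ (2 * hdim) * (vol r * vol s)"
      by (simp add: mult.assoc)
    then show ?thesis using vol[OF rs(1)] vol[OF rs(2)] by (simp add: mult_le_cancel_right_pos)
  qed
  define q where "q = (1 / 2) powr \<beta>"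
  have q: "0 < q" "q < 1" using \<beta> gr_one_powr[of 2 \<beta>] by (simp_all add: q_def powr_divide)
  define A0 where "A0 = A * 2 ^ (2 * hdim)"
  have A0: "0 < A0" using A by (simp add: A0_def)
  define A1 where "A1 = A0 / (1 - q)"
  have A1: "0 < A1" using A0 q by (simp add: A1_def)
  have half: "\<bar>mean b x s - mean b x r\<bar> \<le> A0 * r powr \<beta>" if "r / 2 \<le> s" "s \<le> r" "0 < r" for x r s
    using mean_dist[of s r x x r x 2] that B_mono[of s r x] by (simp add: A0_def mult_ac)
  have tele: "\<bar>mean b x s - mean b x r\<bar> \<le> A0 * r powr \<beta> * (\<Sum>j<k. q ^ j)"
    if "r / 2 ^ k \<le> s" "s \<le> r" "0 < r" for x r s k
    using that
  proof (induction k arbitrary: r)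
    case (Suc k)
    have S: "(\<Sum>j<Suc k. q ^ j) = 1 + q * (\<Sum>j<k. q ^ j)"
      by (simp only: sum.lessThan_Suc_shift power_0 power_Suc sum_distrib_left)
    show ?case
    proof (cases "r / 2 \<le> s")
      case True
      have "A0 * r powr \<beta> * 1 \<le> A0 * r powr \<beta> * (\<Sum>j<Suc k. q ^ j)"
        unfolding S using A0 q by (intro mult_left_mono) (auto intro!: sum_nonneg mult_nonneg_nonneg)
      then show ?thesis using half[OF True Suc.prems(2,3), of x] by simp
    next
      case False
      have "\<bar>mean b x s - mean b x (r / 2)\<bar> \<le> A0 * (r / 2) powr \<beta> * (\<Sum>j<k. q ^ j)"
        using Suc.prems False by (intro Suc.IH) auto
      moreover have "(r / 2) powr \<beta> = r powr \<beta> * q"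
        using Suc.prems by (simp add: q_def powr_divide)
      moreover have "\<bar>mean b x (r / 2) - mean b x r\<bar> \<le> A0 * r powr \<beta>"
        using half[of r "r / 2" x] Suc.prems by simp
      ultimately show ?thesis unfolding S by (simp add: algebra_simps)
    qed
  qed simp
  have cauchy: "\<bar>mean b x s - mean b x r\<bar> \<le> A1 * r powr \<beta>" if sr: "0 < s" "s \<le> r" for x r s
  proof -
    obtain k where "r / s < 2 ^ k" using real_arch_pow[of 2 "r / s"] by auto
    then have "r / 2 ^ k \<le> s" using sr by (simp add: field_simps)
    then have "\<bar>mean b x s - mean b x r\<bar> \<le> A0 * r powr \<beta> * (\<Sum>j<k. q ^ j)"
      using sr by (intro tele) auto
    also have "\<dots> \<le> A0 * r powr \<beta> * (1 / (1 - q))"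
    proof (intro mult_left_mono)
      have "(\<Sum>j<k. q ^ j) \<le> (\<Sum>j. q ^ j)" using q by (intro sum_le_suminf) auto
      then show "(\<Sum>j<k. q ^ j) \<le> 1 / (1 - q)" using q by (simp add: suminf_geometric)
    qed (use A0 in auto)
    finally show ?thesis by (simp add: A1_def)
  qed
  define b' where "b' x = lim (\<lambda>k. mean b x ((1 / 2) ^ k))" for x
  have lim: "(\<lambda>k. mean b x ((1 / 2) ^ k)) \<longlonglongrightarrow> b' x" for x
  proof -
    have "Cauchy (\<lambda>k. mean b x ((1 / 2) ^ k))"
    proof (rule metric_CauchyI)
      fix e :: real assume e: "0 < e"
      have "(\<lambda>k. A1 * q ^ k) \<longlonglongrightarrow> A1 * 0"
        using q by (intro tendsto_intros LIMSEQ_realpow_zero) auto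
      then have "eventually (\<lambda>k. A1 * q ^ k < e / 2) sequentially"
        using e by (intro order_tendstoD) auto
      then obtain M where M: "A1 * q ^ M < e / 2" by (auto simp: eventually_sequentially)
      have "\<bar>mean b x ((1 / 2) ^ n) - mean b x ((1 / 2) ^ M)\<bar> < e / 2" if "M \<le> n" for n
      proof -
        have "((1 / 2) ^ M) powr \<beta> = q ^ M"
          by (simp add: q_def powr_realpow[symmetric] powr_powr mult.commute)
        then show ?thesis
          using cauchy[of "(1 / 2) ^ n" "(1 / 2) ^ M" x] M that power_decreasing[of M n "1 / 2 :: real"] by simp
      qed
      then show "\<exists>M. \<forall>m\<ge>M. \<forall>n\<ge>M. dist (mean b x ((1 / 2) ^ m)) (mean b x ((1 / 2) ^ n)) < e"
        unfolding dist_real_def by (intro exI[of _ M] allI impI) (smt (verit) field_sum_of_halves)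
    qed
    then show ?thesis unfolding b'_def using Cauchy_convergent_iff convergent_LIMSEQ_iff by blast
  qed
  have b'_mean: "\<bar>b' x - mean b x r\<bar> \<le> A1 * r powr \<beta>" if r: "0 < r" for x r
  proof (rule tendsto_upperbound)
    show "(\<lambda>k. \<bar>mean b x ((1 / 2) ^ k) - mean b x r\<bar>) \<longlonglongrightarrow> \<bar>b' x - mean b x r\<bar>"
      by (intro tendsto_intros lim)
    have "(\<lambda>k. (1 / 2 :: real) ^ k) \<longlonglongrightarrow> 0" by (intro LIMSEQ_realpow_zero) auto
    then have "eventually (\<lambda>k. (1 / 2 :: real) ^ k < r) sequentially" using r by (intro order_tendstoD)
    then show "eventually (\<lambda>k. \<bar>mean b x ((1 / 2) ^ k) - mean b x r\<bar> \<le> A1 * r powr \<beta>) sequentially"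
      by eventually_elim (rule cauchy, auto)
  qed simp
  define L where "L = (2 * A1 + A * \<kappa> powr \<beta> * \<kappa> ^ (2 * hdim)) * 2 powr \<beta>"
  have L: "0 < L" using A A1 kappa_pos by (simp add: L_def add_pos_pos)
  have lip: "\<bar>b' x - b' y\<bar> \<le> L * qd x y powr \<beta>" for x y
  proof (cases "x = y")
    case False
    define r where "r = 2 * qd x y"
    have "0 < qd x y" using qd_nonneg[of x y] qd_eq_0[of x y] False by linarith
    then have r: "0 < r" "qd x y < r" by (auto simp: r_def)
    have "x \<in> B x r \<inter> B y r" "x \<in> B x r \<inter> B x r"
      using r by (auto simp: mem_B qd_commute[of y x])
    then have sub: "B x r \<subseteq> B x (\<kappa> * r)" "B y r \<subseteq> B x (\<kappa> * r)"
      by (intro B_engulf; blast)+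
    have "\<bar>mean b x r - mean b y r\<bar> \<le> A * (\<kappa> * r) powr \<beta> * \<kappa> ^ (2 * hdim)"
      using r kappa_pos by (intro mean_dist[OF _ _ sub]) auto
    then have "\<bar>b' x - b' y\<bar> \<le> 2 * (A1 * r powr \<beta>) + A * (\<kappa> * r) powr \<beta> * \<kappa> ^ (2 * hdim)"
      using b'_mean[OF r(1), of x] b'_mean[OF r(1), of y] by linarith
    also have "\<dots> = L * qd x y powr \<beta>"
      using \<open>0 < qd x y\<close> kappa_pos by (simp add: L_def r_def powr_mult algebra_simps)
    finally show ?thesis .
  qed simp
  have "continuous_on UNIV b'"
  proof (intro continuous_at_imp_continuous_on ballI)
    fix y
    have "continuous_on UNIV (\<lambda>x. qd x y)" by (intro continuous_intros)
    then have "isCont (\<lambda>x. qd x y) y" by (simp add: continuous_on_eq_continuous_at)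
    then have "((\<lambda>x. qd x y) \<longlongrightarrow> 0) (at y)" by (simp add: isCont_def)
    then have "((\<lambda>x. L * qd x y powr \<beta>) \<longlongrightarrow> L * 0) (at y)"
      using \<beta> tendsto_powr2[of "\<lambda>x. qd x y" 0 "at y" "\<lambda>_. \<beta>" \<beta>] by (intro tendsto_mult tendsto_const) auto
    then have "((\<lambda>x. b' x - b' y) \<longlongrightarrow> 0) (at y)"
      using Lim_null_comparison[of "\<lambda>x. b' x - b' y" "\<lambda>x. L * qd x y powr \<beta>" "at y"] lip by simp
    then show "isCont b' y" by (simp add: isCont_def LIM_zero_iff)
  qed
  then have "b' \<in> borel_measurable borel" by (rule borel_measurable_continuous_onI)
  then have [measurable]: "b' \<in> borel_measurable lebesgue"
    by (simp add: measurable_completion)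
  define A2 where "A2 = A + A1 + L"
  have A2: "0 < A2" using A A1 L by (simp add: A2_def)
  have local: "(\<integral>\<^sup>+x\<in>B z R. ennreal \<bar>b x - b' x\<bar> \<partial>lebesgue) \<le> ennreal (A2 * R powr \<beta> * vol R)"
    if R: "0 < R" for z R
  proof -
    have "(\<integral>\<^sup>+x\<in>B z R. ennreal \<bar>b x - mean b z R\<bar> \<partial>lebesgue) * ennreal (vol R) \<le> ennreal (A * R powr \<beta> * (vol R)\<^sup>2)"
      using nn_integral_diff_mean_le[OF b R B_sets(2)[of z R], of z] osc[OF R, of z]
      unfolding vol_def by (rule order_trans)
    then have "ennreal (1 / vol R) * ((\<integral>\<^sup>+x\<in>B z R. ennreal \<bar>b x - mean b z R\<bar> \<partial>lebesgue) * ennreal (vol R))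
        \<le> ennreal (1 / vol R) * ennreal (A * R powr \<beta> * (vol R)\<^sup>2)"
      by (rule mult_left_mono) simp
    moreover have "ennreal (1 / vol R) * (i * ennreal (vol R)) = i" for i
      using vol[OF R] by (simp add: mult.left_commute[of "ennreal _"] ennreal_mult[symmetric])
    moreover have "ennreal (1 / vol R) * ennreal (A * R powr \<beta> * (vol R)\<^sup>2) = ennreal (A * R powr \<beta> * vol R)"
      using vol[OF R] A by (subst ennreal_mult[symmetric]) (auto simp: power2_eq_square)
    ultimately have 1: "(\<integral>\<^sup>+x\<in>B z R. ennreal \<bar>b x - mean b z R\<bar> \<partial>lebesgue) \<le> ennreal (A * R powr \<beta> * vol R)"
      by simp
    have pt: "\<bar>b x - b' x\<bar> \<le> \<bar>b x - mean b z R\<bar> + (A1 + L) * R powr \<beta>" if "x \<in> B z R" for x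
    proof -
      have "\<bar>b' x - b' z\<bar> \<le> L * R powr \<beta>"
      proof -
        have "qd x z powr \<beta> \<le> R powr \<beta>"
          using that \<beta> by (intro powr_mono2) (auto simp: mem_B qd_commute[of z x])
        then have "L * qd x z powr \<beta> \<le> L * R powr \<beta>" using L by (intro mult_left_mono) auto
        then show ?thesis using lip[of x z] by linarith
      qed
      then show ?thesis using b'_mean[OF R, of z] by (simp add: algebra_simps)
    qed
    have "(\<integral>\<^sup>+x\<in>B z R. ennreal \<bar>b x - b' x\<bar> \<partial>lebesgue) \<le>
        (\<integral>\<^sup>+x. ennreal \<bar>b x - mean b z R\<bar> * indicator (B z R) x + ennreal ((A1 + L) * R powr \<beta>) * indicator (B z R) x \<partial>lebesgue)"
    proof (intro nn_integral_mono)
      fix x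
      show "ennreal \<bar>b x - b' x\<bar> * indicator (B z R) x \<le>
        ennreal \<bar>b x - mean b z R\<bar> * indicator (B z R) x + ennreal ((A1 + L) * R powr \<beta>) * indicator (B z R) x"
        using pt[of x] A1 L
        by (cases "x \<in> B z R") (auto simp: ennreal_plus[symmetric] simp del: ennreal_plus intro!: ennreal_leI)
    qed
    also have "\<dots> = (\<integral>\<^sup>+x\<in>B z R. ennreal \<bar>b x - mean b z R\<bar> \<partial>lebesgue) + ennreal ((A1 + L) * R powr \<beta>) * ennreal (vol R)"
      using R by (subst nn_integral_add) (auto simp: nn_integral_cmult_indicator emeasure_B vol_def)
    also have "\<dots> \<le> ennreal (A * R powr \<beta> * vol R) + ennreal ((A1 + L) * R powr \<beta>) * ennreal (vol R)"
      using 1 by (rule add_right_mono)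
    also have "\<dots> = ennreal (A2 * R powr \<beta> * vol R)"
      using A A1 L vol[OF R]
      by (simp add: ennreal_mult[symmetric] ennreal_plus[symmetric] A2_def algebra_simps del: ennreal_plus)
    finally show ?thesis .
  qed
  have zero: "(\<integral>\<^sup>+x\<in>K. ennreal \<bar>b x - b' x\<bar> \<partial>lebesgue) = 0" if K: "compact K" for K
  proof -
    have "bounded (\<rho> ` K)"
      using K continuous_on_subset[OF cont_rho subset_UNIV] by (intro compact_imp_bounded compact_continuous_image)
    then obtain R0 where R0: "\<And>z. z \<in> K \<Longrightarrow> \<rho> z \<le> R0"
      by (auto simp: bounded_iff)
    \<comment> \<open>A single ball that contains all balls of radius at most 1 with centre in \<open>K\<close>.\<close>
    define W where "W = B 0 (c0 * (\<bar>R0\<bar> + 2))"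
    have W: "B z r \<subseteq> W" if "z \<in> K" "r \<le> 1" for z r
    proof
      fix y assume "y \<in> B z r"
      then have "qd 0 z + qd z y < \<bar>R0\<bar> + 2"
        using R0[OF that(1)] that(2) by (simp add: mem_B qd_def)
      then have "c0 * (qd 0 z + qd z y) < c0 * (\<bar>R0\<bar> + 2)"
        using c0(1) by (intro mult_strict_left_mono) auto
      then show "y \<in> W" using qd_triangle[of 0 y z] by (simp add: W_def mem_B)
    qed
    obtain w where w: "emeasure lebesgue W = ennreal w" "0 \<le> w"
      using emeasure_B_finite[of 0 "c0 * (\<bar>R0\<bar> + 2)"] unfolding W_def
      by (cases "emeasure lborel (B 0 (c0 * (\<bar>R0\<bar> + 2)))") auto
    have small: "(\<integral>\<^sup>+x\<in>K. ennreal \<bar>b x - b' x\<bar> \<partial>lebesgue) \<le> ennreal (A2 * (\<kappa> * r) powr \<beta> * \<kappa> ^ hdim * w)"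
      if r: "0 < r" "r \<le> 1" for r
    proof -
      have "K \<subseteq> (\<Union>(z, s)\<in>K \<times> {r}. B z s)" using center_in_B[OF r(1)] by auto
      from Vitali_compact[OF K this] r(1) obtain D where D: "finite D" "D \<subseteq> K \<times> {r}"
        "disjoint_family_on (\<lambda>(z, r). B z r) D" "K \<subseteq> (\<Union>(z, r)\<in>D. B z (\<kappa> * r))" by auto
      let ?h = "\<lambda>x. ennreal \<bar>b x - b' x\<bar>"
      have "(\<integral>\<^sup>+x\<in>K. ?h x \<partial>lebesgue) \<le> (\<integral>\<^sup>+x. (\<Sum>p\<in>D. ?h x * indicator (B (fst p) (\<kappa> * r)) x) \<partial>lebesgue)"
      proof (intro nn_integral_mono)
        fix x
        show "?h x * indicator K x \<le> (\<Sum>p\<in>D. ?h x * indicator (B (fst p) (\<kappa> * r)) x)"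
        proof (cases "x \<in> K")
          case True
          then obtain p where p: "p \<in> D" "x \<in> B (fst p) (\<kappa> * r)" using D(2,4) by fastforce
          have "?h x * indicator K x \<le> ?h x * indicator (B (fst p) (\<kappa> * r)) x" using p True by simp
          also have "\<dots> \<le> (\<Sum>p\<in>D. ?h x * indicator (B (fst p) (\<kappa> * r)) x)"
            using p(1) D(1) by (intro member_le_sum) auto
          finally show ?thesis .
        qed simp
      qed
      also have "\<dots> = (\<Sum>p\<in>D. \<integral>\<^sup>+x\<in>B (fst p) (\<kappa> * r). ?h x \<partial>lebesgue)"
        by (intro nn_integral_sum) measurable
      also have "\<dots> \<le> (\<Sum>p\<in>D. ennreal (A2 * (\<kappa> * r) powr \<beta> * vol (\<kappa> * r)))"
        using r kappa_pos by (intro sum_mono local) auto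
      also have "\<dots> = ennreal (A2 * (\<kappa> * r) powr \<beta> * \<kappa> ^ hdim) * (\<Sum>p\<in>D. emeasure lebesgue (B (fst p) (snd p)))"
      proof -
        have "emeasure lebesgue (B (fst p) (snd p)) = ennreal (vol r)" if "p \<in> D" for p
          using that D(2) r by (auto simp: emeasure_B vol_def)
        moreover have "vol (\<kappa> * r) = \<kappa> ^ hdim * vol r" by (simp add: vol_def power_mult_distrib)
        ultimately show ?thesis
          unfolding sum_distrib_left using A2 kappa_pos vol[OF r(1)]
          by (intro sum.cong) (auto simp: ennreal_mult[symmetric] mult_ac)
      qed
      also have "(\<Sum>p\<in>D. emeasure lebesgue (B (fst p) (snd p))) = emeasure lebesgue (\<Union>p\<in>D. B (fst p) (snd p))"
        using D(1,3) by (intro sum_emeasure) (auto simp: disjoint_family_on_def case_prod_beta)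
      also have "ennreal (A2 * (\<kappa> * r) powr \<beta> * \<kappa> ^ hdim) * \<dots> \<le>
          ennreal (A2 * (\<kappa> * r) powr \<beta> * \<kappa> ^ hdim) * ennreal w"
      proof (rule mult_left_mono)
        have "(\<Union>p\<in>D. B (fst p) (snd p)) \<subseteq> W" using D(2) r(2) W by fastforce
        then show "emeasure lebesgue (\<Union>p\<in>D. B (fst p) (snd p)) \<le> ennreal w"
          unfolding w(1)[symmetric] by (rule emeasure_mono) (simp add: W_def)
      qed simp
      also have "\<dots> = ennreal (A2 * (\<kappa> * r) powr \<beta> * \<kappa> ^ hdim * w)"
        using A2 kappa_pos w(2) by (intro ennreal_mult[symmetric]) auto
      finally show ?thesis .
    qed
    have "((\<lambda>r. A2 * (\<kappa> * r) powr \<beta> * \<kappa> ^ hdim * w) \<longlongrightarrow> A2 * 0 * \<kappa> ^ hdim * w) (at_right 0)"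
    proof (intro tendsto_mult tendsto_const)
      have "((\<lambda>r. \<kappa> * r) \<longlongrightarrow> \<kappa> * 0) (at_right 0)" by (intro tendsto_intros)
      then show "((\<lambda>r. (\<kappa> * r) powr \<beta>) \<longlongrightarrow> 0) (at_right 0)"
        using \<beta> kappa_pos tendsto_powr2[of "\<lambda>r. \<kappa> * r" 0 "at_right 0" "\<lambda>_. \<beta>" \<beta>]
        by (simp add: eventually_at_filter)
    qed
    then have "((\<lambda>r. ennreal (A2 * (\<kappa> * r) powr \<beta> * \<kappa> ^ hdim * w)) \<longlongrightarrow> ennreal 0) (at_right 0)"
      by (intro tendsto_ennrealI) simp
    moreover have "eventually (\<lambda>r. (\<integral>\<^sup>+x\<in>K. ennreal \<bar>b x - b' x\<bar> \<partial>lebesgue) \<le>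
        ennreal (A2 * (\<kappa> * r) powr \<beta> * \<kappa> ^ hdim * w)) (at_right 0)"
      unfolding eventually_at_right_field using small by (intro exI[of _ 1]) auto
    ultimately have "(\<integral>\<^sup>+x\<in>K. ennreal \<bar>b x - b' x\<bar> \<partial>lebesgue) \<le> ennreal 0"
      by (intro tendsto_lowerbound) auto
    then show ?thesis by simp
  qed
  have "AE x in lebesgue. \<forall>n::nat. x \<in> cball 0 (real n) \<longrightarrow> b x = b' x"
  proof (subst AE_all_countable, rule allI)
    fix n :: nat
    have [measurable]: "cball (0 :: 'a) (real n) \<in> sets lebesgue" by simp
    have "AE x in lebesgue. ennreal \<bar>b x - b' x\<bar> * indicator (cball 0 (real n)) x = 0"
      using zero[OF compact_cball[of 0 "real n"]] by (subst (asm) nn_integral_0_iff_AE) auto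
    then show "AE x in lebesgue. x \<in> cball 0 (real n) \<longrightarrow> b x = b' x"
      by eventually_elim (auto simp: indicator_def ennreal_eq_0_iff split: if_splits)
  qed
  then have "AE x in lebesgue. b x = b' x"
  proof eventually_elim
    case (elim x)
    then show ?case using real_arch_simple[of "norm x"] by auto
  qed
  then show ?thesis
    unfolding lipschitz_space_def using lip[unfolded qd_def] by blast
qed

lemma lipschitz_necessary:
  assumes \<Phi>: "young_function \<Phi>" and \<Psi>: "young_function \<Psi>" and \<beta>: "0 < \<beta>" and b: "b \<in> L1_loc"
    and C: "0 < C" "\<And>t. 0 < t \<Longrightarrow> young_inverse \<Psi> t \<le> C * young_inverse \<Phi> t * t powr (- \<beta> / real hdim)"
    and dec: "0 < \<epsilon>" "almost_decreasing (\<lambda>t. ennreal (t powr (1 + \<epsilon>)) / \<Psi> t)"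
    and bdd: "bounded_orlicz_weak_orlicz \<Phi> \<Psi> (maximal_commutator mul \<rho> b)"
  shows "b \<in> lipschitz_space mul \<rho> \<beta>"
proof -
  obtain A where "0 < A" "\<And>z r. 0 < r \<Longrightarrow>
      (\<integral>\<^sup>+x\<in>B z r. (\<integral>\<^sup>+y\<in>B z r. ennreal \<bar>b x - b y\<bar> \<partial>lebesgue) \<partial>lebesgue)
        \<le> ennreal (A * r powr \<beta> * (unit_vol * r ^ hdim)\<^sup>2)"
    using oscillation_bound[OF \<Phi> \<Psi> refl L1_loc_measurable[OF b] C(1) _ dec bdd, of \<beta>] C(2) by auto
  then show ?thesis by (rule campanato_lipschitz[OF b \<beta>])
qed

end

theorem theorem3p11:
  fixes mul br :: "'a::euclidean_space \<Rightarrow> 'a \<Rightarrow> 'a"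
    and V :: "nat \<Rightarrow> 'a set" and m :: nat
    and \<rho> b :: "'a \<Rightarrow> real" and \<beta> Q :: real
    and \<Phi> \<Psi> :: "real \<Rightarrow> ennreal"
  assumes G: "stratified_lie_group mul br V m"
    and Q: "Q = real (homogeneous_dim V m)"
    and \<rho>: "homogeneous_norm mul V m \<rho>"
    and \<beta>: "0 < \<beta>" "\<beta> < 1"
    and b: "b \<in> L1_loc"
    and \<Phi>: "young_function \<Phi>" "\<Phi> \<in> young_class_Y"
    and \<Psi>: "young_function \<Psi>"
  shows
    "((\<exists>C>0. \<forall>t>0. t powr (- \<beta> / Q) * young_inverse \<Phi> t \<le> C * young_inverse \<Psi> t) \<longrightarrow>
        (b \<in> lipschitz_space mul \<rho> \<beta> \<longrightarrow>
         bounded_orlicz_weak_orlicz \<Phi> \<Psi> (maximal_commutator mul \<rho> b)))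
     \<and>
     ((\<exists>C>0. \<forall>t>0. young_inverse \<Psi> t \<le> C * young_inverse \<Phi> t * t powr (- \<beta> / Q)) \<and>
      (\<exists>\<epsilon>>0. almost_decreasing (\<lambda>t. ennreal (t powr (1 + \<epsilon>)) / \<Psi> t)) \<longrightarrow>
        (bounded_orlicz_weak_orlicz \<Phi> \<Psi> (maximal_commutator mul \<rho> b) \<longrightarrow>
         b \<in> lipschitz_space mul \<rho> \<beta>))
     \<and>
     ((\<exists>C>0. \<forall>t>0. young_inverse \<Psi> t \<le> C * (young_inverse \<Phi> t * t powr (- \<beta> / Q))) \<and>
      (\<exists>C>0. \<forall>t>0. young_inverse \<Phi> t * t powr (- \<beta> / Q) \<le> C * young_inverse \<Psi> t) \<and>
      (\<exists>\<epsilon>>0. almost_decreasing (\<lambda>t. ennreal (t powr (1 + \<epsilon>)) / \<Psi> t)) \<longrightarrow>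
        (b \<in> lipschitz_space mul \<rho> \<beta> \<longleftrightarrow>
         bounded_orlicz_weak_orlicz \<Phi> \<Psi> (maximal_commutator mul \<rho> b)))"
    (is "(?upper \<longrightarrow> (?lip \<longrightarrow> ?bdd)) \<and> (?lower \<and> ?dec \<longrightarrow> (?bdd \<longrightarrow> ?lip)) \<and> (?lower' \<and> ?upper' \<and> ?dec \<longrightarrow> _)")
proof -
  interpret homogeneous_group mul br V m \<rho>
    using G \<rho> by unfold_locales (auto simp: stratified_lie_group_def)
  have fin: "\<Phi> r < \<infinity>" if "0 < r" for r
    using \<Phi>(2) that by (auto simp: young_class_Y_def)
  have suff: "?lip \<longrightarrow> ?bdd" if ?upper
    using that lipschitz_sufficient[OF \<Phi>(1) fin \<Psi> \<beta>(1)] unfolding Q by blast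
  have nec: "?bdd \<longrightarrow> ?lip" if ?lower ?dec
    using that lipschitz_necessary[OF \<Phi>(1) \<Psi> \<beta>(1) b] unfolding Q by blast
  have "?upper' \<longleftrightarrow> ?upper" by (simp add: mult.commute)
  moreover have "?lower' \<longleftrightarrow> ?lower" by (simp add: mult.assoc)
  ultimately show ?thesis using suff nec by blast
qed

end
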